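(* Let $p\geqslant 1$ be an integer, let $\mu,\nu\in P_p(\mathbb{R}^d)$, and let $c(x,y)=h(x-y)$ be a cost satisfying the standing assumption (see context) with this $p$. Then $$T_c(P_{\mu\leqslant},\nu)=D_c(P_{\mu\leqslant},\nu)=D_c(\mu,P_{\leqslant\nu})=T_c(\mu,P_{\leqslant\nu}).$$ Moreover: (i) if $\varphi\in\mathcal{A}\cap L^1(d\nu)$ is optimal for the backward dual $D_c(\mu,P_{\leqslant\nu})$, then $Q_c(\varphi)\in\mathcal{A}\cap C_{b,p}$ and $Q_c(\varphi)$ is optimal for the forward dual $D_c(P_{\mu\leqslant},\nu)$; (ii) if $\psi\in\mathcal{A}\cap C_{b,p}$ is optimal for the forward dual $D_c(P_{\mu\leqslant},\nu)$, then $Q_{\bar c}(\psi)\in\mathcal{A}\cap L^1(d\nu)$ and $Q_{\bar c}(\psi)$ is optimal for the backward dual $D_c(\mu,P_{\leqslant\nu})$.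
   Context: $P_p(\mathbb{R}^d)$ is the set of Borel probability measures on $\mathbb{R}^d$ with finite $p$-th moment. $\mathcal{A}$ is the set of real-valued convex functions on $\mathbb{R}^d$. $C_{b,p}$ is the set of continuous $f:\mathbb{R}^d\to\mathbb{R}$ such that $f(x)/(1+|x|^p)$ is bounded. Convex order: $\mu\leqslant_{cx}\nu$ iff $\int\varphi\,d\mu\leqslant\int\varphi\,d\nu$ for all $\varphi\in\mathcal{A}$. $P_{\leqslant\nu}=\{\eta\in P_1(\mathbb{R}^d):\eta\leqslant_{cx}\nu\}$, $P_{\mu\leqslant}=\{\xi\in P_1(\mathbb{R}^d):\mu\leqslant_{cx}\xi\}$. Standing assumption on the cost: $c(x,y)=h(x-y)$ with $h:\mathbb{R}^d\to[0,\infty)$ strictly convex such that for some $a>0$, $\inf_{|z|\geqslant a}h(z)/|z|>0$ and $\sup_{|z|\geqslant a}h(z)/|z|^p<\infty$. $T_c(\mu,\eta)$ is the optimal transport cost (infimum of $\int c\,d\pi$ over couplings $\pi$ of $\mu,\eta$); the backward and forward Wasserstein projections are $T_c(\mu,P_{\leqslant\nu})=\inf_{\eta\in P_{\leqslant\nu}}T_c(\mu,\eta)$ and $T_c(P_{\mu\leqslant},\nu)=\inf_{\xi\in P_{\mu\leqslant}}T_c(\xi,\nu)$. Transforms: $Q_c(\varphi)(x)=\inf_{y}\{\varphi(y)+c(x,y)\}$, $Q_{\bar c}(\psi)(y)=\sup_{x}\{\psi(x)-c(x,y)\}$. Dual problems: $D_c(\mu,P_{\leqslant\nu})=\sup_{\varphi\in\mathcal{A}\cap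 C_{b,p}}\{\int Q_c(\varphi)d\mu-\int\varphi\,d\nu\}$ (backward; the class may be relaxed to $\mathcal{A}\cap L^1(d\nu)$ without changing the supremum) and $D_c(P_{\mu\leqslant},\nu)=\sup_{\psi\in\mathcal{A}\cap C_{b,p}}\{\int\psi\,d\mu-\int Q_{\bar c}(\psi)d\nu\}$ (forward). A function is optimal for the dual if the corresponding functional evaluated at it equals the supremum.
   Formalization: In (ii), Q_{c̄}(ψ) may equal +∞ at some points (e.g. h=|z|², μ=ν=δ_0, ψ=|x|²): it is shown convex with values in (-∞,∞], ν-integrable and optimal for the backward dual, and to lie in A∩L¹(dν) whenever it is real-valued. *)

theory Defs
  imports "HOL-Probability.Probability"
begin

(* Integral of an extended real function: positive part minus negative part.
   It is meaningful when at most one of the two is infinite; recall that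
   \<infinity> - \<infinity> = \<infinity> in ereal.  In every use below one part is finite:
   real convex functions are bounded below by affine functions, which are integrable
   for measures with finite first moment, and the transforms of functions in the dual
   classes are dominated from one side by integrable functions.
   The Bochner integral would return 0 for convex functions with integral \<infinity>. *)
definition ext_integral :: "'a measure \<Rightarrow> ('a \<Rightarrow> ereal) \<Rightarrow> ereal" where
  "ext_integral M f =
     enn2ereal (\<integral>\<^sup>+ x. e2ennreal (f x) \<partial>M) - enn2ereal (\<integral>\<^sup>+ x. e2ennreal (- f x) \<partial>M)"

lemma ext_integral_eq_lebesgue_integral:
  fixes f :: "'a \<Rightarrow> real"
  assumes "integrable M f"
  shows "ext_integral M (\<lambda>x. ereal (f x)) = ereal (integral\<^sup>L M f)"
proof -
  obtain r q where rq: "0 \<le> r" "0 \<le> q"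
    "(\<integral>\<^sup>+ x. ennreal (f x) \<partial>M) = ennreal r" "(\<integral>\<^sup>+ x. ennreal (- f x) \<partial>M) = ennreal q"
    "integral\<^sup>L M f = r - q"
    using integrableE[OF assms] by metis
  show ?thesis
    unfolding ext_integral_def uminus_ereal.simps e2ennreal_ereal rq
    using rq(1,2) by (simp add: enn2ereal_ennreal)
qed

definition L1 :: "'a measure \<Rightarrow> ('a \<Rightarrow> real) set" where
  "L1 M = {f. integrable M f}"

definition ext_L1 :: "'a measure \<Rightarrow> ('a \<Rightarrow> ereal) set" where
  "ext_L1 M = {f. f \<in> borel_measurable M \<and> (\<integral>\<^sup>+ x. e2ennreal \<bar>f x\<bar> \<partial>M) < \<infinity>}"

definition P :: "nat \<Rightarrow> 'a::euclidean_space measure set" where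
  "P p = {M. prob_space M \<and> sets M = sets borel \<and> integrable M (\<lambda>x. norm x ^ p)}"

definition convex_funs :: "('a::euclidean_space \<Rightarrow> real) set" where
  "convex_funs = {f. convex_on UNIV f}"

(* Convex functions with values in (-\<infinity>, \<infinity>].  Needed because the sup-transform of a
   real-valued convex function of growth p can take the value \<infinity>: for the cost
   |x - y|^2 and \<psi> = |x|^2 it is 0 at the origin and \<infinity> elsewhere.
   Note 0 * \<infinity> = 0 in ereal. *)
definition ext_convex_funs :: "('a::euclidean_space \<Rightarrow> ereal) set" where
  "ext_convex_funs = {f. (\<forall>x. f x \<noteq> -\<infinity>) \<and>
     (\<forall>x y. \<forall>u\<ge>0. \<forall>v\<ge>0. u + v = 1 \<longrightarrow>
        f (u *\<^sub>R x + v *\<^sub>R y) \<le> ereal u * f x + ereal v * f y)}"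

definition C_b :: "nat \<Rightarrow> ('a::euclidean_space \<Rightarrow> real) set" where
  "C_b p = {f. continuous_on UNIV f \<and> bounded (range (\<lambda>x. f x / (1 + norm x ^ p)))}"

definition convex_order :: "'a::euclidean_space measure \<Rightarrow> 'a measure \<Rightarrow> bool"
    (infix "\<le>\<^sub>c\<^sub>x" 50) where
  "\<mu> \<le>\<^sub>c\<^sub>x \<nu> \<longleftrightarrow>
     (\<forall>\<phi>\<in>convex_funs. ext_integral \<mu> (\<lambda>x. ereal (\<phi> x)) \<le> ext_integral \<nu> (\<lambda>x. ereal (\<phi> x)))"

definition P_below :: "'a::euclidean_space measure \<Rightarrow> 'a measure set" where
  "P_below \<nu> = {\<eta> \<in> P 1. \<eta> \<le>\<^sub>c\<^sub>x \<nu>}"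

definition P_above :: "'a::euclidean_space measure \<Rightarrow> 'a measure set" where
  "P_above \<mu> = {\<xi> \<in> P 1. \<mu> \<le>\<^sub>c\<^sub>x \<xi>}"

definition strictly_convex :: "('a::real_vector \<Rightarrow> real) \<Rightarrow> bool" where
  "strictly_convex h \<longleftrightarrow>
     (\<forall>x y t. x \<noteq> y \<longrightarrow> 0 < t \<longrightarrow> t < 1 \<longrightarrow>
        h ((1 - t) *\<^sub>R x + t *\<^sub>R y) < (1 - t) * h x + t * h y)"

definition admissible_cost :: "nat \<Rightarrow> ('a::euclidean_space \<Rightarrow> real) \<Rightarrow> bool" where
  "admissible_cost p h \<longleftrightarrow> (\<forall>z. 0 \<le> h z) \<and> strictly_convex h \<and>
     (\<exists>a>0. 0 < (INF z\<in>{z. a \<le> norm z}. ereal (h z / norm z)) \<and>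
            (SUP z\<in>{z. a \<le> norm z}. ereal (h z / norm z ^ p)) < \<infinity>)"

definition couplings ::
    "'a::euclidean_space measure \<Rightarrow> 'a measure \<Rightarrow> ('a \<times> 'a) measure set" where
  "couplings \<mu> \<eta> = {\<pi>. prob_space \<pi> \<and> sets \<pi> = sets (borel \<Otimes>\<^sub>M borel) \<and>
     distr \<pi> borel fst = \<mu> \<and> distr \<pi> borel snd = \<eta>}"

definition T :: "('a::euclidean_space \<Rightarrow> 'a \<Rightarrow> real) \<Rightarrow> 'a measure \<Rightarrow> 'a measure \<Rightarrow> ereal" where
  "T c \<mu> \<eta> = (INF \<pi>\<in>couplings \<mu> \<eta>. ext_integral \<pi> (\<lambda>(x, y). ereal (c x y)))"

definition T_backward ::
    "('a::euclidean_space \<Rightarrow> 'a \<Rightarrow> real) \<Rightarrow> 'a measure \<Rightarrow> 'a measure \<Rightarrow> ereal" where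
  "T_backward c \<mu> \<nu> = (INF \<eta>\<in>P_below \<nu>. T c \<mu> \<eta>)"

definition T_forward ::
    "('a::euclidean_space \<Rightarrow> 'a \<Rightarrow> real) \<Rightarrow> 'a measure \<Rightarrow> 'a measure \<Rightarrow> ereal" where
  "T_forward c \<mu> \<nu> = (INF \<xi>\<in>P_above \<mu>. T c \<xi> \<nu>)"

definition Q :: "('a \<Rightarrow> 'a \<Rightarrow> real) \<Rightarrow> ('a \<Rightarrow> ereal) \<Rightarrow> 'a \<Rightarrow> ereal" where
  "Q c \<phi> x = (INF y. \<phi> y + ereal (c x y))"

definition Q_bar :: "('a \<Rightarrow> 'a \<Rightarrow> real) \<Rightarrow> ('a \<Rightarrow> ereal) \<Rightarrow> 'a \<Rightarrow> ereal" where
  "Q_bar c \<psi> y = (SUP x. \<psi> x - ereal (c x y))"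

definition J_backward ::
    "('a \<Rightarrow> 'a \<Rightarrow> real) \<Rightarrow> 'a measure \<Rightarrow> 'a measure \<Rightarrow> ('a \<Rightarrow> ereal) \<Rightarrow> ereal" where
  "J_backward c \<mu> \<nu> \<phi> = ext_integral \<mu> (Q c \<phi>) - ext_integral \<nu> \<phi>"

definition J_forward ::
    "('a \<Rightarrow> 'a \<Rightarrow> real) \<Rightarrow> 'a measure \<Rightarrow> 'a measure \<Rightarrow> ('a \<Rightarrow> ereal) \<Rightarrow> ereal" where
  "J_forward c \<mu> \<nu> \<psi> = ext_integral \<mu> \<psi> - ext_integral \<nu> (Q_bar c \<psi>)"

definition D_backward ::
    "nat \<Rightarrow> ('a::euclidean_space \<Rightarrow> 'a \<Rightarrow> real) \<Rightarrow> 'a measure \<Rightarrow> 'a measure \<Rightarrow> ereal" where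
  "D_backward p c \<mu> \<nu> = (SUP \<phi>\<in>convex_funs \<inter> C_b p. J_backward c \<mu> \<nu> (ereal \<circ> \<phi>))"

definition D_forward ::
    "nat \<Rightarrow> ('a::euclidean_space \<Rightarrow> 'a \<Rightarrow> real) \<Rightarrow> 'a measure \<Rightarrow> 'a measure \<Rightarrow> ereal" where
  "D_forward p c \<mu> \<nu> = (SUP \<psi>\<in>convex_funs \<inter> C_b p. J_forward c \<mu> \<nu> (ereal \<circ> \<psi>))"

definition backward_optimal ::
    "nat \<Rightarrow> ('a::euclidean_space \<Rightarrow> 'a \<Rightarrow> real) \<Rightarrow> 'a measure \<Rightarrow> 'a measure \<Rightarrow>
      ('a \<Rightarrow> ereal) \<Rightarrow> bool" where
  "backward_optimal p c \<mu> \<nu> \<phi> \<longleftrightarrow> J_backward c \<mu> \<nu> \<phi> = D_backward p c \<mu> \<nu>"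

definition forward_optimal ::
    "nat \<Rightarrow> ('a::euclidean_space \<Rightarrow> 'a \<Rightarrow> real) \<Rightarrow> 'a measure \<Rightarrow> 'a measure \<Rightarrow>
      ('a \<Rightarrow> ereal) \<Rightarrow> bool" where
  "forward_optimal p c \<mu> \<nu> \<psi> \<longleftrightarrow> J_forward c \<mu> \<nu> \<psi> = D_forward p c \<mu> \<nu>"

end

theory Submission
  imports Defs
begin

text \<open>
  Both primal values are dominated by the weak transport value, the infimum of
  \<open>E h(X - E(Z | X))\<close> over couplings \<open>(X, Z)\<close> of \<open>\<mu>\<close> and \<open>\<nu>\<close>: with \<open>Y = E(Z | X)\<close>, the law of \<open>Y\<close>
  is below \<open>\<nu>\<close>, the law of \<open>X + Z - Y\<close> is above \<open>\<mu>\<close>, and \<open>(X, Y)\<close> and \<open>(X + Z - Y, Z)\<close> have the same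
  displacement. Weak duality and the two transforms give
  \<open>D\<^sub>b \<le> D\<^sub>f \<le> min(T\<^sub>f, T\<^sub>b)\<close>, so it remains to bound the weak transport value by \<open>D\<^sub>b\<close>.
  Replacing \<open>\<mu>\<close> by the barycentres of a finite partition only decreases the dual value, since
  \<open>Q\<^sub>c \<phi>\<close> is convex, and changes the primal cost by little, since \<open>h\<close> is convex with \<open>p\<close>-growth and
  the \<open>p\<close>-th moment of \<open>Y\<close> is bounded by that of \<open>\<nu>\<close>. For finitely many points the duality
  is a finite-dimensional separation argument, with maxima of finitely many affine functions as dual
  potentials.
\<close>

section \<open>Subgradients\<close>

text \<open>No infimum or supremum is shown to be attained; every comparison carries an epsilon, and
  optimisers are exchanged only by sandwiching values. Two obstacles shape the rest. The
  sup-transform of a potential may be infinite, while the convex order speaks of real functions, so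
  the transform is written as an increasing limit of real convex functions. And the non-compact
  space is cut into small cells inside a ball and one unbounded outer cell, where only moments help.
  There the p-th moments of both \<open>\<mu>\<close> and \<open>\<nu>\<close> must be small, the
  second because the barycentre assigned to the outer cell may lie far away however light that cell
  is. In the finite problem a perturbation of the constraints (masses and barycentres) can make them
  infeasible, so they are penalised. The multipliers of the penalised problem are the slopes and
  intercepts of the affine functions, and a near-minimiser is repaired to be exactly
  feasible.\<close>

text \<open>A Hahn-Banach extension: the functional is extended by one coordinate at a time, so each
  separation takes place in the Euclidean space \<open>'b \<times> real\<close> although the index
  type is arbitrary.\<close>

lemma convex_family_subgradient:
  fixes F :: "('i \<Rightarrow> 'b::euclidean_space) \<Rightarrow> real"
  assumes "finite I"
    and conv: "\<And>e e' u v. 0 \<le> u \<Longrightarrow> 0 \<le> v \<Longrightarrow> u + v = 1 \<Longrightarrow>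
      F (\<lambda>i. u *\<^sub>R e i + v *\<^sub>R e' i) \<le> u * F e + v * F e'"
  shows "\<exists>q. \<forall>e. (\<forall>i. i \<notin> I \<longrightarrow> e i = 0) \<longrightarrow> F (\<lambda>_. 0) + (\<Sum>i\<in>I. q i \<bullet> e i) \<le> F e"
  using \<open>finite I\<close>
proof (induction I)
  case empty
  have "F (\<lambda>_. 0) \<le> F e" if "\<forall>i. e i = 0" for e
  proof -
    have "e = (\<lambda>_. 0)" using that by auto
    then show ?thesis by simp
  qed
  then show ?case by auto
next
  case (insert j I)
  then obtain q where q: "\<And>e. (\<forall>i. i \<notin> I \<longrightarrow> e i = 0) \<Longrightarrow>
      F (\<lambda>_. 0) + (\<Sum>i\<in>I. q i \<bullet> e i) \<le> F e" by blast
  \<comment> \<open>The strict epigraph of the infimal projection to coordinate \<open>j\<close> of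
    \<open>F\<close> minus the functional already found. Strictness is what keeps
    \<open>(0, F (\<lambda>_. 0))\<close> outside.\<close>
  define A where "A = {(b, s). \<exists>e. (\<forall>i. i \<notin> I \<longrightarrow> e i = 0) \<and>
      F (e(j := b)) - (\<Sum>i\<in>I. q i \<bullet> e i) < s}"
  have in_A: "(b, F (e(j := b)) - (\<Sum>i\<in>I. q i \<bullet> e i) + r) \<in> A"
    if "\<forall>i. i \<notin> I \<longrightarrow> e i = 0" "0 < r" for b r e
    unfolding A_def using that by auto
  have "convex A"
  proof (rule convexI)
    fix a a' :: "'b \<times> real" and u v :: real
    assume a: "a \<in> A" "a' \<in> A" and uv: "0 \<le> u" "0 \<le> v" "u + v = 1"
    obtain b s b' s' where ab: "a = (b, s)" "a' = (b', s')" by (cases a, cases a')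
    obtain e where e: "\<forall>i. i \<notin> I \<longrightarrow> e i = 0" "F (e(j := b)) - (\<Sum>i\<in>I. q i \<bullet> e i) < s"
      using a ab unfolding A_def by auto
    obtain e' where e': "\<forall>i. i \<notin> I \<longrightarrow> e' i = 0" "F (e'(j := b')) - (\<Sum>i\<in>I. q i \<bullet> e' i) < s'"
      using a ab unfolding A_def by auto
    define w where "w = (\<lambda>i. u *\<^sub>R e i + v *\<^sub>R e' i)"
    have w0: "\<forall>i. i \<notin> I \<longrightarrow> w i = 0" using e(1) e'(1) by (simp add: w_def)
    have "F (w(j := u *\<^sub>R b + v *\<^sub>R b')) = F (\<lambda>i. u *\<^sub>R (e(j := b)) i + v *\<^sub>R (e'(j := b')) i)"
      by (rule arg_cong[where f = F]) (auto simp: w_def)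
    also have "\<dots> \<le> u * F (e(j := b)) + v * F (e'(j := b'))" by (rule conv[OF uv])
    finally have 1: "F (w(j := u *\<^sub>R b + v *\<^sub>R b')) \<le> u * F (e(j := b)) + v * F (e'(j := b'))" .
    have 2: "(\<Sum>i\<in>I. q i \<bullet> w i) = u * (\<Sum>i\<in>I. q i \<bullet> e i) + v * (\<Sum>i\<in>I. q i \<bullet> e' i)"
      by (simp add: w_def inner_add_right sum.distrib sum_distrib_left)
    have "u * (F (e(j := b)) - (\<Sum>i\<in>I. q i \<bullet> e i)) + v * (F (e'(j := b')) - (\<Sum>i\<in>I. q i \<bullet> e' i))
        < u * s + v * s'"
    proof (cases "u = 0")
      case True then show ?thesis using uv e'(2) by simp
    next
      case False
      then have "u * (F (e(j := b)) - (\<Sum>i\<in>I. q i \<bullet> e i)) < u * s" using e(2) uv(1) by simp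
      moreover have "v * (F (e'(j := b')) - (\<Sum>i\<in>I. q i \<bullet> e' i)) \<le> v * s'"
        using e'(2) uv(2) by (intro mult_left_mono) auto
      ultimately show ?thesis by linarith
    qed
    then have "F (w(j := u *\<^sub>R b + v *\<^sub>R b')) - (\<Sum>i\<in>I. q i \<bullet> w i) < u * s + v * s'"
      using 1 2 by (simp add: algebra_simps)
    then show "u *\<^sub>R a + v *\<^sub>R a' \<in> A"
      unfolding ab A_def using w0 by auto
  qed
  moreover have "(0, F (\<lambda>_. 0)) \<notin> A"
  proof
    assume "(0, F (\<lambda>_. 0)) \<in> A"
    then obtain e where e: "\<forall>i. i \<notin> I \<longrightarrow> e i = 0"
      "F (e(j := 0)) - (\<Sum>i\<in>I. q i \<bullet> e i) < F (\<lambda>_. 0)" unfolding A_def by auto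
    then have "e(j := 0) = e" using insert.hyps(2) by auto
    then show False using e q[OF e(1)] by simp
  qed
  moreover have "A \<noteq> {}" using in_A[of "\<lambda>_. 0" 1 0] by auto
  ultimately obtain \<alpha> \<beta> where sep: "\<alpha> \<noteq> 0" "\<forall>x\<in>{(0, F (\<lambda>_. 0))}. \<alpha> \<bullet> x \<le> \<beta>"
      "\<forall>x\<in>A. \<beta> \<le> \<alpha> \<bullet> x"
    using separating_hyperplane_sets[of "{(0, F (\<lambda>_. 0))}" A] by blast
  obtain a \<tau> where a\<tau>: "\<alpha> = (a, \<tau>)" by (cases \<alpha>)
  have key: "\<tau> * F (\<lambda>_. 0) \<le> a \<bullet> b + \<tau> * (F (e(j := b)) - (\<Sum>i\<in>I. q i \<bullet> e i) + r)"
    if "\<forall>i. i \<notin> I \<longrightarrow> e i = 0" "0 < r" for b r e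
    using sep(2) bspec[OF sep(3) in_A[OF that, of b]] by (simp add: a\<tau>)
  \<comment> \<open>The hyperplane is not vertical. The set is unbounded upwards, so a negative
    \<open>\<tau>\<close> fails for large \<open>r\<close>; and it lies over all of
    \<open>'b\<close> because \<open>F\<close> is real, so \<open>\<tau> = 0\<close> forces
    \<open>a = 0\<close>, tested at \<open>b = - a\<close>.\<close>
  have "0 < \<tau>"
  proof (rule ccontr)
    assume "\<not> 0 < \<tau>"
    moreover have "\<not> \<tau> < 0"
    proof
      assume neg: "\<tau> < 0"
      define g where "g = \<tau> * F ((\<lambda>_. 0)(j := 0)) - \<tau> * F (\<lambda>_. 0)"
      have "0 \<le> g + \<tau> * r" if "0 < r" for r
        using key[of "\<lambda>_. 0" r 0] that by (simp add: g_def algebra_simps)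
      from this[of "(\<bar>g\<bar> + 1) / - \<tau>"] neg have "0 \<le> g - (\<bar>g\<bar> + 1)"
        by (simp add: divide_pos_neg)
      then show False by linarith
    qed
    ultimately have t0: "\<tau> = 0" by simp
    have "0 \<le> a \<bullet> (- a)" using key[of "\<lambda>_. 0" 1 "- a"] t0 by simp
    then have "a = 0" using inner_ge_zero[of a] inner_eq_zero_iff[of a] by simp
    then show False using sep(1) a\<tau> t0 by (simp add: zero_prod_def)
  qed
  \<comment> \<open>Dividing the separating inequality by \<open>\<tau>\<close> turns minus its
    slope into the missing coordinate of the subgradient.\<close>
  define q' where "q' = q(j := - a /\<^sub>R \<tau>)"
  have "F (\<lambda>_. 0) + (\<Sum>i\<in>insert j I. q' i \<bullet> e i) \<le> F e"
    if e: "\<forall>i. i \<notin> insert j I \<longrightarrow> e i = 0" for e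
  proof -
    define e0 where "e0 = e(j := 0)"
    have e0: "\<forall>i. i \<notin> I \<longrightarrow> e0 i = 0" using e by (auto simp: e0_def)
    have [simp]: "e0(j := e j) = e" by (auto simp: e0_def)
    have s: "(\<Sum>i\<in>I. q i \<bullet> e0 i) = (\<Sum>i\<in>I. q' i \<bullet> e i)"
      using insert.hyps(2) by (intro sum.cong) (auto simp: e0_def q'_def)
    have "F (\<lambda>_. 0) + (\<Sum>i\<in>insert j I. q' i \<bullet> e i) \<le> F e + r" if "0 < r" for r
    proof -
      have "\<tau> * F (\<lambda>_. 0) \<le> a \<bullet> e j + \<tau> * (F e - (\<Sum>i\<in>I. q' i \<bullet> e i) + r)"
        using key[OF e0 that, of "e j"] s by simp
      then have "F (\<lambda>_. 0) \<le> (a \<bullet> e j + \<tau> * (F e - (\<Sum>i\<in>I. q' i \<bullet> e i) + r)) / \<tau>"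
        using \<open>0 < \<tau>\<close> by (simp add: pos_le_divide_eq mult.commute)
      also have "\<dots> = (a \<bullet> e j) / \<tau> + (F e - (\<Sum>i\<in>I. q' i \<bullet> e i) + r)"
        using \<open>0 < \<tau>\<close> by (simp add: add_divide_distrib)
      finally show ?thesis using insert.hyps
        by (simp add: q'_def divide_inverse mult.commute)
    qed
    then show ?thesis by (rule field_le_epsilon)
  qed
  then show ?case by blast
qed

lemma convex_subgradient:
  fixes f :: "'b::euclidean_space \<Rightarrow> real"
  assumes "convex_on UNIV f"
  obtains q where "\<And>x. f x0 + q \<bullet> (x - x0) \<le> f x"
proof -
  \<comment> \<open>A single vector is a family over \<open>unit\<close>; a translation moves the
    base point to the origin.\<close>
  have "\<exists>q. \<forall>e. (\<forall>i. i \<notin> {()} \<longrightarrow> e i = 0) \<longrightarrow>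
      f ((\<lambda>_. 0) () + x0) + (\<Sum>i\<in>{()}. q i \<bullet> e i) \<le> f (e () + x0)"
  proof (rule convex_family_subgradient)
    fix e e' :: "unit \<Rightarrow> 'b" and u v :: real
    assume uv: "0 \<le> u" "0 \<le> v" "u + v = 1"
    have "(u *\<^sub>R e () + v *\<^sub>R e' ()) + x0 = u *\<^sub>R (e () + x0) + v *\<^sub>R (e' () + x0)"
      using uv(3) by (simp add: algebra_simps flip: scaleR_add_left)
    then show "f (u *\<^sub>R e () + v *\<^sub>R e' () + x0) \<le> u * f (e () + x0) + v * f (e' () + x0)"
      using assms uv by (simp add: convex_on_def)
  qed simp
  then obtain q where q: "\<And>e. f x0 + q () \<bullet> e () \<le> f (e () + x0)" by auto
  show ?thesis by (rule that[of "q ()"]) (use q[of "\<lambda>_. x - x0" for x] in auto)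
qed

text \<open>Prolong the segment from \<open>u\<close> to \<open>v\<close> by one unit to
  \<open>w\<close>; then \<open>v\<close> is the mean of \<open>u\<close> and \<open>w\<close> with
  weights \<open>1 / (1 + s)\<close> and \<open>s / (1 + s)\<close>, where \<open>s\<close> is the
  distance. The bound on \<open>h\<close> is required only up to one unit beyond
  \<open>norm v\<close>, so \<open>u\<close> is unrestricted.\<close>

lemma convex_nonneg_diff_le:
  fixes h :: "'b::real_normed_vector \<Rightarrow> real"
  assumes conv: "convex_on UNIV h" and nonneg: "\<And>z. 0 \<le> h z"
    and B: "\<And>z. norm z \<le> norm v + 1 \<Longrightarrow> h z \<le> B"
  shows "h v \<le> h u + norm (v - u) * B"
proof (cases "u = v")
  case False
  define s where "s = norm (v - u)"
  have s: "0 < s" using False by (simp add: s_def)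
  define w where "w = v + (v - u) /\<^sub>R s"
  have "norm w \<le> norm v + norm ((v - u) /\<^sub>R s)" unfolding w_def by (rule norm_triangle_ineq)
  also have "norm ((v - u) /\<^sub>R s) = 1" using s by (simp add: s_def)
  finally have hw: "h w \<le> B" by (rule B)
  have veq: "v = (1 / (1 + s)) *\<^sub>R u + (s / (1 + s)) *\<^sub>R w"
  proof -
    have "(1 + s) *\<^sub>R ((1 / (1 + s)) *\<^sub>R u + (s / (1 + s)) *\<^sub>R w) = u + s *\<^sub>R w"
      using s by (simp add: scaleR_add_right)
    also have "\<dots> = (1 + s) *\<^sub>R v" using s by (simp add: w_def algebra_simps)
    finally show ?thesis using s by simp
  qed
  have "h v \<le> (1 / (1 + s)) * h u + (s / (1 + s)) * h w"
  proof -
    have "1 / (1 + s) + s / (1 + s) = 1" using s by (simp add: field_simps)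
    then have "h ((1 / (1 + s)) *\<^sub>R u + (s / (1 + s)) *\<^sub>R w)
        \<le> (1 / (1 + s)) * h u + (s / (1 + s)) * h w"
      using conv s unfolding convex_on_def by (metis UNIV_I add_pos_pos divide_nonneg_pos less_eq_real_def zero_less_one)
    then show ?thesis using veq by simp
  qed
  then have "(1 + s) * h v \<le> (1 + s) * ((1 / (1 + s)) * h u + (s / (1 + s)) * h w)"
    using s by (intro mult_left_mono) auto
  also have "\<dots> = h u + s * h w" using s by (simp add: distrib_left)
  finally have "h v + s * h v \<le> h u + s * h w" by (simp add: algebra_simps)
  moreover have "s * h w \<le> s * B" "0 \<le> s * h v" using s hw nonneg[of v] by auto
  ultimately show ?thesis unfolding s_def by linarith
qed simp

section \<open>Weak transport from a finite set\<close>

text \<open>Disintegration over the target: \<open>\<rho> i z\<close> is the probability that the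
  mass arriving at \<open>z\<close> comes from the source point \<open>i\<close>. With
  \<open>\<nu>\<close>-integrals \<open>m i\<close> this encodes a coupling of a finitely supported
  measure with \<open>\<nu>\<close>.\<close>

definition partitions_of_unity :: "'i set \<Rightarrow> ('i \<Rightarrow> 'a::topological_space \<Rightarrow> real) set" where
  "partitions_of_unity I = {\<rho>. (\<forall>i\<in>I. \<rho> i \<in> borel_measurable borel \<and> (\<forall>z. 0 \<le> \<rho> i z)) \<and>
     (\<forall>z. (\<Sum>i\<in>I. \<rho> i z) = 1)}"

lemma partitions_of_unityD:
  assumes "\<rho> \<in> partitions_of_unity I"
  shows "i \<in> I \<Longrightarrow> \<rho> i \<in> borel_measurable borel" "i \<in> I \<Longrightarrow> 0 \<le> \<rho> i z" "(\<Sum>i\<in>I. \<rho> i z) = 1"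
  using assms by (auto simp: partitions_of_unity_def)

lemma partitions_of_unity_le_1:
  assumes "\<rho> \<in> partitions_of_unity I" "finite I" "i \<in> I"
  shows "\<rho> i z \<le> 1"
  using member_le_sum[of i I "\<lambda>i. \<rho> i z"] partitions_of_unityD[OF assms(1)] assms(2,3) by auto

lemma integrable_partition_scaleR:
  fixes f :: "'a::topological_space \<Rightarrow> 'b::{banach, second_countable_topology}"
  assumes \<rho>: "\<rho> \<in> partitions_of_unity I" "finite I" "i \<in> I"
    and M: "sets M = sets borel" and f: "integrable M f"
  shows "integrable M (\<lambda>z. \<rho> i z *\<^sub>R f z)"
proof (rule Bochner_Integration.integrable_bound[OF f])
  have [measurable]: "\<rho> i \<in> borel_measurable M"
    using partitions_of_unityD(1)[OF \<rho>(1,3)] M by (simp cong: measurable_cong_sets)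
  have [measurable]: "f \<in> borel_measurable M" using f by simp
  show "(\<lambda>z. \<rho> i z *\<^sub>R f z) \<in> borel_measurable M" by measurable
  show "AE z in M. norm (\<rho> i z *\<^sub>R f z) \<le> norm (f z)"
    using partitions_of_unityD(2)[OF \<rho>(1,3)] partitions_of_unity_le_1[OF \<rho>]
    by (auto intro!: mult_left_le_one_le)
qed

lemma partitions_of_unity_mix:
  assumes "\<rho> \<in> partitions_of_unity I" "\<sigma> \<in> partitions_of_unity I" "0 \<le> u" "0 \<le> v" "u + v = 1"
  shows "(\<lambda>i z. u * \<rho> i z + v * \<sigma> i z) \<in> partitions_of_unity I"
  using assms
  by (auto simp: partitions_of_unity_def sum.distrib simp flip: sum_distrib_left
      intro!: borel_measurable_add borel_measurable_times)

text \<open>Lagrangian duality for minimising the sum of \<open>m i * h (x i - y i)\<close> when the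
  piece \<open>\<rho> i\<close> of \<open>\<nu>\<close> must have mass \<open>m i\<close> and
  barycentre \<open>y i\<close>; \<open>r i\<close> and \<open>p i\<close> are the multipliers. As
  \<open>w\<close> is arbitrary and each affine function lies below the maximum, the right-hand side
  yields the dual functional of that maximum.\<close>

lemma finite_weak_transport_duality:
  fixes \<nu> :: "'a::euclidean_space measure" and I :: "'i set" and m :: "'i \<Rightarrow> real"
    and x :: "'i \<Rightarrow> 'a" and h :: "'a \<Rightarrow> real"
  assumes \<nu>: "prob_space \<nu>" "sets \<nu> = sets borel" "integrable \<nu> (\<lambda>z. z)"
    and I: "finite I" and m_pos: "\<And>i. i \<in> I \<Longrightarrow> 0 < m i" and m_sum: "(\<Sum>i\<in>I. m i) = 1"
    and h: "convex_on UNIV h" "\<And>z. 0 \<le> h z" and "0 < \<epsilon>"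
  obtains \<rho> p r where "\<rho> \<in> partitions_of_unity I" "\<And>i. i \<in> I \<Longrightarrow> (\<integral>z. \<rho> i z \<partial>\<nu>) = m i"
    "\<And>w. (\<Sum>i\<in>I. m i * h (x i - (\<integral>z. \<rho> i z *\<^sub>R z \<partial>\<nu>) /\<^sub>R m i)) \<le>
       (\<Sum>i\<in>I. m i * (p i \<bullet> w i + r i + h (x i - w i))) -
       (\<integral>z. Max ((\<lambda>i. p i \<bullet> z + r i) ` I) \<partial>\<nu>) + \<epsilon>"
proof -
  interpret prob_space \<nu> by fact
  have I_ne: "I \<noteq> {}" using m_sum by auto
  note int_id = \<nu>(3)
  have int_norm: "integrable \<nu> (\<lambda>z. norm z)" using int_id by simp
  have int_\<rho>z: "integrable \<nu> (\<lambda>z. \<rho> i z *\<^sub>R z)"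
    if "\<rho> \<in> partitions_of_unity I" "i \<in> I" for \<rho> and i :: 'i
    using integrable_partition_scaleR[OF that(1) I that(2) \<nu>(2) int_id] .
  have int_\<rho>: "integrable \<nu> (\<rho> i)"
    if "\<rho> \<in> partitions_of_unity I" "i \<in> I" for \<rho> and i :: 'i
    using integrable_partition_scaleR[OF that(1) I that(2) \<nu>(2), of "\<lambda>_. 1::real"] by simp
  define mass where "mass \<rho> i = (\<integral>z. \<rho> i z \<partial>\<nu>)" for \<rho> :: "'i \<Rightarrow> 'a \<Rightarrow> real" and i
  define bar where "bar \<rho> i = (\<integral>z. \<rho> i z *\<^sub>R z \<partial>\<nu>)" for \<rho> :: "'i \<Rightarrow> 'a \<Rightarrow> real" and i
  define M where "M = (\<integral>z. norm z \<partial>\<nu>)"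
  have M0: "0 \<le> M" by (simp add: M_def)
  have bar_le: "norm (bar \<rho> i) \<le> M" if "\<rho> \<in> partitions_of_unity I" "i \<in> I" for \<rho> i
    unfolding bar_def M_def
  proof (rule order_trans[OF integral_norm_bound
        integral_mono[OF integrable_norm[OF int_\<rho>z[OF that]] int_norm]])
    show "norm (\<rho> i z *\<^sub>R z) \<le> norm z" for z
      using partitions_of_unityD(2)[OF that] partitions_of_unity_le_1[OF that(1) I that(2)]
      by (auto intro!: mult_left_le_one_le)
  qed
  have m_le1: "m i \<le> 1" if "i \<in> I" for i
    using member_le_sum[of i I m] that m_sum m_pos I by (auto simp: less_imp_le)
  \<comment> \<open>The points \<open>y\<close> are decoupled from the barycentres of
    \<open>\<rho>\<close>; \<open>viol\<close> measures how far a pair is from being admissible, and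
    it is affine in the pair.\<close>
  define W where "W = (partitions_of_unity I :: ('i \<Rightarrow> 'a \<Rightarrow> real) set) \<times> (UNIV :: ('i \<Rightarrow> 'a) set)"
  define viol where "viol \<rho> y i = (bar \<rho> i - m i *\<^sub>R y i, mass \<rho> i - m i)"
    for \<rho> :: "'i \<Rightarrow> 'a \<Rightarrow> real" and y :: "'i \<Rightarrow> 'a" and i
  define cost where "cost y = (\<Sum>i\<in>I. m i * h (x i - y i))" for y
  have cost_nonneg: "0 \<le> cost y" for y
    unfolding cost_def using h(2) m_pos by (intro sum_nonneg) (auto simp: less_imp_le)
  define zb where "zb = (\<integral>z. z \<partial>\<nu>)"
  \<comment> \<open>Constant weights are the product coupling: feasible, with every barycentre at
    the mean of \<open>\<nu>\<close>. They bound the optimal value by \<open>C0\<close>.\<close>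
  define \<rho>c where "\<rho>c = (\<lambda>i (z::'a). m i)"
  have \<rho>c: "\<rho>c \<in> partitions_of_unity I"
    using m_pos m_sum by (auto simp: \<rho>c_def partitions_of_unity_def less_imp_le)
  define C0 where "C0 = cost (\<lambda>_. zb)"
  have viol0: "viol \<rho>c (\<lambda>_. zb) i = 0" if "i \<in> I" for i
    by (simp add: viol_def bar_def mass_def \<rho>c_def zb_def prob_space zero_prod_def)
  \<comment> \<open>The repaired points will satisfy \<open>norm (y' i) \<le> M / m i\<close>, so
    this ball contains all displacements \<open>x i - y' i\<close>, with the extra unit asked for by
    \<open>convex_nonneg_diff_le\<close>.\<close>
  have "bounded (h ` cball 0 (Max ((\<lambda>i. norm (x i) + M / m i) ` I) + 1))"
    by (intro compact_imp_bounded compact_continuous_image)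
       (auto intro: continuous_on_subset[OF convex_on_continuous[OF open_UNIV h(1)]])
  then obtain B where B': "\<forall>y\<in>h ` cball 0 (Max ((\<lambda>i. norm (x i) + M / m i) ` I) + 1). norm y \<le> B"
    unfolding bounded_iff by blast
  have B: "h z \<le> B" if "norm z \<le> Max ((\<lambda>i. norm (x i) + M / m i) ` I) + 1" for z
    using bspec[OF B', of "h z"] that by auto
  have B0: "0 \<le> B"
  proof -
    obtain i where i: "i \<in> I" using I_ne by blast
    have "norm (x i) + M / m i \<le> Max ((\<lambda>i. norm (x i) + M / m i) ` I)"
      using i I by (intro Max_ge) auto
    moreover have "0 \<le> norm (x i) + M / m i" using M0 m_pos[OF i] by simp
    ultimately show ?thesis using B[of 0] h(2)[of 0] by simp
  qed
  define mm where "mm = Min (m ` I)"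
  have mm: "0 < mm" "\<And>i. i \<in> I \<Longrightarrow> mm \<le> m i"
    using I I_ne m_pos by (auto simp: mm_def)
  \<comment> \<open>\<open>K * \<theta>\<close> will bound the cost of the repair, to which each
    index contributes \<open>\<theta> * ((3 * M / mm + 1) * B)\<close>. The summand 1 makes
    \<open>K\<close> positive.\<close>
  define K where "K = real (card I) * ((3 * M / mm + 1) * B) + 1"
  have K: "0 < K" unfolding K_def using M0 mm(1) B0 by (intro add_nonneg_pos) auto
  define \<theta> where "\<theta> = min mm (\<epsilon> / 2 / K)"
  have \<theta>: "0 < \<theta>" "\<theta> \<le> mm" "K * \<theta> \<le> \<epsilon> / 2"
    using mm(1) K \<open>0 < \<epsilon>\<close> by (auto simp: \<theta>_def min_def field_simps)
  \<comment> \<open>With this weight, a pair of penalised value at most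
    \<open>C0 + \<epsilon>\<close> violates the constraints by at most \<open>\<theta>\<close> in
    total.\<close>
  define k where "k = (C0 + \<epsilon>) / \<theta>"
  have k: "0 < k" using cost_nonneg[of "\<lambda>_. zb"] \<open>0 < \<epsilon>\<close> \<theta>(1) by (simp add: k_def C0_def)
  \<comment> \<open>The perturbation \<open>e\<close> prescribes a violation. Penalising the
    deviation from it keeps the value \<open>F\<close> finite for every \<open>e\<close>, including
    those that no pair realises, so \<open>F\<close> has a subgradient at 0.\<close>
  define \<Phi> where "\<Phi> w e = cost (snd w) + k * (\<Sum>i\<in>I. norm (viol (fst w) (snd w) i - e i))"
    for w and e :: "'i \<Rightarrow> 'a \<times> real"
  define F where "F e = (INF w\<in>W. \<Phi> w e)" for e
  have \<Phi>0: "0 \<le> \<Phi> w e" for w e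
    unfolding \<Phi>_def using cost_nonneg k by (intro add_nonneg_nonneg mult_nonneg_nonneg sum_nonneg) auto
  have W_ne: "W \<noteq> {}" using \<rho>c by (auto simp: W_def)
  have bdd: "bdd_below ((\<lambda>w. \<Phi> w e) ` W)" for e using \<Phi>0 by (auto intro!: bdd_belowI)
  have F_le: "F e \<le> \<Phi> w e" if "w \<in> W" for w e
    unfolding F_def by (rule cINF_lower[OF bdd that])
  have F_approx: "\<exists>w\<in>W. \<Phi> w e < F e + d" if "0 < d" for e d
    using cINF_less_iff[OF W_ne bdd, of e "F e + d"] that by (auto simp: F_def)

  \<comment> \<open>\<open>\<Phi>\<close> is jointly convex in the pair and the perturbation, hence
    its partial infimum is convex; the proof mixes two nearly optimal pairs.\<close>
  have F_convex: "F (\<lambda>i. u *\<^sub>R e i + v *\<^sub>R e' i) \<le> u * F e + v * F e'"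
    if uv: "0 \<le> u" "0 \<le> v" "u + v = 1" for e e' u v
  proof (rule field_le_epsilon)
    fix d :: real assume d: "0 < d"
    obtain w w' where w: "w \<in> W" "\<Phi> w e < F e + d" and w': "w' \<in> W" "\<Phi> w' e' < F e' + d"
      using F_approx[OF d] by metis
    obtain \<rho> y \<rho>' y' where wy: "w = (\<rho>, y)" "w' = (\<rho>', y')" by (cases w, cases w')
    have \<rho>: "\<rho> \<in> partitions_of_unity I" "\<rho>' \<in> partitions_of_unity I"
      using w(1) w'(1) wy by (auto simp: W_def)
    define \<sigma> where "\<sigma> = (\<lambda>i z. u * \<rho> i z + v * \<rho>' i z)"
    define s where "s = (\<lambda>i. u *\<^sub>R y i + v *\<^sub>R y' i)"
    have "(\<sigma>, s) \<in> W"
      using partitions_of_unity_mix[OF \<rho> uv] by (simp add: W_def \<sigma>_def)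
    then have "F (\<lambda>i. u *\<^sub>R e i + v *\<^sub>R e' i) \<le> \<Phi> (\<sigma>, s) (\<lambda>i. u *\<^sub>R e i + v *\<^sub>R e' i)"
      by (rule F_le)
    also have "\<dots> \<le> u * \<Phi> w e + v * \<Phi> w' e'"
    proof -
      have "cost s \<le> (\<Sum>i\<in>I. m i * (u * h (x i - y i) + v * h (x i - y' i)))"
        unfolding cost_def
      proof (intro sum_mono mult_left_mono)
        fix i assume i: "i \<in> I"
        show "0 \<le> m i" using m_pos[OF i] by simp
        have "x i = u *\<^sub>R x i + v *\<^sub>R x i" using uv(3) by (simp flip: scaleR_add_left)
        then have "x i - s i = u *\<^sub>R (x i - y i) + v *\<^sub>R (x i - y' i)"
          by (simp add: s_def algebra_simps)
        then show "h (x i - s i) \<le> u * h (x i - y i) + v * h (x i - y' i)"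
          using h(1) uv by (simp add: convex_on_def)
      qed
      also have "\<dots> = u * cost y + v * cost y'"
        by (simp add: cost_def sum_distrib_left sum.distrib algebra_simps)
      finally have 1: "cost s \<le> u * cost y + v * cost y'" .
      have "(\<Sum>i\<in>I. norm (viol \<sigma> s i - (u *\<^sub>R e i + v *\<^sub>R e' i))) \<le>
          (\<Sum>i\<in>I. u * norm (viol \<rho> y i - e i) + v * norm (viol \<rho>' y' i - e' i))"
      proof (rule sum_mono)
        fix i assume i: "i \<in> I"
        have b: "bar \<sigma> i = u *\<^sub>R bar \<rho> i + v *\<^sub>R bar \<rho>' i"
          unfolding bar_def \<sigma>_def using int_\<rho>z[OF \<rho>(1) i] int_\<rho>z[OF \<rho>(2) i]
          by (simp add: scaleR_add_left flip: scaleR_scaleR)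
        have ms: "mass \<sigma> i = u * mass \<rho> i + v * mass \<rho>' i"
          unfolding mass_def \<sigma>_def using int_\<rho>[OF \<rho>(1) i] int_\<rho>[OF \<rho>(2) i] by simp
        have "m i = u * m i + v * m i" using uv(3) by (simp flip: distrib_right)
        then have "viol \<sigma> s i = u *\<^sub>R viol \<rho> y i + v *\<^sub>R viol \<rho>' y' i"
          unfolding viol_def b ms s_def by (simp add: algebra_simps)
        then have "viol \<sigma> s i - (u *\<^sub>R e i + v *\<^sub>R e' i) =
            u *\<^sub>R (viol \<rho> y i - e i) + v *\<^sub>R (viol \<rho>' y' i - e' i)"
          by (simp add: algebra_simps)
        also have "norm \<dots> \<le> u * norm (viol \<rho> y i - e i) + v * norm (viol \<rho>' y' i - e' i)"
          using norm_triangle_ineq[of "u *\<^sub>R (viol \<rho> y i - e i)" "v *\<^sub>R (viol \<rho>' y' i - e' i)"] uv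
          by simp
        finally show "norm (viol \<sigma> s i - (u *\<^sub>R e i + v *\<^sub>R e' i)) \<le> \<dots>" .
      qed
      then have "k * (\<Sum>i\<in>I. norm (viol \<sigma> s i - (u *\<^sub>R e i + v *\<^sub>R e' i))) \<le>
          k * (u * (\<Sum>i\<in>I. norm (viol \<rho> y i - e i)) + v * (\<Sum>i\<in>I. norm (viol \<rho>' y' i - e' i)))"
        using k by (intro mult_left_mono) (auto simp: sum.distrib sum_distrib_left)
      then show ?thesis using 1 by (simp add: \<Phi>_def wy algebra_simps)
    qed
    also have "\<dots> \<le> u * (F e + d) + v * (F e' + d)"
      using w(2) w'(2) uv by (intro add_mono mult_left_mono) auto
    also have "\<dots> = u * F e + v * F e' + (u + v) * d" by (simp add: algebra_simps)
    also have "\<dots> = u * F e + v * F e' + d" using uv(3) by simp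
    finally show "F (\<lambda>i. u *\<^sub>R e i + v *\<^sub>R e' i) \<le> u * F e + v * F e' + d" .
  qed

  obtain q where q: "\<And>e. (\<forall>i. i \<notin> I \<longrightarrow> e i = 0) \<Longrightarrow> F (\<lambda>_. 0) + (\<Sum>i\<in>I. q i \<bullet> e i) \<le> F e"
    using convex_family_subgradient[of I F, OF I F_convex] by blast
  define p where "p i = fst (q i)" for i
  define r where "r i = snd (q i)" for i
  \<comment> \<open>Choosing the perturbation equal to the violation removes the penalty. It is cut
    off outside \<open>I\<close>, where the subgradient inequality asks for zero.\<close>
  have q_dual: "F (\<lambda>_. 0) + (\<Sum>i\<in>I. q i \<bullet> viol \<rho> y i) \<le> cost y"
    if "\<rho> \<in> partitions_of_unity I" for \<rho> y
  proof -
    define e where "e = (\<lambda>i. if i \<in> I then viol \<rho> y i else 0)"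
    have "F (\<lambda>_. 0) + (\<Sum>i\<in>I. q i \<bullet> e i) \<le> F e" by (rule q) (simp add: e_def)
    also have "F e \<le> \<Phi> (\<rho>, y) e" using that by (intro F_le) (simp add: W_def)
    also have "\<dots> = cost y" by (simp add: \<Phi>_def e_def)
    finally show ?thesis by (simp add: e_def cong: sum.cong)
  qed
  define mx where "mx z = Max ((\<lambda>i. p i \<bullet> z + r i) ` I)" for z
  have mx_ge: "p i \<bullet> z + r i \<le> mx z" if "i \<in> I" for i z
    unfolding mx_def using that I by (intro Max_ge) auto
  have mx_in: "\<exists>i\<in>I. mx z = p i \<bullet> z + r i" for z
  proof -
    have "mx z \<in> (\<lambda>i. p i \<bullet> z + r i) ` I" unfolding mx_def using I I_ne by (intro Max_in) auto
    then show ?thesis by blast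
  qed
  \<comment> \<open>Against the multipliers the best partition sends \<open>z\<close> to the indices
    whose affine function attains the maximum at \<open>z\<close>. Sharing ties equally avoids a
    choice.\<close>
  define \<kappa> where "\<kappa> i = indicat_real {z. mx z = p i \<bullet> z + r i}" for i
  define \<alpha> where "\<alpha> = (\<lambda>i z. \<kappa> i z / (\<Sum>j\<in>I. \<kappa> j z))"
  have \<kappa>_pos: "0 < (\<Sum>j\<in>I. \<kappa> j z)" for z
  proof -
    obtain i where i: "i \<in> I" "mx z = p i \<bullet> z + r i" using mx_in by blast
    have "\<kappa> i z \<le> (\<Sum>j\<in>I. \<kappa> j z)" using i I by (intro member_le_sum) (auto simp: \<kappa>_def)
    moreover have "\<kappa> i z = 1" using i by (simp add: \<kappa>_def)
    ultimately show ?thesis by simp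
  qed
  have [measurable]: "mx \<in> borel_measurable borel"
    unfolding mx_def using I by (intro borel_measurable_Max) auto
  have \<alpha>: "\<alpha> \<in> partitions_of_unity I"
    unfolding partitions_of_unity_def
  proof (intro CollectI conjI ballI allI)
    fix i z assume "i \<in> I"
    have [measurable]: "\<kappa> j \<in> borel_measurable borel" for j
      unfolding \<kappa>_def by measurable
    show "\<alpha> i \<in> borel_measurable borel" unfolding \<alpha>_def by measurable
    show "0 \<le> \<alpha> i z" using \<kappa>_pos[of z] by (simp add: \<alpha>_def \<kappa>_def)
  next
    show "(\<Sum>i\<in>I. \<alpha> i z) = 1" for z
      using \<kappa>_pos[of z] by (simp add: \<alpha>_def flip: sum_divide_distrib)
  qed
  have \<alpha>_mx: "(\<Sum>i\<in>I. \<alpha> i z * (p i \<bullet> z + r i)) = mx z" for z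
  proof -
    have "\<alpha> i z * (p i \<bullet> z + r i) = \<alpha> i z * mx z" for i
      by (auto simp: \<alpha>_def \<kappa>_def indicator_def)
    then have "(\<Sum>i\<in>I. \<alpha> i z * (p i \<bullet> z + r i)) = (\<Sum>i\<in>I. \<alpha> i z) * mx z"
      unfolding sum_distrib_right by (intro sum.cong refl)
    then show ?thesis using partitions_of_unityD(3)[OF \<alpha>] by simp
  qed
  have mx_int: "(\<integral>z. mx z \<partial>\<nu>) = (\<Sum>i\<in>I. p i \<bullet> bar \<alpha> i + r i * mass \<alpha> i)"
  proof -
    have "(\<integral>z. mx z \<partial>\<nu>) = (\<integral>z. (\<Sum>i\<in>I. p i \<bullet> (\<alpha> i z *\<^sub>R z) + r i * \<alpha> i z) \<partial>\<nu>)"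
      by (rule Bochner_Integration.integral_cong) (auto simp: algebra_simps simp flip: \<alpha>_mx)
    also have "\<dots> = (\<Sum>i\<in>I. (\<integral>z. p i \<bullet> (\<alpha> i z *\<^sub>R z) + r i * \<alpha> i z \<partial>\<nu>))"
      using int_\<rho>z[OF \<alpha>] int_\<rho>[OF \<alpha>]
      by (intro Bochner_Integration.integral_sum Bochner_Integration.integrable_add
          integrable_inner_right integrable_mult_right) auto
    also have "\<dots> = (\<Sum>i\<in>I. p i \<bullet> bar \<alpha> i + r i * mass \<alpha> i)"
    proof (rule sum.cong[OF refl])
      fix i assume i: "i \<in> I"
      show "(\<integral>z. p i \<bullet> (\<alpha> i z *\<^sub>R z) + r i * \<alpha> i z \<partial>\<nu>) = p i \<bullet> bar \<alpha> i + r i * mass \<alpha> i"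
        unfolding bar_def mass_def using int_\<rho>z[OF \<alpha> i] int_\<rho>[OF \<alpha> i]
        by (subst Bochner_Integration.integral_add)
           (auto intro!: integrable_inner_right simp: integral_inner_right simp del: inner_scaleR_right)
    qed
    finally show ?thesis .
  qed
  \<comment> \<open>This is \<open>q_dual\<close> at \<open>\<alpha>\<close>, where the violation
    paired with the multipliers is the integral of the maximum minus the affine terms at
    \<open>w\<close>.\<close>
  have dual: "F (\<lambda>_. 0) \<le> (\<Sum>i\<in>I. m i * (p i \<bullet> w i + r i + h (x i - w i))) - (\<integral>z. mx z \<partial>\<nu>)" for w
  proof -
    have "(\<Sum>i\<in>I. q i \<bullet> viol \<alpha> w i) =
        (\<Sum>i\<in>I. p i \<bullet> bar \<alpha> i + r i * mass \<alpha> i) - (\<Sum>i\<in>I. m i * (p i \<bullet> w i + r i))"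
      unfolding sum_subtractf[symmetric]
      by (intro sum.cong refl) (simp add: viol_def p_def r_def inner_prod_def algebra_simps)
    moreover have "(\<Sum>i\<in>I. m i * (p i \<bullet> w i + r i + h (x i - w i))) =
        (\<Sum>i\<in>I. m i * (p i \<bullet> w i + r i)) + cost w"
      unfolding cost_def sum.distrib[symmetric]
      by (intro sum.cong refl) (simp only: distrib_left)
    ultimately show ?thesis using q_dual[OF \<alpha>, of w] unfolding mx_int by linarith
  qed

  \<comment> \<open>A near-minimiser of the penalised problem; its violation is at most
    \<open>\<theta>\<close>, and it is repaired below.\<close>
  obtain \<rho> y where \<rho>: "\<rho> \<in> partitions_of_unity I"
    and near: "\<Phi> (\<rho>, y) (\<lambda>_. 0) < F (\<lambda>_. 0) + \<epsilon> / 2"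
    using F_approx[of "\<epsilon> / 2" "\<lambda>_. 0"] \<open>0 < \<epsilon>\<close> by (auto simp: W_def)
  have "F (\<lambda>_. 0) \<le> \<Phi> (\<rho>c, \<lambda>_. zb) (\<lambda>_. 0)" using \<rho>c by (intro F_le) (simp add: W_def)
  also have "\<dots> = C0" using viol0 by (simp add: \<Phi>_def C0_def)
  finally have "cost y + k * (\<Sum>i\<in>I. norm (viol \<rho> y i)) \<le> C0 + \<epsilon>"
    using near \<open>0 < \<epsilon>\<close> by (simp add: \<Phi>_def)
  then have "k * (\<Sum>i\<in>I. norm (viol \<rho> y i)) \<le> k * \<theta>"
    using cost_nonneg[of y] \<theta>(1) by (simp add: k_def)
  then have viol_sum: "(\<Sum>i\<in>I. norm (viol \<rho> y i)) \<le> \<theta>" using k by simp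
  have viol_le: "norm (viol \<rho> y i) \<le> \<theta>" if "i \<in> I" for i
    using member_le_sum[of i I "\<lambda>i. norm (viol \<rho> y i)"] that I viol_sum by simp
  have viol_bar: "norm (bar \<rho> i - m i *\<^sub>R y i) \<le> \<theta>" and viol_mass: "\<bar>mass \<rho> i - m i\<bar> \<le> \<theta>"
    if "i \<in> I" for i
    using viol_le[OF that] norm_fst_le[of "bar \<rho> i - m i *\<^sub>R y i" "mass \<rho> i - m i"]
      norm_snd_le[of "mass \<rho> i - m i" "bar \<rho> i - m i *\<^sub>R y i"]
    unfolding viol_def by auto
  define a where "a i = mass \<rho> i - m i" for i
  have a_sum: "(\<Sum>i\<in>I. a i) = 0"
  proof -
    have "(\<Sum>i\<in>I. mass \<rho> i) = (\<integral>z. (\<Sum>i\<in>I. \<rho> i z) \<partial>\<nu>)"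
      unfolding mass_def using int_\<rho>[OF \<rho>] by (subst Bochner_Integration.integral_sum) auto
    then show ?thesis
      by (simp add: a_def sum_subtractf m_sum partitions_of_unityD(3)[OF \<rho>] prob_space)
  qed
  \<comment> \<open>Chosen so that the mass defects satisfy
    \<open>\<bar>a i\<bar> \<le> t * m i\<close>; replacing a fraction \<open>t\<close> of the
    partition by constants can then absorb them.\<close>
  define t where "t = \<theta> / mm"
  have t: "0 < t" "t \<le> 1" using \<theta> mm(1) by (auto simp: t_def)
  have tm: "\<bar>a i\<bar> \<le> t * m i" if "i \<in> I" for i
  proof -
    have "\<bar>a i\<bar> \<le> \<theta>" using viol_mass[OF that] by (simp add: a_def)
    also have "\<theta> = t * mm" using mm(1) by (simp add: t_def)
    also have "\<dots> \<le> t * m i" using mm(2)[OF that] t by (intro mult_left_mono) auto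
    finally show ?thesis .
  qed
  \<comment> \<open>The only constant that gives \<open>(1 - t) * \<rho> i + s i\<close> the mass
    \<open>m i\<close>. It is nonnegative by the choice of \<open>t\<close>, and the constants sum
    to \<open>t\<close> because the defects sum to zero.\<close>
  define s where "s i = t * m i - (1 - t) * a i" for i
  have s: "0 \<le> s i" "s i \<le> 2 * t" if "i \<in> I" for i
  proof -
    have "\<bar>(1 - t) * a i\<bar> \<le> \<bar>a i\<bar>"
      using t by (auto simp: abs_mult intro!: mult_left_le_one_le)
    then have "\<bar>(1 - t) * a i\<bar> \<le> t * m i" using tm[OF that] by linarith
    moreover have "t * m i \<le> t" using m_le1[OF that] t by simp
    ultimately show "0 \<le> s i" "s i \<le> 2 * t" unfolding s_def by linarith+
  qed
  define \<rho>' where "\<rho>' = (\<lambda>i z. (1 - t) * \<rho> i z + s i)"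
  have \<rho>': "\<rho>' \<in> partitions_of_unity I"
  proof -
    have "(\<Sum>i\<in>I. s i) = t"
      by (simp add: s_def sum_subtractf m_sum a_sum flip: sum_distrib_left)
    then show ?thesis
      using partitions_of_unityD[OF \<rho>] s(1) t
      by (auto simp: \<rho>'_def partitions_of_unity_def sum.distrib simp flip: sum_distrib_left
          intro!: borel_measurable_add borel_measurable_times)
  qed
  have mass': "(\<integral>z. \<rho>' i z \<partial>\<nu>) = m i" if "i \<in> I" for i
  proof -
    have "(\<integral>z. \<rho>' i z \<partial>\<nu>) = (1 - t) * mass \<rho> i + s i"
      unfolding \<rho>'_def mass_def using int_\<rho>[OF \<rho> that] by (simp add: prob_space)
    then show ?thesis by (simp add: s_def a_def algebra_simps)
  qed
  \<comment> \<open>The change is \<open>s i *\<^sub>R zb - t *\<^sub>R bar \<rho> i\<close>, where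
    \<open>s i \<le> 2 * t\<close> and both vectors have norm at most \<open>M\<close>.\<close>
  have bar': "norm (bar \<rho>' i - bar \<rho> i) \<le> 3 * M * t" if i: "i \<in> I" for i
  proof -
    have zb: "norm zb \<le> M"
      unfolding zb_def M_def by (rule integral_norm_bound)
    have "bar \<rho>' i = (1 - t) *\<^sub>R bar \<rho> i + s i *\<^sub>R zb"
      unfolding bar_def \<rho>'_def zb_def using int_\<rho>z[OF \<rho> i] int_id
      by (simp add: scaleR_add_left flip: scaleR_scaleR)
    then have "bar \<rho>' i - bar \<rho> i = s i *\<^sub>R zb - t *\<^sub>R bar \<rho> i"
      by (simp add: algebra_simps)
    also have "norm \<dots> \<le> s i * norm zb + t * norm (bar \<rho> i)"
      using norm_triangle_ineq4[of "s i *\<^sub>R zb" "t *\<^sub>R bar \<rho> i"] s(1)[OF i] t by simp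
    also have "\<dots> \<le> (2 * t) * M + t * M"
      using s[OF i] t zb bar_le[OF \<rho> i] by (intro add_mono mult_mono) auto
    finally show ?thesis by simp
  qed
  define y' where "y' i = bar \<rho>' i /\<^sub>R m i" for i
  \<comment> \<open>With \<open>m i\<close> kept inside the norm, the distance from
    \<open>y i\<close> to \<open>y' i\<close> becomes the change of barycentre plus the violation,
    both already bounded.\<close>
  have step: "m i * h (x i - y' i) \<le> m i * h (x i - y i) + \<theta> * ((3 * M / mm + 1) * B)"
    if i: "i \<in> I" for i
  proof -
    have "norm (y' i) \<le> M / m i"
      using bar_le[OF \<rho>' i] m_pos[OF i] by (simp add: y'_def divide_inverse mult.commute)
    then have "norm (x i - y' i) \<le> norm (x i) + M / m i"
      using norm_triangle_ineq4[of "x i" "y' i"] by linarith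
    also have "\<dots> \<le> Max ((\<lambda>i. norm (x i) + M / m i) ` I)" using i I by (intro Max_ge) auto
    finally have "h (x i - y' i) \<le> h (x i - y i) + norm ((x i - y' i) - (x i - y i)) * B"
      using B by (intro convex_nonneg_diff_le h) force
    then have "m i * h (x i - y' i) \<le> m i * (h (x i - y i) + norm ((x i - y' i) - (x i - y i)) * B)"
      using m_pos[OF i] by (intro mult_left_mono) auto
    also have "\<dots> = m i * h (x i - y i) + norm (m i *\<^sub>R ((x i - y' i) - (x i - y i))) * B"
      using m_pos[OF i] unfolding norm_scaleR by (simp add: distrib_left)
    also have "m i *\<^sub>R ((x i - y' i) - (x i - y i)) = (bar \<rho> i - bar \<rho>' i) - (bar \<rho> i - m i *\<^sub>R y i)"
      using m_pos[OF i] by (simp add: y'_def algebra_simps)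
    also have "norm \<dots> * B \<le> (3 * M * t + \<theta>) * B"
    proof (intro mult_right_mono B0)
      show "norm ((bar \<rho> i - bar \<rho>' i) - (bar \<rho> i - m i *\<^sub>R y i)) \<le> 3 * M * t + \<theta>"
        using norm_triangle_ineq4[of "bar \<rho> i - bar \<rho>' i" "bar \<rho> i - m i *\<^sub>R y i"]
          bar'[OF i] viol_bar[OF i] by (simp add: norm_minus_commute)
    qed
    also have "(3 * M * t + \<theta>) * B = \<theta> * ((3 * M / mm + 1) * B)"
      using mm(1) by (simp add: t_def field_simps)
    finally show ?thesis by simp
  qed
  have "cost y' \<le> cost y + real (card I) * (\<theta> * ((3 * M / mm + 1) * B))"
    unfolding cost_def using sum_mono[of I, OF step] by (simp add: sum.distrib)
  also have "real (card I) * (\<theta> * ((3 * M / mm + 1) * B)) \<le> K * \<theta>"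
    using \<theta>(1) by (simp add: K_def algebra_simps)
  also have "cost y \<le> \<Phi> (\<rho>, y) (\<lambda>_. 0)"
    using k by (simp add: \<Phi>_def sum_nonneg)
  finally have "cost y' \<le> F (\<lambda>_. 0) + \<epsilon>" using near \<theta>(3) by linarith
  then have "cost y' \<le> (\<Sum>i\<in>I. m i * (p i \<bullet> w i + r i + h (x i - w i))) - (\<integral>z. mx z \<partial>\<nu>) + \<epsilon>" for w
    using dual[of w] by linarith
  then show ?thesis
    by (intro that[OF \<rho>' mass']) (auto simp: cost_def y'_def bar_def mx_def)
qed

section \<open>Convex functions and extended integrals\<close>

lemma convex_on_UNIVD:
  assumes "convex_on UNIV f" "0 \<le> u" "0 \<le> v" "u + v = 1"
  shows "f (u *\<^sub>R x + v *\<^sub>R y) \<le> u * f x + v * f y"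
  using assms by (simp add: convex_on_def)

lemma convex_on_UNIV_continuous:
  fixes f :: "'a::euclidean_space \<Rightarrow> real"
  shows "convex_on UNIV f \<Longrightarrow> continuous_on A f"
  using convex_on_continuous[OF open_UNIV] continuous_on_subset by blast

lemma convex_on_UNIV_measurable:
  fixes f :: "'a::euclidean_space \<Rightarrow> real"
  shows "convex_on UNIV f \<Longrightarrow> f \<in> borel_measurable borel"
  by (intro borel_measurable_continuous_onI convex_on_UNIV_continuous)

lemma convex_on_Max:
  fixes f :: "'i \<Rightarrow> 'a::real_vector \<Rightarrow> real"
  assumes "finite I" "I \<noteq> {}" and f: "\<And>i. i \<in> I \<Longrightarrow> convex_on UNIV (f i)"
  shows "convex_on UNIV (\<lambda>x. Max ((\<lambda>i. f i x) ` I))"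
  unfolding convex_on_def
proof (intro conjI ballI allI impI convex_UNIV)
  fix x y :: 'a and u v :: real
  assume uv: "0 \<le> u" "0 \<le> v" "u + v = 1"
  show "Max ((\<lambda>i. f i (u *\<^sub>R x + v *\<^sub>R y)) ` I) \<le>
      u * Max ((\<lambda>i. f i x) ` I) + v * Max ((\<lambda>i. f i y) ` I)"
  proof (rule Max.boundedI)
    fix a assume "a \<in> (\<lambda>i. f i (u *\<^sub>R x + v *\<^sub>R y)) ` I"
    then obtain i where i: "i \<in> I" "a = f i (u *\<^sub>R x + v *\<^sub>R y)" by blast
    have "a \<le> u * f i x + v * f i y" unfolding i(2) by (rule convex_on_UNIVD[OF f[OF i(1)] uv])
    also have "\<dots> \<le> u * Max ((\<lambda>i. f i x) ` I) + v * Max ((\<lambda>i. f i y) ` I)"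
      using uv i(1) assms(1) by (intro add_mono mult_left_mono Max_ge) auto
    finally show "a \<le> \<dots>" .
  qed (use assms in auto)
qed

lemma norm_le_1_plus_power:
  fixes x :: "'a::real_normed_vector"
  assumes "1 \<le> p"
  shows "norm x \<le> 1 + norm x ^ p"
proof (cases "norm x \<le> 1")
  case False
  then have "norm x \<le> norm x ^ p" using assms by (intro self_le_power) auto
  then show ?thesis by simp
qed (simp add: add_increasing2)

lemma PD:
  assumes "\<mu> \<in> P p"
  shows "prob_space \<mu>" "sets \<mu> = sets borel" "integrable \<mu> (\<lambda>x. norm x ^ p)"
  using assms by (auto simp: P_def)

lemma P_measurable: "\<mu> \<in> P p \<Longrightarrow> borel_measurable \<mu> = borel_measurable borel"
  using PD(2) by (intro measurable_cong_sets) auto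

lemma P_integrable_bound:
  fixes f :: "'a::euclidean_space \<Rightarrow> 'b::{banach, second_countable_topology}"
  assumes \<mu>: "\<mu> \<in> P p" and "f \<in> borel_measurable borel" and "\<And>x. norm (f x) \<le> K * (1 + norm x ^ p)"
  shows "integrable \<mu> f"
proof -
  interpret prob_space \<mu> using \<mu> by (rule PD)
  have "integrable \<mu> (\<lambda>x. K * (1 + norm x ^ p))" using PD(3)[OF \<mu>] by simp
  then show ?thesis
    by (rule Bochner_Integration.integrable_bound)
       (use assms P_measurable[OF \<mu>] sets_eq_imp_space_eq[OF PD(2)[OF \<mu>]]
         in \<open>auto simp: measurable_cong_sets[OF PD(2)[OF \<mu>] refl] intro: order_trans[OF _ abs_ge_self]\<close>)
qed

lemma P_integrable_id:
  assumes \<mu>: "\<mu> \<in> P p" and "1 \<le> p"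
  shows "integrable \<mu> (\<lambda>x. x)"
  using norm_le_1_plus_power[OF assms(2)] by (intro P_integrable_bound[OF \<mu>, where K = 1]) auto

lemma P_mono_1:
  assumes \<mu>: "\<mu> \<in> P p" and "1 \<le> p"
  shows "\<mu> \<in> P 1"
  using PD[OF \<mu>] P_integrable_id[OF assms] by (auto simp: P_def)

lemma C_b_bound:
  assumes "f \<in> C_b p"
  obtains K where "0 \<le> K" "\<And>x. \<bar>f x\<bar> \<le> K * (1 + norm x ^ p)"
proof -
  obtain K where K: "\<And>x. \<bar>f x / (1 + norm x ^ p)\<bar> \<le> K"
    using assms by (auto simp: C_b_def bounded_iff)
  have pos: "0 < 1 + norm x ^ p" for x :: 'a by (simp add: add_pos_nonneg)
  have "\<bar>f x\<bar> \<le> K * (1 + norm x ^ p)" for x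
    using K[of x] pos[of x] by (simp add: abs_divide pos_divide_le_eq)
  moreover have "0 \<le> K" using K[of 0] by (meson abs_ge_zero order_trans)
  ultimately show ?thesis using that by blast
qed

lemma C_bI:
  assumes "continuous_on UNIV f" "\<And>x. \<bar>f x\<bar> \<le> K * (1 + norm x ^ p)"
  shows "f \<in> C_b p"
proof -
  have pos: "0 < 1 + norm x ^ p" for x :: 'a by (simp add: add_pos_nonneg)
  have "norm (f x / (1 + norm x ^ p)) \<le> K" for x
    using assms(2)[of x] pos[of x] by (simp add: abs_divide pos_divide_le_eq)
  then show ?thesis using assms(1) by (auto simp: C_b_def bounded_iff)
qed

lemma C_b_integrable:
  assumes "\<mu> \<in> P p" "f \<in> C_b p"
  shows "integrable \<mu> f"
proof -
  obtain K where "\<And>x. \<bar>f x\<bar> \<le> K * (1 + norm x ^ p)" using C_b_bound[OF assms(2)] by blast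
  then show ?thesis
    using assms(2) by (intro P_integrable_bound[OF assms(1), where K = K])
      (auto simp: C_b_def intro: borel_measurable_continuous_onI)
qed

text \<open>Only growth from above has to be checked: a supporting affine function bounds
  \<open>f\<close> from below at a linear rate, which is within rate \<open>p\<close> since
  \<open>p\<close> is at least 1, and continuity is automatic.\<close>

lemma convex_in_C_b:
  fixes f :: "'a::euclidean_space \<Rightarrow> real"
  assumes f: "convex_on UNIV f" and K: "\<And>x. f x \<le> K * (1 + norm x ^ p)" and p: "1 \<le> p"
  shows "f \<in> C_b p"
proof -
  obtain q where q: "\<And>x. f 0 + q \<bullet> (x - 0) \<le> f x" using convex_subgradient[OF f] by blast
  define L where "L = \<bar>f 0\<bar> + norm q"
  have "- (2 * L * (1 + norm x ^ p)) \<le> f x" for x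
  proof -
    have "- (q \<bullet> x) \<le> norm q * norm x" using Cauchy_Schwarz_ineq2[of q x] by linarith
    also have "\<dots> \<le> norm q * (1 + norm x ^ p)"
      by (intro mult_left_mono norm_le_1_plus_power p) auto
    also have "\<dots> \<le> L * (1 + norm x ^ p)"
      by (intro mult_right_mono) (auto simp: L_def)
    finally have 1: "- (q \<bullet> x) \<le> L * (1 + norm x ^ p)" .
    have "\<bar>f 0\<bar> \<le> L * 1" by (simp add: L_def)
    also have "\<dots> \<le> L * (1 + norm x ^ p)" by (intro mult_left_mono) (auto simp: L_def)
    finally have "\<bar>f 0\<bar> \<le> L * (1 + norm x ^ p)" .
    then show ?thesis using 1 q[of x] by simp
  qed
  moreover have "f x \<le> \<bar>K\<bar> * (1 + norm x ^ p)" for x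
    by (rule order_trans[OF K]) (auto intro!: mult_right_mono)
  moreover have "0 \<le> L * (1 + norm x ^ p)" "0 \<le> \<bar>K\<bar> * (1 + norm x ^ p)" for x :: 'a
    by (auto simp: L_def)
  moreover have "\<bar>a\<bar> \<le> (2 * L + \<bar>K\<bar>) * t"
    if "- (2 * L * t) \<le> a" "a \<le> \<bar>K\<bar> * t" "0 \<le> L * t" "0 \<le> \<bar>K\<bar> * t" for a t
    using that by (simp add: abs_le_iff distrib_right)
  ultimately have "\<bar>f x\<bar> \<le> (2 * L + \<bar>K\<bar>) * (1 + norm x ^ p)" for x
    by blast
  then show ?thesis by (intro C_bI convex_on_UNIV_continuous f)
qed

section \<open>Extended integrals of functions with an integrable minorant\<close>

lemma ext_integral_cong_AE:
  assumes "AE x in M. f x = g x"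
  shows "ext_integral M f = ext_integral M g"
proof -
  have "(\<integral>\<^sup>+ x. e2ennreal (f x) \<partial>M) = (\<integral>\<^sup>+ x. e2ennreal (g x) \<partial>M)"
    "(\<integral>\<^sup>+ x. e2ennreal (- f x) \<partial>M) = (\<integral>\<^sup>+ x. e2ennreal (- g x) \<partial>M)"
    using assms by (auto intro!: nn_integral_cong_AE)
  then show ?thesis by (simp add: ext_integral_def)
qed

text \<open>The minorant makes the integral of the negative part finite, so a difference of
  infinities cannot occur and the positive part alone decides between the two cases.\<close>

lemma ext_integral_bounded_below:
  assumes f: "f \<in> borel_measurable M" and l: "integrable M l" "\<And>x. ereal (l x) \<le> f x"
  obtains (finite) "integrable M (\<lambda>x. real_of_ereal (f x))"
      "AE x in M. f x = ereal (real_of_ereal (f x))"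
      "ext_integral M f = ereal (\<integral>x. real_of_ereal (f x) \<partial>M)"
    | (infinite) "ext_integral M f = \<infinity>" "(\<integral>\<^sup>+ x. e2ennreal (f x) \<partial>M) = \<infinity>"
proof (cases "(\<integral>\<^sup>+ x. e2ennreal (f x) \<partial>M) = \<infinity>")
  case True
  have "(\<integral>\<^sup>+ x. e2ennreal (- f x) \<partial>M) \<le> (\<integral>\<^sup>+ x. ennreal (norm (l x)) \<partial>M)"
  proof (rule nn_integral_mono)
    fix x
    have "- f x \<le> ereal (norm (l x))"
      using l(2)[of x] by (cases "f x") auto
    then show "e2ennreal (- f x) \<le> ennreal (norm (l x))"
      using e2ennreal_mono by fastforce
  qed
  also have "\<dots> < \<infinity>" using l(1) by (simp add: integrable_iff_bounded)
  finally have "enn2ereal (\<integral>\<^sup>+ x. e2ennreal (- f x) \<partial>M) \<noteq> \<infinity>"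
    by (cases "\<integral>\<^sup>+ x. e2ennreal (- f x) \<partial>M") (auto simp: enn2ereal_ennreal)
  then show ?thesis using True infinite by (simp add: ext_integral_def)
next
  case False
  have [measurable]: "f \<in> borel_measurable M" "l \<in> borel_measurable M" using f l by auto
  have em: "(\<lambda>x. e2ennreal (f x)) \<in> borel_measurable M" by measurable
  have "AE x in M. e2ennreal (f x) \<noteq> \<infinity>" by (rule nn_integral_PInf_AE[OF em False])
  then have AE: "AE x in M. f x = ereal (real_of_ereal (f x))"
  proof (rule AE_mp, intro AE_I2 impI)
    fix x assume "e2ennreal (f x) \<noteq> \<infinity>"
    then show "f x = ereal (real_of_ereal (f x))" using l(2)[of x] by (cases "f x") auto
  qed
  have "(\<integral>\<^sup>+ x. ennreal (norm (real_of_ereal (f x))) \<partial>M) \<le>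
      (\<integral>\<^sup>+ x. e2ennreal (f x) + ennreal (norm (l x)) \<partial>M)"
  proof (rule nn_integral_mono)
    fix x
    show "ennreal (norm (real_of_ereal (f x))) \<le> e2ennreal (f x) + ennreal (norm (l x))"
    proof (cases "f x")
      case (real r)
      show ?thesis
      proof (cases "0 \<le> r")
        case False
        then have "norm r \<le> norm (l x)" using l(2)[of x] real by auto
        then show ?thesis using real by (simp add: add_increasing)
      qed (simp add: real add_increasing2)
    qed auto
  qed
  also have "\<dots> = (\<integral>\<^sup>+ x. e2ennreal (f x) \<partial>M) + (\<integral>\<^sup>+ x. ennreal (norm (l x)) \<partial>M)"
    by (rule nn_integral_add) measurable
  also have "\<dots> < \<infinity>" using l(1) False by (simp add: integrable_iff_bounded less_top)
  finally have int: "integrable M (\<lambda>x. real_of_ereal (f x))" by (intro integrableI_bounded) auto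
  show ?thesis
    using ext_integral_cong_AE[OF AE] ext_integral_eq_lebesgue_integral[OF int]
    by (intro finite int AE) simp
qed

lemma ext_integral_real_bounded_below:
  fixes f :: "'a \<Rightarrow> real"
  assumes "f \<in> borel_measurable M" "integrable M l" "\<And>x. l x \<le> f x"
  obtains (finite) "integrable M f" "ext_integral M (\<lambda>x. ereal (f x)) = ereal (\<integral>x. f x \<partial>M)"
    | (infinite) "ext_integral M (\<lambda>x. ereal (f x)) = \<infinity>"
  by (rule ext_integral_bounded_below[of "\<lambda>x. ereal (f x)" M l]) (use assms in auto)

lemma convex_minorant_integrable:
  fixes f :: "'a::euclidean_space \<Rightarrow> real"
  assumes "convex_on UNIV f" "prob_space \<mu>" "integrable \<mu> (\<lambda>x. x)"
  obtains l where "integrable \<mu> l" "\<And>x. l x \<le> f x"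
proof -
  interpret prob_space \<mu> by fact
  obtain q where q: "\<And>x. f 0 + q \<bullet> (x - 0) \<le> f x" using convex_subgradient[OF assms(1)] by blast
  show ?thesis
    by (rule that[of "\<lambda>x. f 0 + q \<bullet> (x - 0)"]) (use q assms(3) in auto)
qed

text \<open>Integrability under \<open>\<eta>\<close> is part of the gain: the order bounds the
  extended integral by a real number, which excludes its infinite case.\<close>

lemma convex_order_integral:
  assumes order: "\<eta> \<le>\<^sub>c\<^sub>x \<nu>" and \<eta>: "\<eta> \<in> P 1" and f: "convex_on UNIV f" "integrable \<nu> f"
  shows "integrable \<eta> f" "(\<integral>x. f x \<partial>\<eta>) \<le> (\<integral>x. f x \<partial>\<nu>)"
proof -
  obtain l where l: "integrable \<eta> l" "\<And>x. l x \<le> f x"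
    using convex_minorant_integrable[OF f(1) PD(1)[OF \<eta>]] P_integrable_id[OF \<eta>] by auto
  have le: "ext_integral \<eta> (\<lambda>x. ereal (f x)) \<le> ereal (\<integral>x. f x \<partial>\<nu>)"
    using order f ext_integral_eq_lebesgue_integral[OF f(2)]
    by (auto simp: convex_order_def convex_funs_def)
  have "f \<in> borel_measurable \<eta>"
    using convex_on_UNIV_measurable[OF f(1)] by (simp add: P_measurable[OF \<eta>])
  from this l have "integrable \<eta> f \<and> (\<integral>x. f x \<partial>\<eta>) \<le> (\<integral>x. f x \<partial>\<nu>)"
    by (rule ext_integral_real_bounded_below) (use le in auto)
  then show "integrable \<eta> f" "(\<integral>x. f x \<partial>\<eta>) \<le> (\<integral>x. f x \<partial>\<nu>)" by auto
qed

lemma ext_convex_funs_ereal: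
  assumes "convex_on UNIV \<phi>"
  shows "ereal \<circ> \<phi> \<in> ext_convex_funs"
  using convex_on_UNIVD[OF assms] by (auto simp: ext_convex_funs_def)

section \<open>The transforms\<close>

locale transport_cost =
  fixes h :: "'a::euclidean_space \<Rightarrow> real" and C :: real and p :: nat
  assumes h_convex: "convex_on UNIV h" and h_nonneg: "\<And>z. 0 \<le> h z"
    and h_growth: "\<And>z. h z \<le> C * (1 + norm z ^ p)" and p_ge_1: "1 \<le> p"
begin

abbreviation c :: "'a \<Rightarrow> 'a \<Rightarrow> real" where "c \<equiv> \<lambda>x y. h (x - y)"

lemma Q_le: "Q c \<phi> x \<le> \<phi> y + ereal (h (x - y))"
  unfolding Q_def by (rule INF_lower) simp

text \<open>An infimal convolution inherits convexity from the joint convexity of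
  \<open>G y + h (x - y)\<close>. Strict real upper bounds \<open>s\<close> and \<open>s'\<close>
  replace the values of the transform, which may be infinite.\<close>

lemma Q_ext_convex:
  assumes G: "G \<in> ext_convex_funs" and s: "Q c G x < ereal s" "Q c G x' < ereal s'"
    and uv: "0 \<le> u" "0 \<le> v" "u + v = 1"
  shows "Q c G (u *\<^sub>R x + v *\<^sub>R x') \<le> ereal (u * s + v * s')"
proof -
  have real: "\<exists>y t. G y = ereal t \<and> t + h (x - y) < s" if less: "Q c G x < ereal s" for x s
  proof -
    obtain y where y: "G y + ereal (h (x - y)) < ereal s"
      using less unfolding Q_def INF_less_iff by blast
    moreover have "G y \<noteq> -\<infinity>" using G by (simp add: ext_convex_funs_def)
    ultimately show ?thesis by (cases "G y") auto
  qed
  obtain y t where y: "G y = ereal t" "t + h (x - y) < s" using real[OF s(1)] by blast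
  obtain y' t' where y': "G y' = ereal t'" "t' + h (x' - y') < s'" using real[OF s(2)] by blast
  have "Q c G (u *\<^sub>R x + v *\<^sub>R x') \<le>
      G (u *\<^sub>R y + v *\<^sub>R y') + ereal (h (u *\<^sub>R x + v *\<^sub>R x' - (u *\<^sub>R y + v *\<^sub>R y')))"
    by (rule Q_le)
  also have "\<dots> \<le> ereal (u * t + v * t') + ereal (u * h (x - y) + v * h (x' - y'))"
  proof (rule add_mono)
    have "G (u *\<^sub>R y + v *\<^sub>R y') \<le> ereal u * G y + ereal v * G y'"
      using G uv unfolding ext_convex_funs_def by blast
    then show "G (u *\<^sub>R y + v *\<^sub>R y') \<le> ereal (u * t + v * t')" by (simp add: y(1) y'(1))
    have "u *\<^sub>R x + v *\<^sub>R x' - (u *\<^sub>R y + v *\<^sub>R y') = u *\<^sub>R (x - y) + v *\<^sub>R (x' - y')"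
      by (simp add: algebra_simps)
    then show "ereal (h (u *\<^sub>R x + v *\<^sub>R x' - (u *\<^sub>R y + v *\<^sub>R y')))
        \<le> ereal (u * h (x - y) + v * h (x' - y'))"
      using convex_on_UNIVD[OF h_convex uv] by simp
  qed
  also have "\<dots> = ereal (u * (t + h (x - y)) + v * (t' + h (x' - y')))"
    by (simp add: algebra_simps)
  also have "\<dots> \<le> ereal (u * s + v * s')"
    using y(2) y'(2) uv by (auto intro!: add_mono mult_left_mono)
  finally show ?thesis .
qed

lemma Q_real_convex:
  assumes G: "G \<in> ext_convex_funs" and q: "Q c G = ereal \<circ> q"
  shows "convex_on UNIV q"
  unfolding convex_on_def
proof (intro conjI ballI allI impI convex_UNIV)
  fix x y and u v :: real
  assume uv: "0 \<le> u" "0 \<le> v" "u + v = 1"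
  show "q (u *\<^sub>R x + v *\<^sub>R y) \<le> u * q x + v * q y"
  proof (rule field_le_epsilon)
    fix d :: real assume "0 < d"
    then have "Q c G (u *\<^sub>R x + v *\<^sub>R y) \<le> ereal (u * (q x + d) + v * (q y + d))"
      using q by (intro Q_ext_convex[OF G _ _ uv]) auto
    then have "q (u *\<^sub>R x + v *\<^sub>R y) \<le> u * (q x + d) + v * (q y + d)" by (simp add: q)
    also have "\<dots> = u * q x + v * q y + (u + v) * d" by (simp add: algebra_simps)
    finally show "q (u *\<^sub>R x + v *\<^sub>R y) \<le> u * q x + v * q y + d" using uv by simp
  qed
qed

text \<open>A real \<open>\<phi>\<close> keeps the transform below infinity, and such a convex
  function on the whole space is \<open>-\<infinity>\<close> everywhere once it is so at one point.
  Otherwise it is real, and testing with \<open>y = 0\<close> gives it the growth of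
  \<open>h\<close>, whatever the growth of \<open>\<phi>\<close>.\<close>

lemma Q_convex_cases:
  assumes \<phi>: "convex_on UNIV \<phi>"
  obtains (bot) "\<And>x. Q c (ereal \<circ> \<phi>) x = -\<infinity>"
    | (real) q where "convex_on UNIV q" "q \<in> C_b p" "Q c (ereal \<circ> \<phi>) = ereal \<circ> q"
proof (cases "\<exists>x0. Q c (ereal \<circ> \<phi>) x0 = -\<infinity>")
  case True
  then obtain x0 where x0: "Q c (ereal \<circ> \<phi>) x0 = -\<infinity>" by blast
  have "Q c (ereal \<circ> \<phi>) x = -\<infinity>" for x
  proof (rule ereal_bot)
    fix B :: real
    \<comment> \<open>\<open>x\<close> is the midpoint of \<open>x0\<close> and its reflection
      \<open>w\<close>. The value at \<open>w\<close> has a real upper bound, and the bound at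
      \<open>x0\<close> is taken low enough for the average to be \<open>B\<close>.\<close>
    define w where "w = 2 *\<^sub>R x - x0"
    have "Q c (ereal \<circ> \<phi>) w \<le> ereal (\<phi> w + h 0)" using Q_le[of "ereal \<circ> \<phi>" w w] by simp
    then have "Q c (ereal \<circ> \<phi>) w < ereal (\<phi> w + h 0 + 1)"
      by (rule order.strict_trans1) simp
    then have "Q c (ereal \<circ> \<phi>) ((1/2) *\<^sub>R x0 + (1/2) *\<^sub>R w) \<le>
        ereal ((1/2) * (2 * B - (\<phi> w + h 0 + 1)) + (1/2) * (\<phi> w + h 0 + 1))"
      using x0 by (intro Q_ext_convex ext_convex_funs_ereal \<phi>) auto
    also have "(1/2) *\<^sub>R x0 + (1/2) *\<^sub>R w = x" by (simp add: w_def algebra_simps)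
    also have "(1/2) * (2 * B - (\<phi> w + h 0 + 1)) + (1/2) * (\<phi> w + h 0 + 1) = B"
      by (simp add: field_simps)
    finally show "Q c (ereal \<circ> \<phi>) x \<le> ereal B" .
  qed
  then show ?thesis by (rule bot)
next
  case False
  define q where "q x = real_of_ereal (Q c (ereal \<circ> \<phi>) x)" for x
  have le: "Q c (ereal \<circ> \<phi>) x \<le> ereal (\<phi> 0 + h x)" for x
    using Q_le[of "ereal \<circ> \<phi>" x 0] by simp
  have q: "Q c (ereal \<circ> \<phi>) x = ereal (q x)" for x
    using False le[of x] by (cases "Q c (ereal \<circ> \<phi>) x") (auto simp: q_def)
  then have eq: "Q c (ereal \<circ> \<phi>) = ereal \<circ> q" by auto
  have conv: "convex_on UNIV q" by (rule Q_real_convex[OF ext_convex_funs_ereal[OF \<phi>] eq])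
  have "q x \<le> (\<bar>\<phi> 0\<bar> + C) * (1 + norm x ^ p)" for x
  proof -
    have "q x \<le> \<phi> 0 + h x" using le[of x] q[of x] by simp
    moreover have "\<bar>\<phi> 0\<bar> * 1 \<le> \<bar>\<phi> 0\<bar> * (1 + norm x ^ p)" by (intro mult_left_mono) auto
    ultimately have "q x \<le> \<bar>\<phi> 0\<bar> * (1 + norm x ^ p) + C * (1 + norm x ^ p)"
      using h_growth[of x] by (smt (verit, best) mult_1_right)
    then show ?thesis by (simp only: distrib_right)
  qed
  then have "q \<in> C_b p" by (rule convex_in_C_b[OF conv _ p_ge_1])
  then show ?thesis using real conv eq by blast
qed

text \<open>Half of the Galois connection between the transforms; \<open>Q_Q_bar_ge\<close> is the
  other half. They let a potential pass to the opposite dual problem without lowering the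
  functional.\<close>

lemma Q_bar_Q_le:
  assumes "Q c (ereal \<circ> \<phi>) = ereal \<circ> q"
  shows "Q_bar c (Q c (ereal \<circ> \<phi>)) y \<le> ereal (\<phi> y)"
  unfolding Q_bar_def
proof (rule SUP_least)
  fix x
  have "ereal (q x) \<le> ereal (\<phi> y) + ereal (h (x - y))"
    using Q_le[of "ereal \<circ> \<phi>" x y] assms by simp
  then show "Q c (ereal \<circ> \<phi>) x - ereal (h (x - y)) \<le> ereal (\<phi> y)" by (simp add: assms)
qed

lemma Q_bar_ge: "ereal (\<psi> x - h (x - y)) \<le> Q_bar c (ereal \<circ> \<psi>) y"
  unfolding Q_bar_def using SUP_upper[of x UNIV "\<lambda>x. (ereal \<circ> \<psi>) x - ereal (h (x - y))"] by simp

lemma Q_Q_bar_ge: "ereal (\<psi> x) \<le> Q c (Q_bar c (ereal \<circ> \<psi>)) x"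
  unfolding Q_def
proof (rule INF_greatest)
  fix y
  show "ereal (\<psi> x) \<le> Q_bar c (ereal \<circ> \<psi>) y + ereal (h (x - y))"
    using Q_bar_ge[of \<psi> x y] by (cases "Q_bar c (ereal \<circ> \<psi>) y") auto
qed

text \<open>After substituting \<open>x = y + z\<close> the cost term is free of \<open>y\<close>,
  so each term is convex in \<open>y\<close>. Hence the transform is convex although the cost enters
  with a minus sign.\<close>

lemma Q_bar_shift: "Q_bar c (ereal \<circ> \<psi>) y = (SUP z. ereal (\<psi> (y + z) - h z))"
proof (rule antisym)
  show "Q_bar c (ereal \<circ> \<psi>) y \<le> (SUP z. ereal (\<psi> (y + z) - h z))"
    unfolding Q_bar_def
  proof (rule SUP_least)
    fix x
    show "(ereal \<circ> \<psi>) x - ereal (h (x - y)) \<le> (SUP z. ereal (\<psi> (y + z) - h z))"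
      using SUP_upper[of "x - y" UNIV "\<lambda>z. ereal (\<psi> (y + z) - h z)"] by simp
  qed
  show "(SUP z. ereal (\<psi> (y + z) - h z)) \<le> Q_bar c (ereal \<circ> \<psi>) y"
    using Q_bar_ge[of \<psi> "y + z" y for z] by (intro SUP_least) simp
qed

lemma convex_translate_minus:
  assumes \<psi>: "convex_on UNIV \<psi>"
  shows "convex_on UNIV (\<lambda>y. \<psi> (y + z) - b :: real)"
  unfolding convex_on_def
proof (intro conjI ballI allI impI convex_UNIV)
  fix x y and u v :: real
  assume uv: "0 \<le> u" "0 \<le> v" "u + v = 1"
  have "u *\<^sub>R x + v *\<^sub>R y + (u + v) *\<^sub>R z = u *\<^sub>R (x + z) + v *\<^sub>R (y + z)"
    by (simp add: algebra_simps)
  then have "\<psi> (u *\<^sub>R x + v *\<^sub>R y + z) \<le> u * \<psi> (x + z) + v * \<psi> (y + z)"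
    using convex_on_UNIVD[OF \<psi> uv, of "x + z" "y + z"] uv(3) by simp
  moreover have "u * (\<psi> (x + z) - b) + v * (\<psi> (y + z) - b) =
      u * \<psi> (x + z) + v * \<psi> (y + z) - (u + v) * b"
    by (simp add: algebra_simps)
  ultimately show "\<psi> (u *\<^sub>R x + v *\<^sub>R y + z) - b \<le> u * (\<psi> (x + z) - b) + v * (\<psi> (y + z) - b)"
    using uv(3) by simp
qed

lemma Q_bar_ext_convex:
  assumes \<psi>: "convex_on UNIV \<psi>"
  shows "Q_bar c (ereal \<circ> \<psi>) \<in> ext_convex_funs"
  unfolding ext_convex_funs_def
proof (intro CollectI conjI allI impI)
  fix x y and u v :: real
  show "Q_bar c (ereal \<circ> \<psi>) x \<noteq> -\<infinity>" using Q_bar_ge[of \<psi> x x] by auto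
  assume uv: "0 \<le> u" "0 \<le> v" "u + v = 1"
  show "Q_bar c (ereal \<circ> \<psi>) (u *\<^sub>R x + v *\<^sub>R y) \<le>
      ereal u * Q_bar c (ereal \<circ> \<psi>) x + ereal v * Q_bar c (ereal \<circ> \<psi>) y"
    unfolding Q_bar_shift[of \<psi> "u *\<^sub>R x + v *\<^sub>R y"]
  proof (rule SUP_least)
    fix z
    have "ereal (\<psi> (u *\<^sub>R x + v *\<^sub>R y + z) - h z) \<le>
        ereal u * ereal (\<psi> (x + z) - h z) + ereal v * ereal (\<psi> (y + z) - h z)"
      using convex_on_UNIVD[OF convex_translate_minus[OF \<psi>] uv] by simp
    also have "\<dots> \<le> ereal u * Q_bar c (ereal \<circ> \<psi>) x + ereal v * Q_bar c (ereal \<circ> \<psi>) y"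
      using uv Q_bar_ge[of \<psi> "x + z" x] Q_bar_ge[of \<psi> "y + z" y]
      by (intro add_mono ereal_mult_left_mono) auto
    finally show "ereal (\<psi> (u *\<^sub>R x + v *\<^sub>R y + z) - h z) \<le> \<dots>" .
  qed
qed

text \<open>By continuity the supremum over shifts may be restricted to a countable dense set, and
  running maxima make it an increasing limit. This gives measurability, and it is how the convex
  order, which tests real functions only, reaches a transform that may be infinite.\<close>

lemma Q_bar_convex_sequence:
  assumes \<psi>: "convex_on UNIV \<psi>"
  obtains \<phi> :: "nat \<Rightarrow> 'a \<Rightarrow> real" where "\<And>n. convex_on UNIV (\<phi> n)" "\<And>y. incseq (\<lambda>n. \<phi> n y)"
    "\<And>y. Q_bar c (ereal \<circ> \<psi>) y = (SUP n. ereal (\<phi> n y))"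
proof -
  obtain D :: "'a set" where D: "countable D" "\<And>X. open X \<Longrightarrow> X \<noteq> {} \<Longrightarrow> \<exists>d\<in>D. d \<in> X"
    using countable_dense_setE by blast
  have "D \<noteq> {}" using D(2)[OF open_UNIV] by auto
  then obtain d :: "nat \<Rightarrow> 'a" where d: "range d = D" using range_from_nat_into[OF _ D(1)] by blast
  define f where "f k y = \<psi> (y + d k) - h (d k)" for k :: nat and y
  define \<phi> where "\<phi> n y = Max ((\<lambda>k. f k y) ` {..n})" for n y
  have f_le: "f k y \<le> \<phi> n y" if "k \<le> n" for k n y
    unfolding \<phi>_def using that by (intro Max_ge) auto
  have conv: "convex_on UNIV (\<phi> n)" for n
    unfolding \<phi>_def f_def by (intro convex_on_Max convex_translate_minus \<psi>) auto
  have inc: "incseq (\<lambda>n. \<phi> n y)" for y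
    unfolding \<phi>_def by (intro monoI Max_mono) auto
  have "Q_bar c (ereal \<circ> \<psi>) y = (SUP n. ereal (\<phi> n y))" for y
  proof (rule antisym)
    show "(SUP n. ereal (\<phi> n y)) \<le> Q_bar c (ereal \<circ> \<psi>) y"
    proof (rule SUP_least)
      fix n
      have "\<phi> n y \<in> (\<lambda>k. f k y) ` {..n}" unfolding \<phi>_def by (intro Max_in) auto
      then obtain k where "\<phi> n y = f k y" by blast
      then show "ereal (\<phi> n y) \<le> Q_bar c (ereal \<circ> \<psi>) y"
        using Q_bar_ge[of \<psi> "y + d k" y] by (simp add: f_def)
    qed
    show "Q_bar c (ereal \<circ> \<psi>) y \<le> (SUP n. ereal (\<phi> n y))"
      unfolding Q_bar_shift
    proof (rule SUP_least, rule ccontr)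
      fix z assume "\<not> ereal (\<psi> (y + z) - h z) \<le> (SUP n. ereal (\<phi> n y))"
      then have less: "(SUP n. ereal (\<phi> n y)) < ereal (\<psi> (y + z) - h z)" by simp
      moreover have "ereal (\<phi> 0 y) \<le> (SUP n. ereal (\<phi> n y))" by (rule SUP_upper) simp
      ultimately obtain r where r: "(SUP n. ereal (\<phi> n y)) = ereal r"
        by (cases "SUP n. ereal (\<phi> n y)") auto
      have "continuous_on UNIV (\<lambda>z. \<psi> (y + z) - h z)"
        using continuous_on_compose[OF continuous_on_add[OF continuous_on_const continuous_on_id]
            convex_on_UNIV_continuous[OF \<psi>], of UNIV y]
        by (intro continuous_on_diff convex_on_UNIV_continuous[OF h_convex]) (simp add: o_def)
      \<comment> \<open>The superlevel set is open and nonempty, so it contains one of the dense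
        shifts \<open>d k\<close>.\<close>
      then have "open {z. r < \<psi> (y + z) - h z}"
        by (intro open_Collect_less continuous_on_const)
      moreover have "z \<in> {z. r < \<psi> (y + z) - h z}" using less r by simp
      ultimately obtain k where k: "r < f k y" using D(2) d unfolding f_def by blast
      have "ereal (\<phi> k y) \<le> ereal r" unfolding r[symmetric] by (rule SUP_upper) simp
      then show False using k f_le[of k k y] by simp
    qed
  qed
  then show ?thesis using that conv inc by blast
qed

lemma Q_bar_measurable:
  assumes "convex_on UNIV \<psi>"
  shows "Q_bar c (ereal \<circ> \<psi>) \<in> borel_measurable borel"
proof -
  obtain \<phi> :: "nat \<Rightarrow> 'a \<Rightarrow> real" where \<phi>: "\<And>n. convex_on UNIV (\<phi> n)"
    "\<And>y. Q_bar c (ereal \<circ> \<psi>) y = (SUP n. ereal (\<phi> n y))"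
    using Q_bar_convex_sequence[OF assms] by metis
  have [measurable]: "\<phi> n \<in> borel_measurable borel" for n
    by (rule convex_on_UNIV_measurable[OF \<phi>(1)])
  have "(\<lambda>y. SUP n. ereal (\<phi> n y)) \<in> borel_measurable borel" by measurable
  then show ?thesis using \<phi>(2) by (metis (no_types, lifting) ext)
qed

end

section \<open>Weak duality\<close>

lemma couplingsD:
  assumes "\<pi> \<in> couplings \<mu> \<eta>"
  shows "prob_space \<pi>" "fst \<in> measurable \<pi> borel" "snd \<in> measurable \<pi> borel"
    "distr \<pi> borel fst = \<mu>" "distr \<pi> borel snd = \<eta>"
proof -
  have s: "sets \<pi> = sets (borel \<Otimes>\<^sub>M borel)" using assms by (simp add: couplings_def)
  show "fst \<in> measurable \<pi> borel" "snd \<in> measurable \<pi> borel"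
    unfolding measurable_cong_sets[OF s refl] by simp_all
qed (use assms in \<open>auto simp: couplings_def\<close>)

lemma couplings_integral:
  fixes f :: "'a::euclidean_space \<Rightarrow> real"
  assumes \<pi>: "\<pi> \<in> couplings \<mu> \<eta>" and f: "f \<in> borel_measurable borel"
  shows "integrable \<mu> f \<longleftrightarrow> integrable \<pi> (\<lambda>z. f (fst z))"
    "(\<integral>x. f x \<partial>\<mu>) = (\<integral>z. f (fst z) \<partial>\<pi>)"
    "integrable \<eta> f \<longleftrightarrow> integrable \<pi> (\<lambda>z. f (snd z))"
    "(\<integral>x. f x \<partial>\<eta>) = (\<integral>z. f (snd z) \<partial>\<pi>)"
  using integrable_distr_eq[OF couplingsD(2)[OF \<pi>] f] integral_distr[OF couplingsD(2)[OF \<pi>] f]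
    integrable_distr_eq[OF couplingsD(3)[OF \<pi>] f] integral_distr[OF couplingsD(3)[OF \<pi>] f]
  by (simp_all add: couplingsD(4,5)[OF \<pi>])

lemma couplings_AE_snd:
  fixes f g :: "'a::euclidean_space \<Rightarrow> ereal"
  assumes \<pi>: "\<pi> \<in> couplings \<mu> \<eta>" and AE: "AE y in \<eta>. f y = g y"
    and [measurable]: "f \<in> borel_measurable borel" "g \<in> borel_measurable borel"
  shows "AE z in \<pi>. f (snd z) = g (snd z)"
proof -
  have "{y \<in> space borel. f y = g y} \<in> sets borel" by measurable
  then show ?thesis
    using AE unfolding couplingsD(5)[OF \<pi>, symmetric]
    by (subst (asm) AE_distr_iff[OF couplingsD(3)[OF \<pi>]]) auto
qed

lemma integrable_squeeze:
  fixes f l u :: "'a \<Rightarrow> real"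
  assumes f: "f \<in> borel_measurable M" and "integrable M l" "integrable M u"
    and "AE x in M. l x \<le> f x" "AE x in M. f x \<le> u x"
  shows "integrable M f"
proof (rule Bochner_Integration.integrable_bound)
  show "integrable M (\<lambda>x. \<bar>l x\<bar> + \<bar>u x\<bar>)" using assms(2,3) by simp
  show "AE x in M. norm (f x) \<le> norm (\<bar>l x\<bar> + \<bar>u x\<bar>)"
    using assms(4,5) by eventually_elim auto
qed fact

context transport_cost
begin

lemma h_measurable [measurable]: "h \<in> borel_measurable borel"
  by (rule convex_on_UNIV_measurable[OF h_convex])

text \<open>The choice \<open>x = y\<close> bounds the transform below by
  \<open>\<psi> y - h 0\<close>, which is integrable. The formula for \<open>g\<close> is exported
  because the same \<open>g\<close> is later integrated against measures other than
  \<open>\<nu>\<close>.\<close>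

lemma Q_bar_integral_cases:
  assumes \<psi>: "convex_on UNIV \<psi>" "\<psi> \<in> C_b p" and \<nu>: "\<nu> \<in> P p"
  obtains (finite) g where "g \<in> borel_measurable borel" "integrable \<nu> g"
      "AE y in \<nu>. Q_bar c (ereal \<circ> \<psi>) y = ereal (g y)"
      "\<And>y. g y = real_of_ereal (Q_bar c (ereal \<circ> \<psi>) y)"
      "ext_integral \<nu> (Q_bar c (ereal \<circ> \<psi>)) = ereal (\<integral>y. g y \<partial>\<nu>)"
    | (infinite) "ext_integral \<nu> (Q_bar c (ereal \<circ> \<psi>)) = \<infinity>"
proof -
  interpret prob_space \<nu> by (rule PD[OF \<nu>])
  note [measurable] = Q_bar_measurable[OF \<psi>(1)]
  have "Q_bar c (ereal \<circ> \<psi>) \<in> borel_measurable \<nu>" by (simp add: P_measurable[OF \<nu>])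
  moreover have "integrable \<nu> (\<lambda>y. \<psi> y - h 0)"
    using C_b_integrable[OF \<nu> \<psi>(2)] by simp
  moreover have "ereal (\<psi> y - h 0) \<le> Q_bar c (ereal \<circ> \<psi>) y" for y
    using Q_bar_ge[of \<psi> y y] by simp
  ultimately show ?thesis
  proof (rule ext_integral_bounded_below)
    assume *: "integrable \<nu> (\<lambda>y. real_of_ereal (Q_bar c (ereal \<circ> \<psi>) y))"
      "AE y in \<nu>. Q_bar c (ereal \<circ> \<psi>) y = ereal (real_of_ereal (Q_bar c (ereal \<circ> \<psi>) y))"
      "ext_integral \<nu> (Q_bar c (ereal \<circ> \<psi>)) = ereal (\<integral>y. real_of_ereal (Q_bar c (ereal \<circ> \<psi>) y) \<partial>\<nu>)"
    show thesis by (rule finite[OF _ *(1,2) refl *(3)]) measurable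
  qed (rule infinite)
qed

text \<open>Integrate \<open>\<psi> x \<le> g y + c x y\<close> against \<open>\<pi>\<close>, then
  pass from \<open>\<xi>\<close> to \<open>\<mu>\<close> by the convex order.\<close>

lemma J_forward_le_cost:
  assumes \<psi>: "convex_on UNIV \<psi>" "\<psi> \<in> C_b p" and \<mu>: "\<mu> \<in> P p" and \<nu>: "\<nu> \<in> P p"
    and \<xi>: "\<xi> \<in> P_above \<mu>" and \<pi>: "\<pi> \<in> couplings \<xi> \<nu>"
  shows "J_forward c \<mu> \<nu> (ereal \<circ> \<psi>) \<le> ext_integral \<pi> (\<lambda>(x, y). ereal (c x y))"
proof (rule Q_bar_integral_cases[OF \<psi> \<nu>])
  assume infinite: "ext_integral \<nu> (Q_bar c (ereal \<circ> \<psi>)) = \<infinity>"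
  then show ?thesis
    using ext_integral_eq_lebesgue_integral[OF C_b_integrable[OF \<mu> \<psi>(2)]]
    by (simp add: J_forward_def comp_def)
next
  fix g
  assume finite: "g \<in> borel_measurable borel" "integrable \<nu> g"
    "AE y in \<nu>. Q_bar c (ereal \<circ> \<psi>) y = ereal (g y)"
    "\<And>y. g y = real_of_ereal (Q_bar c (ereal \<circ> \<psi>) y)"
    "ext_integral \<nu> (Q_bar c (ereal \<circ> \<psi>)) = ereal (\<integral>y. g y \<partial>\<nu>)"
  note [measurable] = Q_bar_measurable[OF \<psi>(1)] convex_on_UNIV_measurable[OF \<psi>(1)]
    couplingsD(2,3)[OF \<pi>] finite(1)
  have \<xi>1: "\<xi> \<in> P 1" "\<mu> \<le>\<^sub>c\<^sub>x \<xi>" using \<xi> by (auto simp: P_above_def)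
  have m: "(\<lambda>z. h (fst z - snd z)) \<in> borel_measurable \<pi>" by measurable
  from m integrable_zero show ?thesis
  proof (rule ext_integral_real_bounded_below)
    assume int_c: "integrable \<pi> (\<lambda>z. h (fst z - snd z))"
      and cost: "ext_integral \<pi> (\<lambda>z. ereal (h (fst z - snd z))) = ereal (\<integral>z. h (fst z - snd z) \<partial>\<pi>)"
    have "AE z in \<pi>. Q_bar c (ereal \<circ> \<psi>) (snd z) = ereal (g (snd z))"
      using finite(3) by (rule couplings_AE_snd[OF \<pi>]) measurable
    then have le: "AE z in \<pi>. \<psi> (fst z) \<le> g (snd z) + h (fst z - snd z)"
    proof eventually_elim
      case (elim z)
      then show ?case using Q_bar_ge[of \<psi> "fst z" "snd z"] by simp
    qed
    have int_g: "integrable \<pi> (\<lambda>z. g (snd z))"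
      using finite(2) couplings_integral(3)[OF \<pi> finite(1)] by simp
    \<comment> \<open>Membership in \<open>P_above\<close> gives \<open>\<xi>\<close> a first moment
      only, while \<open>\<psi>\<close> may grow with power \<open>p\<close>. Its integrability
      comes from the coupling: an affine minorant below, \<open>g\<close> plus the cost
      above.\<close>
    obtain l where l: "integrable \<xi> l" "\<And>x. l x \<le> \<psi> x"
      using convex_minorant_integrable[OF \<psi>(1) PD(1)[OF \<xi>1(1)]] P_integrable_id[OF \<xi>1(1)] by auto
    have "l \<in> borel_measurable borel"
      using l(1) borel_measurable_integrable P_measurable[OF \<xi>1(1)] by metis
    then have "integrable \<pi> (\<lambda>z. l (fst z))" using l(1) couplings_integral(1)[OF \<pi>] by blast
    then have int_\<psi>: "integrable \<pi> (\<lambda>z. \<psi> (fst z))"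
      by (rule integrable_squeeze[rotated, OF _ Bochner_Integration.integrable_add[OF int_g int_c] _ le])
         (use l(2) in auto)
    then have \<psi>\<xi>: "integrable \<xi> \<psi>" by (simp add: couplings_integral(1)[OF \<pi>])
    have "(\<integral>x. \<psi> x \<partial>\<mu>) \<le> (\<integral>x. \<psi> x \<partial>\<xi>)"
      by (rule convex_order_integral(2)[OF \<xi>1(2) P_mono_1[OF \<mu> p_ge_1] \<psi>(1) \<psi>\<xi>])
    also have "\<dots> = (\<integral>z. \<psi> (fst z) \<partial>\<pi>)" by (simp add: couplings_integral(2)[OF \<pi>])
    also have "\<dots> \<le> (\<integral>z. g (snd z) + h (fst z - snd z) \<partial>\<pi>)"
      by (rule integral_mono_AE[OF int_\<psi> Bochner_Integration.integrable_add[OF int_g int_c] le])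
    also have "\<dots> = (\<integral>y. g y \<partial>\<nu>) + (\<integral>z. h (fst z - snd z) \<partial>\<pi>)"
      using int_g int_c by (simp add: couplings_integral(4)[OF \<pi>])
    finally show ?thesis
      using ext_integral_eq_lebesgue_integral[OF C_b_integrable[OF \<mu> \<psi>(2)]]
      by (simp add: J_forward_def o_def finite(5)[unfolded o_def] case_prod_unfold cost)
  qed (auto simp: h_nonneg case_prod_unfold)
qed

text \<open>The order does not apply to the transform itself, which may be infinite. It is applied
  to the approximations \<open>\<phi> n\<close>; monotone convergence then carries finiteness almost
  everywhere, integrability and the inequality from \<open>\<nu>\<close> to
  \<open>\<eta>\<close>.\<close>

lemma Q_bar_integral_convex_order:
  assumes \<psi>: "convex_on UNIV \<psi>" "\<psi> \<in> C_b p" and \<nu>: "\<nu> \<in> P p" and \<eta>: "\<eta> \<in> P_below \<nu>"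
    and g: "integrable \<nu> g" "AE y in \<nu>. Q_bar c (ereal \<circ> \<psi>) y = ereal (g y)"
      "\<And>y. g y = real_of_ereal (Q_bar c (ereal \<circ> \<psi>) y)"
  shows "AE y in \<eta>. Q_bar c (ereal \<circ> \<psi>) y = ereal (g y)" "integrable \<eta> g"
    "(\<integral>y. g y \<partial>\<eta>) \<le> (\<integral>y. g y \<partial>\<nu>)"
proof -
  have \<eta>1: "\<eta> \<in> P 1" "\<eta> \<le>\<^sub>c\<^sub>x \<nu>" using \<eta> by (auto simp: P_below_def)
  interpret \<eta>: prob_space \<eta> by (rule PD[OF \<eta>1(1)])
  interpret \<nu>: prob_space \<nu> by (rule PD[OF \<nu>])
  obtain \<phi> :: "nat \<Rightarrow> 'a \<Rightarrow> real" where \<phi>: "\<And>n. convex_on UNIV (\<phi> n)" "\<And>y. incseq (\<lambda>n. \<phi> n y)"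
    and sup: "\<And>y. Q_bar c (ereal \<circ> \<psi>) y = (SUP n. ereal (\<phi> n y))"
    using Q_bar_convex_sequence[OF \<psi>(1)] by metis
  note [measurable] = Q_bar_measurable[OF \<psi>(1)] convex_on_UNIV_measurable[OF \<phi>(1)]
  have \<phi>_le: "ereal (\<phi> n y) \<le> Q_bar c (ereal \<circ> \<psi>) y" for n y
    unfolding sup by (rule SUP_upper) simp
  have \<phi>_le_g: "AE y in \<nu>. \<phi> n y \<le> g y" for n
    using g(2)
  proof eventually_elim
    case (elim y)
    then show ?case using \<phi>_le[of n y] by simp
  qed
  have int_\<nu>: "integrable \<nu> (\<phi> n)" for n
  proof -
    obtain l where l: "integrable \<nu> l" "\<And>x. l x \<le> \<phi> n x"
      using convex_minorant_integrable[OF \<phi>(1) PD(1)[OF \<nu>] P_integrable_id[OF \<nu> p_ge_1]] by blast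
    show ?thesis
      by (rule integrable_squeeze[OF _ l(1) g(1) _ \<phi>_le_g])
         (use l(2) convex_on_UNIV_measurable[OF \<phi>(1)] in \<open>auto simp: P_measurable[OF \<nu>]\<close>)
  qed
  note co = convex_order_integral[OF \<eta>1(2,1) \<phi>(1) int_\<nu>]
  have le_g: "(\<integral>y. \<phi> n y \<partial>\<eta>) \<le> (\<integral>y. g y \<partial>\<nu>)" for n
    using co(2)[of n] integral_mono_AE[OF int_\<nu> g(1) \<phi>_le_g, of n] by linarith
  define B where "B = (\<integral>y. g y \<partial>\<nu>) - (\<integral>y. \<phi> 0 y \<partial>\<eta>)"
  \<comment> \<open>Subtracting \<open>\<phi> 0\<close> makes the sequence nonnegative. The integral
    of its supremum is at most \<open>B\<close>, so the supremum is finite almost everywhere under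
    \<open>\<eta>\<close>.\<close>
  define s where "s y = (SUP n. ennreal (\<phi> n y - \<phi> 0 y))" for y
  have "(\<integral>\<^sup>+ y. s y \<partial>\<eta>) = (SUP n. \<integral>\<^sup>+ y. ennreal (\<phi> n y - \<phi> 0 y) \<partial>\<eta>)"
    unfolding s_def
  proof (rule nn_integral_monotone_convergence_SUP)
    show "incseq (\<lambda>n y. ennreal (\<phi> n y - \<phi> 0 y))"
      using \<phi>(2) by (auto simp: incseq_def le_fun_def intro!: ennreal_leI)
    show "(\<lambda>y. ennreal (\<phi> n y - \<phi> 0 y)) \<in> borel_measurable \<eta>" for n
      unfolding P_measurable[OF \<eta>1(1)] by measurable
  qed
  also have "\<dots> \<le> ennreal B"
  proof (rule SUP_least)
    fix n
    have "(\<integral>\<^sup>+ y. ennreal (\<phi> n y - \<phi> 0 y) \<partial>\<eta>) = ennreal (\<integral>y. \<phi> n y - \<phi> 0 y \<partial>\<eta>)"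
      using co(1) \<phi>(2) by (intro nn_integral_eq_integral) (auto dest: incseqD[of _ 0 n])
    also have "\<dots> \<le> ennreal B"
      using co(1) le_g[of n] by (intro ennreal_leI) (simp add: B_def)
    finally show "(\<integral>\<^sup>+ y. ennreal (\<phi> n y - \<phi> 0 y) \<partial>\<eta>) \<le> ennreal B" .
  qed
  finally have "(\<integral>\<^sup>+ y. s y \<partial>\<eta>) \<noteq> \<infinity>" by (auto simp: top_unique)
  moreover have "s \<in> borel_measurable \<eta>"
    unfolding s_def P_measurable[OF \<eta>1(1)] by measurable
  ultimately have "AE y in \<eta>. s y \<noteq> \<infinity>" by (intro nn_integral_PInf_AE)
  then show AE: "AE y in \<eta>. Q_bar c (ereal \<circ> \<psi>) y = ereal (g y)"
  proof eventually_elim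
    case (elim y)
    then obtain b where b: "s y = ennreal b" "0 \<le> b" by (cases "s y") auto
    have "\<phi> n y \<le> b + \<phi> 0 y" for n
    proof -
      have "ennreal (\<phi> n y - \<phi> 0 y) \<le> ennreal b"
        unfolding b(1)[symmetric] s_def by (rule SUP_upper) simp
      then show ?thesis using b(2) by simp
    qed
    then have "Q_bar c (ereal \<circ> \<psi>) y \<le> ereal (b + \<phi> 0 y)"
      unfolding sup by (intro SUP_least) simp
    then show ?case using \<phi>_le[of 0 y] g(3)[of y]
      by (cases "Q_bar c (ereal \<circ> \<psi>) y") auto
  qed
  \<comment> \<open>Second passage to the limit, now for signed functions with the real limit
    \<open>g\<close>.\<close>
  have "incseq (\<lambda>n. \<integral>y. \<phi> n y \<partial>\<eta>)"
    using co(1) \<phi>(2) by (intro incseq_SucI integral_mono) (auto dest: incseq_SucD)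
  then obtain L where L: "(\<lambda>n. \<integral>y. \<phi> n y \<partial>\<eta>) \<longlonglongrightarrow> L" "\<forall>n. (\<integral>y. \<phi> n y \<partial>\<eta>) \<le> L"
    using incseq_convergent[of "\<lambda>n. \<integral>y. \<phi> n y \<partial>\<eta>" "\<integral>y. g y \<partial>\<nu>"] le_g by blast
  have lim: "AE y in \<eta>. (\<lambda>n. \<phi> n y) \<longlonglongrightarrow> g y"
    using AE
  proof eventually_elim
    case (elim y)
    have "(\<lambda>n. ereal (\<phi> n y)) \<longlonglongrightarrow> (SUP n. ereal (\<phi> n y))"
      using \<phi>(2)[of y] by (intro LIMSEQ_SUP) (auto simp: incseq_def)
    then show ?case using elim by (simp add: sup)
  qed
  have mono: "AE y in \<eta>. mono (\<lambda>n. \<phi> n y)" using \<phi>(2) by (simp add: mono_def)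
  have gm: "g \<in> borel_measurable \<eta>"
  proof -
    have "(\<lambda>y. real_of_ereal (Q_bar c (ereal \<circ> \<psi>) y)) \<in> borel_measurable borel" by measurable
    then show ?thesis by (simp add: g(3)[abs_def] P_measurable[OF \<eta>1(1)])
  qed
  show "integrable \<eta> g" by (rule integrable_monotone_convergence[OF co(1) mono lim L(1) gm])
  have "(\<integral>y. g y \<partial>\<eta>) = L" by (rule integral_monotone_convergence[OF co(1) mono lim L(1) gm])
  also have "L \<le> (\<integral>y. g y \<partial>\<nu>)" using L(1) le_g by (intro LIMSEQ_le_const2) auto
  finally show "(\<integral>y. g y \<partial>\<eta>) \<le> (\<integral>y. g y \<partial>\<nu>)" .
qed

text \<open>The potential may be infinite and thus lie outside the class that defines
  \<open>D_backward\<close>, so weak duality is proved for it directly. The assumption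
  \<open>fin\<close> excludes the convention \<open>\<infinity> - \<infinity> = \<infinity>\<close>
  in the functional.\<close>

lemma J_backward_Q_bar_le_cost:
  assumes \<psi>: "convex_on UNIV \<psi>" "\<psi> \<in> C_b p" and \<mu>: "\<mu> \<in> P p" and \<nu>: "\<nu> \<in> P p"
    and fin: "ext_integral \<nu> (Q_bar c (ereal \<circ> \<psi>)) \<noteq> \<infinity>"
    and \<eta>: "\<eta> \<in> P_below \<nu>" and \<pi>: "\<pi> \<in> couplings \<mu> \<eta>"
  shows "J_backward c \<mu> \<nu> (Q_bar c (ereal \<circ> \<psi>)) \<le> ext_integral \<pi> (\<lambda>(x, y). ereal (c x y))"
proof (rule Q_bar_integral_cases[OF \<psi> \<nu>])
  assume infinite: "ext_integral \<nu> (Q_bar c (ereal \<circ> \<psi>)) = \<infinity>"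
  then show ?thesis using fin by simp
next
  fix g
  assume finite: "g \<in> borel_measurable borel" "integrable \<nu> g"
    "AE y in \<nu>. Q_bar c (ereal \<circ> \<psi>) y = ereal (g y)"
    "\<And>y. g y = real_of_ereal (Q_bar c (ereal \<circ> \<psi>) y)"
    "ext_integral \<nu> (Q_bar c (ereal \<circ> \<psi>)) = ereal (\<integral>y. g y \<partial>\<nu>)"
  define G where "G = Q_bar c (ereal \<circ> \<psi>)"
  note [measurable] = Q_bar_measurable[OF \<psi>(1), folded G_def] couplingsD(2,3)[OF \<pi>] finite(1)
  note g = Q_bar_integral_convex_order[OF \<psi> \<nu> \<eta> finite(2,3,4), folded G_def]
  interpret \<pi>: prob_space \<pi> by (rule couplingsD[OF \<pi>])
  have AE_G: "AE z in \<pi>. G (snd z) = ereal (g (snd z))"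
    using g(1) by (rule couplings_AE_snd[OF \<pi>]) measurable
  \<comment> \<open>\<open>G\<close> is finite almost surely under a probability measure, hence
    somewhere. That point bounds \<open>Q c G\<close> from above and \<open>\<psi>\<close> bounds it
    from below, so the transform is real.\<close>
  obtain y0 where y0: "G y0 = ereal (g y0)"
  proof -
    have "\<exists>z. G (snd z) = ereal (g (snd z))"
    proof (rule ccontr)
      assume "\<nexists>z. G (snd z) = ereal (g (snd z))"
      then have "AE z in \<pi>. False" using AE_G by simp
      then show False by simp
    qed
    then show ?thesis using that by blast
  qed
  define q where "q x = real_of_ereal (Q c G x)" for x
  have "Q c G x = ereal (q x)" for x
  proof -
    have "Q c G x \<le> ereal (g y0 + h (x - y0))" using Q_le[of G x y0] y0 by simp
    moreover have "ereal (\<psi> x) \<le> Q c G x" using Q_Q_bar_ge by (simp add: G_def)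
    ultimately show ?thesis by (cases "Q c G x") (auto simp: q_def)
  qed
  then have q: "Q c G = ereal \<circ> q" by auto
  have q_convex: "convex_on UNIV q"
    using Q_bar_ext_convex[OF \<psi>(1)] q unfolding G_def by (rule Q_real_convex)
  note [measurable] = convex_on_UNIV_measurable[OF q_convex]
  have m: "(\<lambda>z. h (fst z - snd z)) \<in> borel_measurable \<pi>" by measurable
  from m integrable_zero show ?thesis
  proof (rule ext_integral_real_bounded_below)
    assume int_c: "integrable \<pi> (\<lambda>z. h (fst z - snd z))"
      and cost: "ext_integral \<pi> (\<lambda>z. ereal (h (fst z - snd z))) = ereal (\<integral>z. h (fst z - snd z) \<partial>\<pi>)"
    have le: "AE z in \<pi>. q (fst z) \<le> g (snd z) + h (fst z - snd z)"
      using AE_G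
    proof eventually_elim
      case (elim z)
      then show ?case using Q_le[of G "fst z" "snd z"] q by simp
    qed
    have int_g: "integrable \<pi> (\<lambda>z. g (snd z))"
      using g(2) couplings_integral(3)[OF \<pi> finite(1)] by simp
    have ge: "\<psi> x \<le> q x" for x
      using Q_Q_bar_ge[of \<psi> x] q by (simp add: G_def)
    have "integrable \<pi> (\<lambda>z. \<psi> (fst z))"
      using C_b_integrable[OF \<mu> \<psi>(2)] convex_on_UNIV_measurable[OF \<psi>(1)]
      by (simp add: couplings_integral(1)[OF \<pi>])
    then have int_q: "integrable \<pi> (\<lambda>z. q (fst z))"
      by (rule integrable_squeeze[rotated, OF _ Bochner_Integration.integrable_add[OF int_g int_c] _ le])
         (use ge in auto)
    then have int_q\<mu>: "integrable \<mu> q" by (simp add: couplings_integral(1)[OF \<pi>])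
    have "(\<integral>x. q x \<partial>\<mu>) = (\<integral>z. q (fst z) \<partial>\<pi>)" by (simp add: couplings_integral(2)[OF \<pi>])
    also have "\<dots> \<le> (\<integral>z. g (snd z) + h (fst z - snd z) \<partial>\<pi>)"
      by (rule integral_mono_AE[OF int_q Bochner_Integration.integrable_add[OF int_g int_c] le])
    also have "\<dots> = (\<integral>y. g y \<partial>\<eta>) + (\<integral>z. h (fst z - snd z) \<partial>\<pi>)"
      using int_g int_c by (simp add: couplings_integral(4)[OF \<pi>])
    also have "\<dots> \<le> (\<integral>y. g y \<partial>\<nu>) + (\<integral>z. h (fst z - snd z) \<partial>\<pi>)" using g(3) by simp
    finally show ?thesis
      unfolding J_backward_def G_def[symmetric] q
      using ext_integral_eq_lebesgue_integral[OF int_q\<mu>] finite(5)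
      by (simp add: o_def[of ereal q] G_def[symmetric] case_prod_unfold cost)
  qed (auto simp: h_nonneg case_prod_unfold)
qed

end

section \<open>Competitors from a finite partition\<close>

text \<open>Integrate the supporting affine function at the barycentre. The weight is not
  normalised, so the statement serves for cells of \<open>\<mu>\<close>, for pieces of
  \<open>\<nu>\<close> and, with \<open>m = 1\<close>, for conditional laws.\<close>

lemma weighted_jensen:
  fixes f :: "'a::euclidean_space \<Rightarrow> real"
  assumes f: "convex_on UNIV f" and w: "integrable M w" "\<And>z. 0 \<le> w z"
    and wX: "integrable M (\<lambda>z. w z *\<^sub>R X z)" and wf: "integrable M (\<lambda>z. w z * f (X z))"
    and m: "(\<integral>z. w z \<partial>M) = m" "0 < m"
  shows "m * f ((\<integral>z. w z *\<^sub>R X z \<partial>M) /\<^sub>R m) \<le> (\<integral>z. w z * f (X z) \<partial>M)"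
proof -
  define x0 where "x0 = (\<integral>z. w z *\<^sub>R X z \<partial>M) /\<^sub>R m"
  obtain q where q: "\<And>x. f x0 + q \<bullet> (x - x0) \<le> f x" using convex_subgradient[OF f] by blast
  have mx0: "m *\<^sub>R x0 = (\<integral>z. w z *\<^sub>R X z \<partial>M)" using m(2) by (simp add: x0_def)
  have int: "integrable M (\<lambda>z. q \<bullet> (w z *\<^sub>R X z))" by (rule integrable_inner_right) (rule wX)
  have "(\<integral>z. w z * (f x0 - q \<bullet> x0) + q \<bullet> (w z *\<^sub>R X z) \<partial>M) = m * (f x0 - q \<bullet> x0) + q \<bullet> (m *\<^sub>R x0)"
    unfolding mx0 using w(1) int wX m(1)
    by (subst Bochner_Integration.integral_add) (auto simp del: inner_scaleR_right)
  also have "\<dots> = m * f x0" by (simp add: algebra_simps)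
  finally have "m * f x0 = (\<integral>z. w z * (f x0 - q \<bullet> x0) + q \<bullet> (w z *\<^sub>R X z) \<partial>M)" by simp
  also have "\<dots> \<le> (\<integral>z. w z * f (X z) \<partial>M)"
  proof (rule integral_mono[OF Bochner_Integration.integrable_add[OF integrable_mult_left[OF w(1)] int] wf])
    fix z
    have "w z * (f x0 + q \<bullet> (X z - x0)) \<le> w z * f (X z)" by (intro mult_left_mono q w)
    then show "w z * (f x0 - q \<bullet> x0) + q \<bullet> (w z *\<^sub>R X z) \<le> w z * f (X z)"
      by (simp add: inner_diff_right algebra_simps)
  qed
  finally show ?thesis unfolding x0_def .
qed

lemma distr_density_pair:
  fixes k :: "'a \<Rightarrow> 'b \<Rightarrow> ennreal"
  assumes M: "prob_space M" and N: "prob_space N"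
    and k[measurable]: "case_prod k \<in> borel_measurable (M \<Otimes>\<^sub>M N)"
    and M1: "AE x in M. (\<integral>\<^sup>+ z. k x z \<partial>N) = 1" and N1: "AE z in N. (\<integral>\<^sup>+ x. k x z \<partial>M) = 1"
  shows "distr (density (M \<Otimes>\<^sub>M N) (case_prod k)) M fst = M"
    "distr (density (M \<Otimes>\<^sub>M N) (case_prod k)) N snd = N"
proof -
  interpret M: prob_space M by fact
  interpret N: prob_space N by fact
  interpret pair_sigma_finite M N ..
  show "distr (density (M \<Otimes>\<^sub>M N) (case_prod k)) M fst = M"
  proof (rule measure_eqI)
    fix A assume "A \<in> sets (distr (density (M \<Otimes>\<^sub>M N) (case_prod k)) M fst)"
    then have A[measurable]: "A \<in> sets M" by simp
    have "emeasure (distr (density (M \<Otimes>\<^sub>M N) (case_prod k)) M fst) A =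
        emeasure (density (M \<Otimes>\<^sub>M N) (case_prod k)) (A \<times> space N)"
      using sets.sets_into_space[OF A]
      by (subst emeasure_distr) (auto intro!: arg_cong2[where f = emeasure] simp: space_pair_measure)
    also have "\<dots> = (\<integral>\<^sup>+ v. case_prod k v * indicator (A \<times> space N) v \<partial>(M \<Otimes>\<^sub>M N))"
      by (rule emeasure_density) measurable
    also have "\<dots> = (\<integral>\<^sup>+ x. \<integral>\<^sup>+ z. k x z * indicator (A \<times> space N) (x, z) \<partial>N \<partial>M)"
      by (subst N.nn_integral_fst[symmetric]) auto
    also have "\<dots> = (\<integral>\<^sup>+ x. indicator A x \<partial>M)"
    proof (rule nn_integral_cong_AE)
      show "AE x in M. (\<integral>\<^sup>+ z. k x z * indicator (A \<times> space N) (x, z) \<partial>N) = indicator A x"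
        using M1
      proof eventually_elim
        case (elim x)
        have "(\<integral>\<^sup>+ z. k x z * indicator (A \<times> space N) (x, z) \<partial>N) = (\<integral>\<^sup>+ z. k x z * indicator A x \<partial>N)"
          by (intro nn_integral_cong) (auto simp: indicator_def)
        then show ?case using elim by (auto simp: indicator_def)
      qed
    qed
    finally show "emeasure (distr (density (M \<Otimes>\<^sub>M N) (case_prod k)) M fst) A = emeasure M A" by simp
  qed simp
  show "distr (density (M \<Otimes>\<^sub>M N) (case_prod k)) N snd = N"
  proof (rule measure_eqI)
    fix A assume "A \<in> sets (distr (density (M \<Otimes>\<^sub>M N) (case_prod k)) N snd)"
    then have A[measurable]: "A \<in> sets N" by simp
    have "emeasure (distr (density (M \<Otimes>\<^sub>M N) (case_prod k)) N snd) A =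
        emeasure (density (M \<Otimes>\<^sub>M N) (case_prod k)) (space M \<times> A)"
      using sets.sets_into_space[OF A]
      by (subst emeasure_distr) (auto intro!: arg_cong2[where f = emeasure] simp: space_pair_measure)
    also have "\<dots> = (\<integral>\<^sup>+ v. case_prod k v * indicator (space M \<times> A) v \<partial>(M \<Otimes>\<^sub>M N))"
      by (rule emeasure_density) measurable
    also have "\<dots> = (\<integral>\<^sup>+ z. \<integral>\<^sup>+ x. k x z * indicator (space M \<times> A) (x, z) \<partial>M \<partial>N)"
      by (subst nn_integral_snd[symmetric]) auto
    also have "\<dots> = (\<integral>\<^sup>+ z. indicator A z \<partial>N)"
    proof (rule nn_integral_cong_AE)
      show "AE z in N. (\<integral>\<^sup>+ x. k x z * indicator (space M \<times> A) (x, z) \<partial>M) = indicator A z"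
        using N1
      proof eventually_elim
        case (elim z)
        have "(\<integral>\<^sup>+ x. k x z * indicator (space M \<times> A) (x, z) \<partial>M) = (\<integral>\<^sup>+ x. k x z * indicator A z \<partial>M)"
          by (intro nn_integral_cong) (auto simp: indicator_def)
        then show ?case using elim by (auto simp: indicator_def)
      qed
    qed
    finally show "emeasure (distr (density (M \<Otimes>\<^sub>M N) (case_prod k)) N snd) A = emeasure N A" by simp
  qed simp
qed

text \<open>Think of \<open>X\<close> with law \<open>\<mu>\<close> and label \<open>cell X\<close>,
  and of \<open>Z\<close> with law \<open>\<nu>\<close> that gets label \<open>j\<close> with
  probability \<open>\<rho> j z\<close>; the label masses agree on both sides. Labels in
  \<open>I\<close> have positive mass since \<open>m j\<close> is a divisor, so
  \<open>cell x \<in> I\<close> is asked for almost everywhere.\<close>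

locale discretisation =
  fixes \<mu> \<nu> :: "'a::euclidean_space measure" and I :: "nat set" and cell :: "'a \<Rightarrow> nat"
    and m :: "nat \<Rightarrow> real" and \<rho> :: "nat \<Rightarrow> 'a \<Rightarrow> real"
  assumes \<mu>: "\<mu> \<in> P 1" and \<nu>: "\<nu> \<in> P 1" and I: "finite I"
    and cell_measurable: "cell \<in> measurable borel (count_space UNIV)"
    and cell_AE: "AE x in \<mu>. cell x \<in> I"
    and m: "\<And>j. j \<in> I \<Longrightarrow> m j = measure \<mu> {x. cell x = j}" and m_pos: "\<And>j. j \<in> I \<Longrightarrow> 0 < m j"
    and \<rho>: "\<rho> \<in> partitions_of_unity I" and \<rho>_mass: "\<And>j. j \<in> I \<Longrightarrow> (\<integral>z. \<rho> j z \<partial>\<nu>) = m j"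
begin

sublocale \<mu>: prob_space \<mu> by (rule PD[OF \<mu>])
sublocale \<nu>: prob_space \<nu> by (rule PD[OF \<nu>])
sublocale pair_sigma_finite \<mu> \<nu> ..

declare cell_measurable [measurable]
lemmas sets_\<mu> [measurable_cong] = PD(2)[OF \<mu>]
lemmas sets_\<nu> [measurable_cong] = PD(2)[OF \<nu>]

lemma \<rho>_measurable [measurable]: "j \<in> I \<Longrightarrow> \<rho> j \<in> borel_measurable borel"
  by (rule partitions_of_unityD[OF \<rho>])

lemma \<rho>_integrable:
  fixes f :: "'a \<Rightarrow> 'b::{banach, second_countable_topology}"
  assumes "j \<in> I" "integrable \<nu> f"
  shows "integrable \<nu> (\<lambda>z. \<rho> j z *\<^sub>R f z)"
  by (rule integrable_partition_scaleR[OF \<rho> I assms(1) sets_\<nu> assms(2)])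

text \<open>The conditional mean of \<open>Z\<close> given the label. The default 0 is met only on a
  null set of points and keeps the function bounded.\<close>

definition bary :: "nat \<Rightarrow> 'a" where
  "bary j = (if j \<in> I then (\<integral>z. \<rho> j z *\<^sub>R z \<partial>\<nu>) /\<^sub>R m j else 0)"

lemma bary_cell_measurable [measurable]: "(\<lambda>x. bary (cell x)) \<in> borel_measurable borel"
  by (rule measurable_compose[OF cell_measurable]) simp

lemma bary_bounded: "norm (bary j) \<le> (\<Sum>l\<in>I. norm (bary l))"
proof (cases "j \<in> I")
  case True
  then show ?thesis using member_le_sum[of j I "\<lambda>l. norm (bary l)"] I by auto
qed (simp add: bary_def sum_nonneg)

lemma cell_sum:
  fixes f :: "'a \<Rightarrow> real"
  assumes f: "integrable \<mu> f"
  shows "(\<integral>x. f x \<partial>\<mu>) = (\<Sum>j\<in>I. \<integral>x. indicat_real {x. cell x = j} x * f x \<partial>\<mu>)"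
proof -
  have [measurable]: "f \<in> borel_measurable borel"
    using borel_measurable_integrable[OF f] by (simp add: P_measurable[OF \<mu>])
  have int: "integrable \<mu> (\<lambda>x. indicat_real {x. cell x = j} x * f x)" for j
    using f by (rule Bochner_Integration.integrable_bound) (auto simp: indicator_def)
  have "(\<integral>x. f x \<partial>\<mu>) = (\<integral>x. (\<Sum>j\<in>I. indicat_real {x. cell x = j} x * f x) \<partial>\<mu>)"
  proof (rule integral_cong_AE)
    show "AE x in \<mu>. f x = (\<Sum>j\<in>I. indicat_real {x. cell x = j} x * f x)"
      using cell_AE
    proof eventually_elim
      case (elim x)
      have "(\<Sum>j\<in>I. indicat_real {x. cell x = j} x * f x) = (\<Sum>j\<in>I. if j = cell x then f x else 0)"
        by (intro sum.cong) (auto simp: indicator_def)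
      then show ?case using elim I by simp
    qed
  qed measurable
  then show ?thesis using int by simp
qed

lemma cell_integral: "j \<in> I \<Longrightarrow> (\<integral>x. indicat_real {x. cell x = j} x \<partial>\<mu>) = m j"
proof -
  assume "j \<in> I"
  have "{x. cell x = j} \<in> sets \<mu>" unfolding sets_\<mu> by measurable
  then show ?thesis using m[OF \<open>j \<in> I\<close>] by simp
qed

lemma integral_bary_cell:
  fixes f :: "'a \<Rightarrow> real"
  assumes [measurable]: "f \<in> borel_measurable borel"
  shows "integrable \<mu> (\<lambda>x. f (bary (cell x)))"
    and "(\<integral>x. f (bary (cell x)) \<partial>\<mu>) = (\<Sum>j\<in>I. m j * f (bary j))"
proof -
  show int: "integrable \<mu> (\<lambda>x. f (bary (cell x)))"
  proof (rule \<mu>.integrable_const_bound)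
    show "AE x in \<mu>. norm (f (bary (cell x))) \<le> (\<Sum>j\<in>I. norm (f (bary j)))"
      using cell_AE by eventually_elim (use I in \<open>auto intro!: member_le_sum\<close>)
  qed measurable
  have "(\<integral>x. f (bary (cell x)) \<partial>\<mu>) =
      (\<Sum>j\<in>I. \<integral>x. indicat_real {x. cell x = j} x * f (bary (cell x)) \<partial>\<mu>)"
    by (rule cell_sum[OF int])
  also have "\<dots> = (\<Sum>j\<in>I. m j * f (bary j))"
  proof (rule sum.cong[OF refl])
    fix j assume j: "j \<in> I"
    have "(\<integral>x. indicat_real {x. cell x = j} x * f (bary (cell x)) \<partial>\<mu>) =
        (\<integral>x. indicat_real {x. cell x = j} x * f (bary j) \<partial>\<mu>)"
      by (rule Bochner_Integration.integral_cong) (auto simp: indicator_def)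
    also have "\<dots> = m j * f (bary j)" using cell_integral[OF j] by simp
    finally show "(\<integral>x. indicat_real {x. cell x = j} x * f (bary (cell x)) \<partial>\<mu>) = m j * f (bary j)" .
  qed
  finally show "(\<integral>x. f (bary (cell x)) \<partial>\<mu>) = (\<Sum>j\<in>I. m j * f (bary j))" .
qed

lemma bary_jensen:
  assumes f: "convex_on UNIV f" "integrable \<nu> f" and j: "j \<in> I"
  shows "m j * f (bary j) \<le> (\<integral>z. \<rho> j z * f z \<partial>\<nu>)"
proof -
  have "m j * f ((\<integral>z. \<rho> j z *\<^sub>R z \<partial>\<nu>) /\<^sub>R m j) \<le> (\<integral>z. \<rho> j z * f z \<partial>\<nu>)"
    using \<rho>_integrable[OF j, of "\<lambda>_. 1 :: real"] \<rho>_integrable[OF j P_integrable_id[OF \<nu>]]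
      \<rho>_integrable[OF j f(2)] partitions_of_unityD(2)[OF \<rho> j] \<rho>_mass[OF j] m_pos[OF j]
    by (intro weighted_jensen f(1)) auto
  then show ?thesis by (simp add: bary_def j)
qed

lemma \<rho>_sum:
  fixes f :: "'a \<Rightarrow> real"
  assumes f: "integrable \<nu> f"
  shows "(\<Sum>j\<in>I. \<integral>z. \<rho> j z * f z \<partial>\<nu>) = (\<integral>z. f z \<partial>\<nu>)"
proof -
  have "(\<Sum>j\<in>I. \<integral>z. \<rho> j z * f z \<partial>\<nu>) = (\<integral>z. (\<Sum>j\<in>I. \<rho> j z * f z) \<partial>\<nu>)"
    using \<rho>_integrable[OF _ f] by (subst Bochner_Integration.integral_sum) auto
  also have "\<dots> = (\<integral>z. f z \<partial>\<nu>)"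
    by (simp add: partitions_of_unityD(3)[OF \<rho>] flip: sum_distrib_right)
  finally show ?thesis .
qed

text \<open>The barycentre takes finitely many values almost surely, so every convex function is
  integrable under its law, and the convex order reduces to Jensen on each label.\<close>

lemma T_backward_le:
  fixes h :: "'a \<Rightarrow> real"
  assumes [measurable]: "h \<in> borel_measurable borel"
    and int: "integrable \<mu> (\<lambda>x. h (x - bary (cell x)))"
  shows "T_backward (\<lambda>x y. h (x - y)) \<mu> \<nu> \<le> ereal (\<integral>x. h (x - bary (cell x)) \<partial>\<mu>)"
proof -
  define \<eta> where "\<eta> = distr \<mu> borel (\<lambda>x. bary (cell x))"
  define \<pi> where "\<pi> = distr \<mu> (borel \<Otimes>\<^sub>M borel) (\<lambda>x. (x, bary (cell x)))"
  have "prob_space \<eta>" unfolding \<eta>_def by (rule \<mu>.prob_space_distr) measurable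
  moreover have "integrable \<eta> (\<lambda>x. norm x ^ 1)"
    unfolding \<eta>_def using integral_bary_cell(1)[of norm] by (subst integrable_distr_eq) auto
  ultimately have \<eta>1: "\<eta> \<in> P 1" by (simp add: P_def \<eta>_def)
  have "\<eta> \<le>\<^sub>c\<^sub>x \<nu>"
    unfolding convex_order_def
  proof
    fix f :: "'a \<Rightarrow> real" assume "f \<in> convex_funs"
    then have f: "convex_on UNIV f" by (simp add: convex_funs_def)
    note [measurable] = convex_on_UNIV_measurable[OF f]
    obtain l where l: "integrable \<nu> l" "\<And>x. l x \<le> f x"
      using convex_minorant_integrable[OF f PD(1)[OF \<nu>]] P_integrable_id[OF \<nu>] by auto
    have f\<nu>: "f \<in> borel_measurable \<nu>" by measurable
    from f\<nu> l show "ext_integral \<eta> (\<lambda>x. ereal (f x)) \<le> ext_integral \<nu> (\<lambda>x. ereal (f x))"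
    proof (rule ext_integral_real_bounded_below)
      assume f_int: "integrable \<nu> f" and ext: "ext_integral \<nu> (\<lambda>x. ereal (f x)) = ereal (\<integral>x. f x \<partial>\<nu>)"
      have "integrable \<eta> f"
        unfolding \<eta>_def using integral_bary_cell(1)[of f] by (subst integrable_distr_eq) auto
      then have "ext_integral \<eta> (\<lambda>x. ereal (f x)) = ereal (\<integral>x. f x \<partial>\<eta>)"
        by (rule ext_integral_eq_lebesgue_integral)
      also have "(\<integral>x. f x \<partial>\<eta>) = (\<Sum>j\<in>I. m j * f (bary j))"
        unfolding \<eta>_def using integral_bary_cell(2)[of f] by (subst integral_distr) auto
      also have "\<dots> \<le> (\<Sum>j\<in>I. \<integral>z. \<rho> j z * f z \<partial>\<nu>)" by (intro sum_mono bary_jensen f f_int)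
      also have "\<dots> = (\<integral>z. f z \<partial>\<nu>)" by (rule \<rho>_sum[OF f_int])
      finally show ?thesis by (simp add: ext)
    qed simp
  qed
  then have \<eta>: "\<eta> \<in> P_below \<nu>" using \<eta>1 by (simp add: P_below_def)
  have \<pi>: "\<pi> \<in> couplings \<mu> \<eta>"
    unfolding couplings_def
  proof (intro CollectI conjI)
    show "prob_space \<pi>" unfolding \<pi>_def by (rule \<mu>.prob_space_distr) measurable
    show "distr \<pi> borel fst = \<mu>"
      unfolding \<pi>_def by (subst distr_distr) (auto simp: o_def intro!: distr_id2 sets_\<mu>[symmetric])
    show "distr \<pi> borel snd = \<eta>"
      unfolding \<pi>_def \<eta>_def by (subst distr_distr) (auto simp: o_def)
  qed (simp add: \<pi>_def)
  have "T_backward (\<lambda>x y. h (x - y)) \<mu> \<nu> \<le> ext_integral \<pi> (\<lambda>(x, y). ereal (h (x - y)))"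
    unfolding T_backward_def T_def
    by (rule INF_lower2[OF \<eta>]) (rule INF_lower[OF \<pi>])
  also have "\<dots> = ext_integral \<pi> (\<lambda>z. ereal (h (fst z - snd z)))" by (simp add: case_prod_unfold)
  also have "\<dots> = ereal (\<integral>z. h (fst z - snd z) \<partial>\<pi>)"
    unfolding \<pi>_def using int
    by (intro ext_integral_eq_lebesgue_integral) (subst integrable_distr_eq, auto)
  also have "(\<integral>z. h (fst z - snd z) \<partial>\<pi>) = (\<integral>x. h (x - bary (cell x)) \<partial>\<mu>)"
    unfolding \<pi>_def by (subst integral_distr) auto
  finally show ?thesis .
qed

section \<open>The plan with given labels and the forward competitor\<close>

definition kern :: "'a \<Rightarrow> 'a \<Rightarrow> real" where
  "kern x z = (\<Sum>j\<in>I. indicat_real {x. cell x = j} x * \<rho> j z / m j)"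

lemma kern_measurable [measurable]: "case_prod kern \<in> borel_measurable (borel \<Otimes>\<^sub>M borel)"
  unfolding kern_def case_prod_unfold by measurable

lemma kern_nonneg: "0 \<le> kern x z"
  unfolding kern_def using partitions_of_unityD(2)[OF \<rho>] m_pos
  by (intro sum_nonneg divide_nonneg_pos mult_nonneg_nonneg) auto

lemma kern_eq: "cell x \<in> I \<Longrightarrow> kern x z = \<rho> (cell x) z / m (cell x)"
proof -
  assume x: "cell x \<in> I"
  have "kern x z = (\<Sum>j\<in>I. if j = cell x then \<rho> j z / m j else 0)"
    unfolding kern_def by (intro sum.cong) (auto simp: indicator_def)
  then show ?thesis using x I by simp
qed

lemma kern_integrable:
  fixes f :: "'a \<Rightarrow> 'b::{banach, second_countable_topology}"
  assumes "cell x \<in> I" "integrable \<nu> f"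
  shows "integrable \<nu> (\<lambda>z. kern x z *\<^sub>R f z)"
proof -
  have "(\<lambda>z. kern x z *\<^sub>R f z) = (\<lambda>z. (1 / m (cell x)) *\<^sub>R (\<rho> (cell x) z *\<^sub>R f z))"
    by (simp add: kern_eq[OF assms(1)])
  then show ?thesis using \<rho>_integrable[OF assms] by (simp del: scaleR_scaleR)
qed

lemma kern_integral: "cell x \<in> I \<Longrightarrow> (\<integral>z. kern x z \<partial>\<nu>) = 1"
  using \<rho>_mass[of "cell x"] m_pos[of "cell x"] by (simp add: kern_eq)

lemma kern_bary:
  assumes x: "cell x \<in> I"
  shows "(\<integral>z. kern x z *\<^sub>R z \<partial>\<nu>) = bary (cell x)"
proof -
  have "(\<lambda>z. kern x z *\<^sub>R z) = (\<lambda>z. (1 / m (cell x)) *\<^sub>R (\<rho> (cell x) z *\<^sub>R z))"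
    by (simp add: kern_eq[OF x])
  then show ?thesis using x by (simp add: bary_def inverse_eq_divide del: scaleR_scaleR)
qed

text \<open>\<open>X\<close> and \<open>Z\<close> are made independent given the label: the density
  with respect to the product measure is \<open>\<rho> (cell x) z / m (cell x)\<close>, which
  \<open>kern\<close> writes as a finite sum over labels.\<close>

definition plan :: "('a \<times> 'a) measure" where
  "plan = density (\<mu> \<Otimes>\<^sub>M \<nu>) (\<lambda>(x, z). ennreal (kern x z))"

lemma sets_plan [measurable_cong]: "sets plan = sets (borel \<Otimes>\<^sub>M borel)"
  unfolding plan_def sets_density by (rule sets_pair_measure_cong[OF sets_\<mu> sets_\<nu>])

lemma plan_marginals: "distr plan \<mu> fst = \<mu>" "distr plan \<nu> snd = \<nu>"
proof -
  have "case_prod (\<lambda>x z. ennreal (kern x z)) = (\<lambda>v. ennreal (case_prod kern v))" by auto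
  then have k: "case_prod (\<lambda>x z. ennreal (kern x z)) \<in> borel_measurable (\<mu> \<Otimes>\<^sub>M \<nu>)" by simp
  have 1: "AE x in \<mu>. (\<integral>\<^sup>+ z. ennreal (kern x z) \<partial>\<nu>) = 1"
    using cell_AE
  proof eventually_elim
    case (elim x)
    have "(\<integral>\<^sup>+ z. ennreal (kern x z) \<partial>\<nu>) = ennreal (\<integral>z. kern x z \<partial>\<nu>)"
      using kern_integrable[OF elim, of "\<lambda>_. 1 :: real"] kern_nonneg
      by (intro nn_integral_eq_integral) auto
    then show ?case by (simp add: kern_integral[OF elim])
  qed
  \<comment> \<open>Integrating over \<open>x\<close> replaces each indicator by \<open>m j\<close>,
    which cancels the denominator and leaves the partition of unity.\<close>
  have 2: "(\<integral>\<^sup>+ x. ennreal (kern x z) \<partial>\<mu>) = 1" for z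
  proof -
    have ind: "integrable \<mu> (indicat_real {x. cell x = j})" for j
      by (rule \<mu>.integrable_const_bound[where B = 1]) auto
    then have int: "integrable \<mu> (\<lambda>x. indicat_real {x. cell x = j} x * \<rho> j z / m j)" for j
      by simp
    have "(\<integral>\<^sup>+ x. ennreal (kern x z) \<partial>\<mu>) = ennreal (\<integral>x. kern x z \<partial>\<mu>)"
      using kern_nonneg int unfolding kern_def
      by (intro nn_integral_eq_integral Bochner_Integration.integrable_sum) auto
    also have "(\<integral>x. kern x z \<partial>\<mu>) = (\<Sum>j\<in>I. \<rho> j z)"
      unfolding kern_def using int
    proof (subst Bochner_Integration.integral_sum, simp, intro sum.cong refl)
      fix j assume j: "j \<in> I"
      have "(\<integral>x. indicat_real {x. cell x = j} x * \<rho> j z / m j \<partial>\<mu>) = m j * \<rho> j z / m j"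
        using ind[of j] cell_integral[OF j] by simp
      then show "(\<integral>x. indicat_real {x. cell x = j} x * \<rho> j z / m j \<partial>\<mu>) = \<rho> j z"
        using m_pos[OF j] by simp
    qed
    finally show ?thesis by (simp add: partitions_of_unityD(3)[OF \<rho>])
  qed
  show "distr plan \<mu> fst = \<mu>" "distr plan \<nu> snd = \<nu>"
    unfolding plan_def
    using distr_density_pair[OF PD(1)[OF \<mu>] PD(1)[OF \<nu>] k 1] 2 by auto
qed

lemma prob_space_plan: "prob_space plan"
proof -
  have "prob_space (distr plan \<mu> fst)" unfolding plan_marginals by (rule PD[OF \<mu>])
  then show ?thesis by (rule prob_space_distrD[rotated]) measurable
qed

lemma plan_fst:
  fixes f :: "'a \<Rightarrow> 'b::{banach, second_countable_topology}"
  assumes f: "integrable \<mu> f"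
  shows "integrable plan (\<lambda>v. f (fst v))" "(\<integral>v. f (fst v) \<partial>plan) = (\<integral>x. f x \<partial>\<mu>)"
proof -
  have m: "fst \<in> measurable plan \<mu>" by measurable
  have f': "f \<in> borel_measurable \<mu>" using f by simp
  show "integrable plan (\<lambda>v. f (fst v))" "(\<integral>v. f (fst v) \<partial>plan) = (\<integral>x. f x \<partial>\<mu>)"
    using integrable_distr_eq[OF m f'] integral_distr[OF m f'] f by (simp_all add: plan_marginals)
qed

lemma plan_snd:
  fixes f :: "'a \<Rightarrow> 'b::{banach, second_countable_topology}"
  assumes f: "integrable \<nu> f"
  shows "integrable plan (\<lambda>v. f (snd v))"
proof -
  have m: "snd \<in> measurable plan \<nu>" by measurable
  have f': "f \<in> borel_measurable \<nu>" using f by simp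
  show ?thesis using integrable_distr_eq[OF m f'] f by (simp add: plan_marginals)
qed

definition shift :: "'a \<times> 'a \<Rightarrow> 'a" where
  "shift = (\<lambda>(x, z). x + z - bary (cell x))"

lemma shift_measurable [measurable]: "shift \<in> borel_measurable (borel \<Otimes>\<^sub>M borel)"
  unfolding shift_def case_prod_unfold by measurable

text \<open>Given \<open>X = x\<close>, the mean of \<open>x + Z - bary (cell x)\<close> is
  \<open>x\<close>, so Jensen applies under the conditional law with density
  \<open>kern x\<close>.\<close>

lemma convex_order_shift:
  assumes \<xi>: "distr plan borel shift \<in> P 1"
  shows "\<mu> \<le>\<^sub>c\<^sub>x distr plan borel shift"
  unfolding convex_order_def
proof
  fix f :: "'a \<Rightarrow> real" assume "f \<in> convex_funs"
  then have f: "convex_on UNIV f" by (simp add: convex_funs_def)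
  note f_measurable [measurable] = convex_on_UNIV_measurable[OF f]
  let ?\<xi> = "distr plan borel shift"
  obtain l where l: "integrable ?\<xi> l" "\<And>x. l x \<le> f x"
    using convex_minorant_integrable[OF f PD(1)[OF \<xi>]] P_integrable_id[OF \<xi>] by auto
  have f\<xi>: "f \<in> borel_measurable ?\<xi>" by measurable
  from f\<xi> l show "ext_integral \<mu> (\<lambda>x. ereal (f x)) \<le> ext_integral ?\<xi> (\<lambda>x. ereal (f x))"
  proof (rule ext_integral_real_bounded_below)
    assume f_int: "integrable ?\<xi> f" and ext: "ext_integral ?\<xi> (\<lambda>x. ereal (f x)) = ereal (\<integral>x. f x \<partial>?\<xi>)"
    have sm: "shift \<in> measurable plan borel" by measurable
    have plan: "plan = density (\<mu> \<Otimes>\<^sub>M \<nu>) (\<lambda>v. ennreal (case_prod kern v))"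
      by (simp add: plan_def case_prod_unfold)
    have fs: "(\<lambda>v. f (shift v)) \<in> borel_measurable (\<mu> \<Otimes>\<^sub>M \<nu>)" by measurable
    have km: "case_prod kern \<in> borel_measurable (\<mu> \<Otimes>\<^sub>M \<nu>)" by measurable
    have kn: "AE v in \<mu> \<Otimes>\<^sub>M \<nu>. 0 \<le> case_prod kern v" by (auto simp: kern_nonneg)
    have "integrable plan (\<lambda>v. f (shift v))"
      using f_int by (simp add: integrable_distr_eq[OF sm f_measurable])
    then have int: "integrable (\<mu> \<Otimes>\<^sub>M \<nu>) (\<lambda>v. case_prod kern v *\<^sub>R f (shift v))"
      unfolding plan by (simp only: integrable_density[OF fs km kn])
    have "(\<integral>x. f x \<partial>?\<xi>) = (\<integral>v. case_prod kern v *\<^sub>R f (shift v) \<partial>(\<mu> \<Otimes>\<^sub>M \<nu>))"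
      unfolding integral_distr[OF sm f_measurable] unfolding plan by (rule integral_density[OF fs km kn])
    also have "\<dots> = (\<integral>x. (\<integral>z. kern x z * f (x + z - bary (cell x)) \<partial>\<nu>) \<partial>\<mu>)"
      unfolding integral_fst'[OF int, symmetric] by (simp add: shift_def)
    finally have eq: "(\<integral>x. f x \<partial>?\<xi>) = (\<integral>x. (\<integral>z. kern x z * f (x + z - bary (cell x)) \<partial>\<nu>) \<partial>\<mu>)" .
    have int_u: "integrable \<mu> (\<lambda>x. (\<integral>z. kern x z * f (x + z - bary (cell x)) \<partial>\<nu>))"
      using integrable_fst'[OF int] by (simp add: shift_def)
    have le: "AE x in \<mu>. f x \<le> (\<integral>z. kern x z * f (x + z - bary (cell x)) \<partial>\<nu>)"
      using cell_AE AE_integrable_fst'[OF int]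
    proof eventually_elim
      case (elim x)
      have k1: "integrable \<nu> (\<lambda>z. kern x z)"
        using kern_integrable[OF elim(1), of "\<lambda>_. 1 :: real"] by simp
      have kz: "integrable \<nu> (\<lambda>z. kern x z *\<^sub>R z)"
        using kern_integrable[OF elim(1) P_integrable_id[OF \<nu>]] by simp
      have split: "kern x z *\<^sub>R (x + z - bary (cell x)) = kern x z *\<^sub>R (x - bary (cell x)) + kern x z *\<^sub>R z" for z
        by (simp add: algebra_simps)
      have "(\<integral>z. kern x z *\<^sub>R (x + z - bary (cell x)) \<partial>\<nu>) = x"
        unfolding split using k1 kz
        by (simp add: kern_integral[OF elim(1)] kern_bary[OF elim(1)])
      moreover have "1 * f ((\<integral>z. kern x z *\<^sub>R (x + z - bary (cell x)) \<partial>\<nu>) /\<^sub>R 1) \<le>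
          (\<integral>z. kern x z * f (x + z - bary (cell x)) \<partial>\<nu>)"
        using elim(2) k1 kz
        by (intro weighted_jensen f kern_nonneg kern_integral[OF elim(1)])
           (simp_all add: shift_def split)
      ultimately show ?case by simp
    qed
    \<comment> \<open>Integrability of \<open>f\<close> under \<open>\<mu>\<close> has to be
      derived: an affine minorant bounds it below, the conditional integral above.\<close>
    obtain l' where l': "integrable \<mu> l'" "\<And>x. l' x \<le> f x"
      using convex_minorant_integrable[OF f PD(1)[OF \<mu>]] P_integrable_id[OF \<mu>] by auto
    have f\<mu>: "integrable \<mu> f"
      by (rule integrable_squeeze[OF _ l'(1) int_u _ le]) (use l'(2) in auto)
    have "(\<integral>x. f x \<partial>\<mu>) \<le> (\<integral>x. f x \<partial>?\<xi>)"
      unfolding eq by (rule integral_mono_AE[OF f\<mu> int_u le])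
    then show ?thesis by (simp add: ext ext_integral_eq_lebesgue_integral[OF f\<mu>])
  qed simp
qed

lemma T_forward_le:
  fixes h :: "'a \<Rightarrow> real"
  assumes [measurable]: "h \<in> borel_measurable borel"
    and int: "integrable \<mu> (\<lambda>x. h (x - bary (cell x)))"
  shows "T_forward (\<lambda>x y. h (x - y)) \<mu> \<nu> \<le> ereal (\<integral>x. h (x - bary (cell x)) \<partial>\<mu>)"
proof -
  interpret plan: prob_space plan by (rule prob_space_plan)
  define \<xi> where "\<xi> = distr plan borel shift"
  define \<pi> where "\<pi> = distr plan (borel \<Otimes>\<^sub>M borel) (\<lambda>v. (shift v, snd v))"
  have int_bary: "integrable \<mu> (\<lambda>x. norm (bary (cell x)))"
    by (rule integral_bary_cell(1)) measurable
  have "integrable plan (\<lambda>v. norm (shift v))"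
  proof (rule Bochner_Integration.integrable_bound)
    show "integrable plan (\<lambda>v. norm (fst v) + norm (snd v) + norm (bary (cell (fst v))))"
      using plan_fst(1)[OF int_bary] plan_fst(1)[OF integrable_norm[OF P_integrable_id[OF \<mu>]]]
        plan_snd[OF integrable_norm[OF P_integrable_id[OF \<nu>]]] by simp
    show "AE v in plan. norm (norm (shift v)) \<le>
        norm (norm (fst v) + norm (snd v) + norm (bary (cell (fst v))))"
    proof (intro AE_I2)
      fix v
      have "norm (shift v) \<le> norm (fst v + snd v) + norm (bary (cell (fst v)))"
        unfolding shift_def case_prod_unfold by (rule norm_triangle_ineq4)
      also have "\<dots> \<le> norm (fst v) + norm (snd v) + norm (bary (cell (fst v)))"
        by (intro add_right_mono norm_triangle_ineq)
      finally show "norm (norm (shift v)) \<le> norm (norm (fst v) + norm (snd v) + norm (bary (cell (fst v))))"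
        by simp
    qed
  qed measurable
  then have "integrable \<xi> (\<lambda>x. norm x ^ 1)"
    unfolding \<xi>_def by (subst integrable_distr_eq) auto
  moreover have "prob_space \<xi>" unfolding \<xi>_def by (rule plan.prob_space_distr) measurable
  ultimately have \<xi>1: "\<xi> \<in> P 1" by (simp add: P_def \<xi>_def)
  then have \<xi>: "\<xi> \<in> P_above \<mu>" using convex_order_shift by (simp add: P_above_def \<xi>_def)
  have \<pi>: "\<pi> \<in> couplings \<xi> \<nu>"
    unfolding couplings_def
  proof (intro CollectI conjI)
    show "prob_space \<pi>" unfolding \<pi>_def by (rule plan.prob_space_distr) measurable
    show "distr \<pi> borel fst = \<xi>"
      unfolding \<pi>_def \<xi>_def by (subst distr_distr) (auto simp: o_def)
    have "distr \<pi> borel snd = distr plan borel snd"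
      unfolding \<pi>_def by (subst distr_distr) (auto simp: o_def)
    also have "\<dots> = distr plan \<nu> snd" by (rule distr_cong) (simp_all add: sets_\<nu>)
    finally show "distr \<pi> borel snd = \<nu>" by (simp add: plan_marginals)
  qed (simp add: \<pi>_def)
  have disp: "shift v - snd v = fst v - bary (cell (fst v))" for v
    by (simp add: shift_def case_prod_unfold)
  have "T_forward (\<lambda>x y. h (x - y)) \<mu> \<nu> \<le> ext_integral \<pi> (\<lambda>(x, y). ereal (h (x - y)))"
    unfolding T_forward_def T_def
    by (rule INF_lower2[OF \<xi>]) (rule INF_lower[OF \<pi>])
  also have "\<dots> = ext_integral \<pi> (\<lambda>z. ereal (h (fst z - snd z)))" by (simp add: case_prod_unfold)
  also have "\<dots> = ereal (\<integral>z. h (fst z - snd z) \<partial>\<pi>)"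
    unfolding \<pi>_def using plan_fst(1)[OF int]
    by (intro ext_integral_eq_lebesgue_integral) (subst integrable_distr_eq, auto simp: disp)
  also have "(\<integral>z. h (fst z - snd z) \<partial>\<pi>) = (\<integral>x. h (x - bary (cell x)) \<partial>\<mu>)"
    unfolding \<pi>_def using plan_fst(2)[OF int] by (subst integral_distr) (auto simp: disp)
  finally show ?thesis .
qed

end

section \<open>Discretisation error\<close>

text \<open>In the induction step the gap between the two sides contains
  \<open>u * v * ((a - b) * (a ^ n - b ^ n))\<close>, nonnegative because the two differences have
  the same sign.\<close>

lemma convex_power_combination:
  fixes a b u v :: real
  assumes "0 \<le> a" "0 \<le> b" "0 \<le> u" "0 \<le> v" "u + v = 1"
  shows "(u * a + v * b) ^ n \<le> u * a ^ n + v * b ^ n"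
proof (induction n)
  case (Suc n)
  have "(u * a + v * b) ^ Suc n \<le> (u * a + v * b) * (u * a ^ n + v * b ^ n)"
    using assms Suc by (auto intro!: mult_left_mono)
  also have "\<dots> = u * (u + v) * a ^ Suc n + v * (u + v) * b ^ Suc n - u * v * ((a - b) * (a ^ n - b ^ n))"
    by (simp add: algebra_simps)
  also have "0 \<le> (a - b) * (a ^ n - b ^ n)"
    using assms power_mono[of a b n] power_mono[of b a n]
    by (cases "a \<le> b") (auto intro: mult_nonneg_nonneg mult_nonpos_nonpos)
  then have "u * (u + v) * a ^ Suc n + v * (u + v) * b ^ Suc n - u * v * ((a - b) * (a ^ n - b ^ n)) \<le>
      u * a ^ Suc n + v * b ^ Suc n"
    using assms by simp
  finally show ?case .
qed (use assms in simp)

lemma convex_on_norm_power: "convex_on UNIV (\<lambda>x :: 'a::real_normed_vector. norm x ^ n)"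
  unfolding convex_on_def
proof (intro conjI ballI allI impI convex_UNIV)
  fix x y :: 'a and u v :: real
  assume uv: "0 \<le> u" "0 \<le> v" "u + v = 1"
  have "norm (u *\<^sub>R x + v *\<^sub>R y) \<le> u * norm x + v * norm y"
    using norm_triangle_ineq[of "u *\<^sub>R x" "v *\<^sub>R y"] uv by simp
  then have "norm (u *\<^sub>R x + v *\<^sub>R y) ^ n \<le> (u * norm x + v * norm y) ^ n" by (intro power_mono) auto
  also have "\<dots> \<le> u * norm x ^ n + v * norm y ^ n"
    using uv by (intro convex_power_combination) auto
  finally show "norm (u *\<^sub>R x + v *\<^sub>R y) ^ n \<le> u * norm x ^ n + v * norm y ^ n" .
qed

lemma tail_integral_small:
  fixes f :: "'a::euclidean_space \<Rightarrow> real"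
  assumes M: "sets M = sets borel" and f: "integrable M f" and "0 < \<epsilon>"
  obtains R where "0 < R" "(\<integral>x. indicat_real {x. R < norm x} x * f x \<partial>M) < \<epsilon>"
proof -
  note [measurable_cong] = M
  have [measurable]: "f \<in> borel_measurable M" using f by simp
  have "(\<lambda>n. \<integral>x. indicat_real {x. real n < norm x} x * f x \<partial>M) \<longlonglongrightarrow> (\<integral>x. 0 \<partial>M)"
  proof (rule integral_dominated_convergence[where w = "\<lambda>x. norm (f x)"])
    show "AE x in M. (\<lambda>n. indicat_real {x. real n < norm x} x * f x) \<longlonglongrightarrow> 0"
    proof (rule AE_I2)
      fix x :: 'a
      obtain k :: nat where "norm x < real k" using reals_Archimedean2 by blast
      then have "\<forall>\<^sub>F n in sequentially. indicat_real {x. real n < norm x} x * f x = 0"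
        by (intro eventually_sequentiallyI[of k]) (auto simp: indicator_def)
      then show "(\<lambda>n. indicat_real {x. real n < norm x} x * f x) \<longlonglongrightarrow> 0" by (rule tendsto_eventually)
    qed
  qed (use f in \<open>auto simp: indicator_def\<close>)
  then have "\<forall>\<^sub>F n in sequentially. (\<integral>x. indicat_real {x. real n < norm x} x * f x \<partial>M) < \<epsilon>"
    using \<open>0 < \<epsilon>\<close> by (intro order_tendstoD) auto
  then obtain n where n: "\<forall>k\<ge>n. (\<integral>x. indicat_real {x. real k < norm x} x * f x \<partial>M) < \<epsilon>"
    by (auto simp: eventually_sequentially)
  \<comment> \<open>The successor makes the radius positive even for \<open>n = 0\<close>.\<close>
  show ?thesis by (rule that[of "real (Suc n)"]) (use n[rule_format, of "Suc n"] in \<open>simp_all del: of_nat_Suc\<close>)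
qed

text \<open>Label \<open>N\<close> is the unbounded outer cell. The others come from a finite cover
  of the ball by balls of radius \<open>\<delta> / 2\<close>, made disjoint by taking the first one
  that contains the point.\<close>

lemma cell_partition:
  assumes "0 < \<delta>"
  obtains N and cell :: "'a::euclidean_space \<Rightarrow> nat" where "cell \<in> measurable borel (count_space UNIV)"
    "\<And>x. cell x \<le> N" "\<And>x. cell x = N \<longleftrightarrow> R < norm x"
    "\<And>x x'. cell x = cell x' \<Longrightarrow> cell x \<noteq> N \<Longrightarrow> norm (x - x') \<le> \<delta>"
proof -
  have "compact (cball (0::'a) R)" by simp
  then have "\<forall>e>0. \<exists>k. finite k \<and> cball (0::'a) R \<subseteq> (\<Union>x\<in>k. ball x e)"
    unfolding compact_eq_totally_bounded by (rule conjunct2)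
  then obtain k where k: "finite k" "cball 0 R \<subseteq> (\<Union>x\<in>k. ball (x::'a) (\<delta> / 2))"
    using half_gt_zero[OF assms] by meson
  obtain f :: "nat \<Rightarrow> 'a" and N :: nat where f: "k = f ` {i. i < N}"
    using finite_imp_nat_seg_image_inj_on[OF k(1)] by blast
  define cell where "cell x = (if R < norm x then N else (LEAST i. x \<in> ball (f i) (\<delta> / 2)))" for x
  have inner: "cell x < N \<and> x \<in> ball (f (cell x)) (\<delta> / 2)" if "\<not> R < norm x" for x
  proof -
    have "x \<in> cball 0 R" using that by simp
    then obtain a where "a \<in> k" "x \<in> ball a (\<delta> / 2)" using k(2) by blast
    then obtain i where i: "i < N" "x \<in> ball (f i) (\<delta> / 2)" using f by blast
    have c: "cell x = (LEAST i. x \<in> ball (f i) (\<delta> / 2))" using that by (simp add: cell_def)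
    show ?thesis
      unfolding c using i(1) Least_le[of "\<lambda>i. x \<in> ball (f i) (\<delta> / 2)", OF i(2)]
        LeastI[of "\<lambda>i. x \<in> ball (f i) (\<delta> / 2)", OF i(2)] by (blast intro: le_less_trans)
  qed
  show ?thesis
  proof (rule that)
    have [measurable]: "Measurable.pred borel (\<lambda>x. x \<in> ball (f i) (\<delta> / 2))" for i
      unfolding mem_ball by measurable
    show "cell \<in> measurable borel (count_space UNIV)"
      unfolding cell_def by measurable
    show "cell x \<le> N" for x using inner[of x] by (cases "R < norm x") (auto simp: cell_def)
    show out: "cell x = N \<longleftrightarrow> R < norm x" for x using inner[of x] by (auto simp: cell_def)
    fix x x' assume eq: "cell x = cell x'" and ne: "cell x \<noteq> N"
    have "dist (f (cell x)) x < \<delta> / 2" "dist (f (cell x)) x' < \<delta> / 2"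
      using inner[of x] inner[of x'] out[of x] out[of x'] eq ne by auto
    then show "norm (x - x') \<le> \<delta>"
      using dist_triangle_half_r[of "f (cell x)" x \<delta> x'] by (simp add: dist_norm)
  qed
qed

context transport_cost
begin

lemma C_nonneg: "0 \<le> C"
proof -
  have "0 \<le> C * (1 + norm (0::'a) ^ p)" using h_nonneg[of 0] h_growth[of 0] by linarith
  then show ?thesis using p_ge_1 by (simp add: power_0_left)
qed

text \<open>If \<open>norm z \<le> norm x + norm y + 1\<close>, then \<open>norm z\<close> is at
  most three times the largest of 1, \<open>norm x\<close> and \<open>norm y\<close>; this is the
  source of \<open>3 ^ p\<close>. The extra unit in that condition is the one in
  \<open>convex_nonneg_diff_le\<close>.\<close>

definition growth_const :: real where "growth_const = C * (1 + 3 ^ p)"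

lemma growth_const_nonneg: "0 \<le> growth_const" unfolding growth_const_def using C_nonneg by simp

lemma h_bound:
  assumes z: "norm z \<le> norm x + norm y + 1"
  shows "h z \<le> growth_const * (1 + norm x ^ p + norm y ^ p)"
proof -
  define t where "t = max 1 (max (norm x) (norm y))"
  have "norm z ^ p \<le> (3 * t) ^ p" using z by (intro power_mono) (auto simp: t_def)
  also have "\<dots> = 3 ^ p * t ^ p" by (rule power_mult_distrib)
  also have "t ^ p \<le> 1 + norm x ^ p + norm y ^ p"
    by (auto simp: t_def max_def add_increasing add_increasing2)
  finally have 1: "norm z ^ p \<le> 3 ^ p * (1 + norm x ^ p + norm y ^ p)" by simp
  have 2: "1 \<le> 1 + norm x ^ p + norm y ^ p" by simp
  have "h z \<le> C * (1 + norm z ^ p)" by (rule h_growth)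
  also have "\<dots> \<le> C * ((1 + norm x ^ p + norm y ^ p) + 3 ^ p * (1 + norm x ^ p + norm y ^ p))"
    by (intro mult_left_mono add_mono 1 2 C_nonneg)
  also have "\<dots> = growth_const * (1 + norm x ^ p + norm y ^ p)" by (simp add: growth_const_def algebra_simps)
  finally show ?thesis .
qed

text \<open>In an inner cell, replacing \<open>x\<close> by \<open>xs j\<close> moves the
  displacement by at most \<open>\<delta>\<close> and raises \<open>h\<close> by at most
  \<open>\<delta>\<close> times a bound of growth \<open>p\<close>. In the outer cell
  \<open>h\<close> is bounded outright by the moments there: \<open>\<tau>\<close> from
  \<open>\<mu>\<close> and \<open>2 * \<tau>\<close> from \<open>\<nu>\<close>, hence
  \<open>3 * \<tau>\<close>.\<close>

lemma discretised_cost: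
  assumes disc: "discretisation \<mu> \<nu> I cell m \<rho>" and \<mu>p: "\<mu> \<in> P p" and \<nu>p: "\<nu> \<in> P p"
    and near: "\<And>j x. j \<in> I \<Longrightarrow> j \<noteq> N \<Longrightarrow> cell x = j \<Longrightarrow> norm (x - xs j) \<le> \<delta>" and "0 \<le> \<delta>"
    and tail\<mu>: "(\<integral>x. indicat_real {x. cell x = N} x * (1 + norm x ^ p) \<partial>\<mu>) \<le> \<tau>"
    and tail\<nu>: "N \<in> I \<Longrightarrow> (\<integral>z. \<rho> N z * norm z ^ p \<partial>\<nu>) \<le> 2 * \<tau>"
  defines "y \<equiv> discretisation.bary \<nu> I m \<rho>"
  shows "integrable \<mu> (\<lambda>x. h (x - y (cell x)))"
    "(\<integral>x. h (x - y (cell x)) \<partial>\<mu>) \<le> (\<Sum>j\<in>I. m j * h (xs j - y j)) +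
      growth_const * (\<delta> * (1 + (\<integral>x. norm x ^ p \<partial>\<mu>) + (\<integral>z. norm z ^ p \<partial>\<nu>)) + 3 * \<tau>)"
proof -
  interpret discretisation \<mu> \<nu> I cell m \<rho> by (rule disc)
  have y [measurable]: "(\<lambda>x. y (cell x)) \<in> borel_measurable borel" unfolding y_def by measurable
  define Y where "Y = (\<Sum>l\<in>I. norm (y l))"
  have Y: "norm (y j) \<le> Y" for j unfolding y_def Y_def by (rule bary_bounded)
  have bound: "h (x - y j) \<le> growth_const * (1 + norm x ^ p + norm (y j) ^ p)" for x j
    by (intro h_bound order_trans[OF norm_triangle_ineq4]) simp
  show int: "integrable \<mu> (\<lambda>x. h (x - y (cell x)))"
  proof (rule P_integrable_bound[OF \<mu>p])
    fix x
    have "h (x - y (cell x)) \<le> growth_const * (1 + norm x ^ p + Y ^ p)"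
      by (rule order_trans[OF bound]) (intro mult_left_mono add_left_mono power_mono Y growth_const_nonneg, simp)
    also have "\<dots> \<le> growth_const * ((1 + Y ^ p) * (1 + norm x ^ p))"
      using order_trans[OF norm_ge_zero Y] by (intro mult_left_mono growth_const_nonneg) (simp add: algebra_simps)
    finally show "norm (h (x - y (cell x))) \<le> (growth_const * (1 + Y ^ p)) * (1 + norm x ^ p)"
      using h_nonneg by (simp add: mult.assoc)
  qed measurable
  define E where "E j f = (\<integral>x. indicat_real {x. cell x = j} x * f x \<partial>\<mu>)" for j and f :: "'a \<Rightarrow> real"
  have E_int: "integrable \<mu> (\<lambda>x. indicat_real {x. cell x = j} x * f x)"
    if "integrable \<mu> f" for j and f :: "'a \<Rightarrow> real"
  proof -
    have "f \<in> borel_measurable \<mu>" using that by simp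
    then have "(\<lambda>x. indicat_real {x. cell x = j} x * f x) \<in> borel_measurable \<mu>" by measurable
    then show ?thesis
      by (rule Bochner_Integration.integrable_bound[OF that]) (auto simp: indicator_def)
  qed
  \<comment> \<open>The share of the p-th moment of \<open>\<nu>\<close> that label \<open>j\<close>
    receives. By Jensen it dominates \<open>m j * norm (y j) ^ p\<close>, so the total error does
    not depend on the number or the masses of the cells.\<close>
  define b where "b j = (\<integral>z. \<rho> j z * norm z ^ p \<partial>\<nu>)" for j
  have yb: "m j * norm (y j) ^ p \<le> b j" if "j \<in> I" for j
    unfolding b_def y_def by (rule bary_jensen[OF convex_on_norm_power PD(3)[OF \<nu>p] that])
  have b_sum: "(\<Sum>j\<in>I. b j) = (\<integral>z. norm z ^ p \<partial>\<nu>)" unfolding b_def by (rule \<rho>_sum[OF PD(3)[OF \<nu>p]])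
  have b_nonneg: "0 \<le> b j" if "j \<in> I" for j
    using yb[OF that] m_pos[OF that] by (smt (verit) mult_nonneg_nonneg norm_ge_zero zero_le_power)
  define e where "e = (\<lambda>x::'a. norm x ^ p)"
  have e_int: "integrable \<mu> e" unfolding e_def by (rule PD(3)[OF \<mu>p])
  have E_nonneg: "0 \<le> E j e" for j unfolding E_def e_def by (intro Bochner_Integration.integral_nonneg) auto
  have \<tau>_nonneg: "0 \<le> \<tau>"
    by (rule order_trans[OF _ tail\<mu>]) (intro Bochner_Integration.integral_nonneg, auto)
  have int_j: "integrable \<mu> (\<lambda>x. h (x - y j))" for j
  proof (rule P_integrable_bound[OF \<mu>p])
    fix x
    have "h (x - y j) \<le> growth_const * ((1 + norm (y j) ^ p) * (1 + norm x ^ p))"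
      by (rule order_trans[OF bound]) (intro mult_left_mono growth_const_nonneg, simp add: algebra_simps)
    then show "norm (h (x - y j)) \<le> (growth_const * (1 + norm (y j) ^ p)) * (1 + norm x ^ p)"
      using h_nonneg by (simp add: mult.assoc)
  qed measurable
  have E_affine: "E j (\<lambda>x. a + k * e x) = m j * a + k * E j e" if "j \<in> I" for j a k
  proof -
    have ind: "integrable \<mu> (indicat_real {x. cell x = j})"
      using E_int[of "\<lambda>_. 1" j] by simp
    have "E j (\<lambda>x. a + k * e x) =
        (\<integral>x. indicat_real {x. cell x = j} x * a + k * (indicat_real {x. cell x = j} x * e x) \<partial>\<mu>)"
      unfolding E_def by (rule Bochner_Integration.integral_cong) (auto simp: algebra_simps)
    also have "\<dots> = m j * a + k * E j e"
      unfolding E_def using E_int[OF e_int, of j] cell_integral[OF that] ind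
      by (subst Bochner_Integration.integral_add) auto
    finally show ?thesis .
  qed
  have E_mono: "E j f \<le> E j g"
    if "integrable \<mu> f" "integrable \<mu> g" "\<And>x. cell x = j \<Longrightarrow> f x \<le> g x" for j f g
    unfolding E_def using that(3) by (intro integral_mono E_int that(1,2)) (auto simp: indicator_def)
  have part: "E j (\<lambda>x. h (x - y j)) \<le>
      m j * h (xs j - y j) + growth_const * (\<delta> * (m j + E j e + b j)) + (if j = N then growth_const * (3 * \<tau>) else 0)"
    if j: "j \<in> I" for j
  proof (cases "j = N")
    case True
    have "E j (\<lambda>x. h (x - y j)) \<le> E j (\<lambda>x. (growth_const * (1 + norm (y j) ^ p)) + growth_const * e x)"
      using e_int bound[of _ j] by (intro E_mono int_j) (auto simp: e_def algebra_simps)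
    also have "\<dots> = growth_const * ((m j * 1 + 1 * E j e) + m j * norm (y j) ^ p)"
      unfolding E_affine[OF j] by (simp add: algebra_simps)
    \<comment> \<open>\<open>E_affine\<close> is read backwards, with both coefficients 1, to return
      to the integral bounded by \<open>tail\<mu>\<close>.\<close>
    also have "m j * 1 + 1 * E j e = E j (\<lambda>x. 1 + 1 * e x)" by (rule E_affine[OF j, symmetric])
    also have "growth_const * (E j (\<lambda>x. 1 + 1 * e x) + m j * norm (y j) ^ p) \<le> growth_const * (\<tau> + 2 * \<tau>)"
      using tail\<mu> order_trans[OF yb[OF j]] tail\<nu> j True growth_const_nonneg
      by (intro mult_left_mono add_mono) (auto simp: E_def e_def b_def)
    finally have "E j (\<lambda>x. h (x - y j)) \<le> growth_const * (3 * \<tau>)" by simp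
    moreover have "0 \<le> m j * h (xs j - y j)" using m_pos[OF j] h_nonneg by simp
    moreover have "0 \<le> growth_const * (\<delta> * (m j + E j e + b j))"
      using growth_const_nonneg \<open>0 \<le> \<delta>\<close> m_pos[OF j] E_nonneg[of j] b_nonneg[OF j] by simp
    ultimately show ?thesis using True by simp
  next
    case False
    have "h (x - y j) \<le> (h (xs j - y j) + \<delta> * growth_const * (1 + norm (y j) ^ p)) + (\<delta> * growth_const) * e x"
      if x: "cell x = j" for x
    proof -
      have bz: "h z \<le> growth_const * (1 + norm x ^ p + norm (y j) ^ p)" if "norm z \<le> norm (x - y j) + 1" for z
        using that norm_triangle_ineq4[of x "y j"] by (intro h_bound) linarith
      have "h (x - y j) \<le> h (xs j - y j) +
          norm ((x - y j) - (xs j - y j)) * (growth_const * (1 + norm x ^ p + norm (y j) ^ p))"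
        by (rule convex_nonneg_diff_le[OF h_convex h_nonneg bz])
      also have "norm ((x - y j) - (xs j - y j)) * (growth_const * (1 + norm x ^ p + norm (y j) ^ p)) \<le>
          \<delta> * (growth_const * (1 + norm x ^ p + norm (y j) ^ p))"
        using near[OF j False x] growth_const_nonneg by (intro mult_right_mono) auto
      finally show ?thesis by (simp add: e_def algebra_simps)
    qed
    then have "E j (\<lambda>x. h (x - y j)) \<le>
        E j (\<lambda>x. (h (xs j - y j) + \<delta> * growth_const * (1 + norm (y j) ^ p)) + (\<delta> * growth_const) * e x)"
      using e_int by (intro E_mono int_j) auto
    also have "\<dots> = m j * h (xs j - y j) + growth_const * (\<delta> * (m j + E j e + m j * norm (y j) ^ p))"
      unfolding E_affine[OF j] by (simp add: algebra_simps)
    also have "\<dots> \<le> m j * h (xs j - y j) + growth_const * (\<delta> * (m j + E j e + b j))"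
      using yb[OF j] growth_const_nonneg \<open>0 \<le> \<delta>\<close> by (intro add_left_mono mult_left_mono) auto
    finally show ?thesis using False by simp
  qed
  have m_sum: "(\<Sum>j\<in>I. m j) = 1"
    using cell_sum[of "\<lambda>_. 1"] cell_integral by (simp add: \<mu>.prob_space)
  have "(\<integral>x. h (x - y (cell x)) \<partial>\<mu>) = (\<Sum>j\<in>I. E j (\<lambda>x. h (x - y (cell x))))"
    unfolding E_def by (rule cell_sum[OF int])
  also have "\<dots> = (\<Sum>j\<in>I. E j (\<lambda>x. h (x - y j)))"
    unfolding E_def
    by (intro sum.cong refl Bochner_Integration.integral_cong) (auto simp: indicator_def)
  also have "\<dots> \<le> (\<Sum>j\<in>I. m j * h (xs j - y j) + growth_const * (\<delta> * (m j + E j e + b j)) +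
      (if j = N then growth_const * (3 * \<tau>) else 0))"
    by (intro sum_mono part)
  also have "\<dots> = (\<Sum>j\<in>I. m j * h (xs j - y j)) +
      growth_const * (\<delta> * ((\<Sum>j\<in>I. m j) + (\<Sum>j\<in>I. E j e) + (\<Sum>j\<in>I. b j))) + (if N \<in> I then growth_const * (3 * \<tau>) else 0)"
    using I by (simp add: sum.distrib sum_distrib_left distrib_left)
  also have "\<dots> \<le> (\<Sum>j\<in>I. m j * h (xs j - y j)) +
      growth_const * (\<delta> * (1 + (\<integral>x. norm x ^ p \<partial>\<mu>) + (\<integral>z. norm z ^ p \<partial>\<nu>))) + growth_const * (3 * \<tau>)"
    using growth_const_nonneg \<tau>_nonneg cell_sum[OF e_int] by (simp add: m_sum b_sum E_def e_def)
  finally show "(\<integral>x. h (x - y (cell x)) \<partial>\<mu>) \<le> (\<Sum>j\<in>I. m j * h (xs j - y j)) +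
      growth_const * (\<delta> * (1 + (\<integral>x. norm x ^ p \<partial>\<mu>) + (\<integral>z. norm z ^ p \<partial>\<nu>)) + 3 * \<tau>)"
    by (simp add: distrib_left)
qed

lemma J_backward_real:
  assumes "\<mu> \<in> P p" "q \<in> C_b p" "Q c (ereal \<circ> \<phi>) = ereal \<circ> q" "integrable \<nu> \<phi>"
  shows "J_backward c \<mu> \<nu> (ereal \<circ> \<phi>) = ereal ((\<integral>x. q x \<partial>\<mu>) - (\<integral>y. \<phi> y \<partial>\<nu>))"
  using ext_integral_eq_lebesgue_integral[OF C_b_integrable[OF assms(1,2)]]
    ext_integral_eq_lebesgue_integral[OF assms(4)]
  unfolding J_backward_def assms(3) by (simp add: comp_def)

text \<open>In the application \<open>xs j\<close> is the barycentre of a cell, so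
  \<open>jensen\<close> holds and convexity of the transform carries the discrete dual value over to
  \<open>\<mu>\<close>. The second \<open>\<epsilon>\<close> pays for the infimum in the transform,
  which need not be attained.\<close>

lemma discretised_dual:
  assumes I: "finite I" and m_pos: "\<And>j. j \<in> I \<Longrightarrow> 0 < m j" and m_sum: "(\<Sum>j\<in>I. m j) = (1::real)"
    and \<mu>: "\<mu> \<in> P p" and \<nu>: "\<nu> \<in> P p" and "0 \<le> A" "0 < \<epsilon>"
    and dual: "\<And>w. A \<le> (\<Sum>j\<in>I. m j * (s j \<bullet> w j + r j + h (xs j - w j))) -
       (\<integral>z. Max ((\<lambda>j. s j \<bullet> z + r j) ` I) \<partial>\<nu>) + \<epsilon>"
    and jensen: "\<And>f. convex_on UNIV f \<Longrightarrow> integrable \<mu> f \<Longrightarrow> (\<Sum>j\<in>I. m j * f (xs j)) \<le> (\<integral>x. f x \<partial>\<mu>)"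
  shows "ereal A \<le> D_backward p c \<mu> \<nu> + ereal (2 * \<epsilon>)"
proof -
  have I_ne: "I \<noteq> {}" using m_sum by auto
  define \<phi> where "\<phi> z = Max ((\<lambda>j. s j \<bullet> z + r j) ` I)" for z
  have \<phi>_ge: "s j \<bullet> z + r j \<le> \<phi> z" if "j \<in> I" for j z
    unfolding \<phi>_def using that I by (intro Max_ge) auto
  have \<phi>: "convex_on UNIV \<phi>"
    unfolding \<phi>_def
  proof (intro convex_on_Max I I_ne)
    fix j
    have "u * (s j \<bullet> x) + v * (s j \<bullet> y) + r j = u * (s j \<bullet> x + r j) + v * (s j \<bullet> y + r j)"
      if "u + v = 1" for u v x y
    proof -
      have "r j = (u + v) * r j" using that by simp
      then show ?thesis by (simp add: algebra_simps)
    qed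
    then show "convex_on UNIV (\<lambda>z. s j \<bullet> z + r j)"
      by (auto simp: convex_on_def inner_add_right)
  qed
  have "\<phi> z \<le> (\<Sum>j\<in>I. 2 * norm (s j) + \<bar>r j\<bar>) * (1 + norm z ^ p)" for z
  proof -
    have "\<phi> z \<in> (\<lambda>j. s j \<bullet> z + r j) ` I" unfolding \<phi>_def using I I_ne by (intro Max_in) auto
    then obtain j where j: "j \<in> I" "\<phi> z = s j \<bullet> z + r j" by blast
    have one: "1 \<le> 1 + norm z ^ p" by simp
    have "s j \<bullet> z \<le> norm (s j) * norm z" by (rule norm_cauchy_schwarz)
    also have "\<dots> \<le> norm (s j) * (1 + norm z ^ p)"
      by (intro mult_left_mono norm_le_1_plus_power p_ge_1) auto
    also have "\<dots> \<le> 2 * norm (s j) * (1 + norm z ^ p)" by (intro mult_right_mono) auto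
    finally have "s j \<bullet> z \<le> 2 * norm (s j) * (1 + norm z ^ p)" .
    moreover have "r j \<le> \<bar>r j\<bar> * (1 + norm z ^ p)"
      using mult_left_mono[OF one abs_ge_zero[of "r j"]] by (rule order_trans[rotated]) simp
    ultimately have "\<phi> z \<le> (2 * norm (s j) + \<bar>r j\<bar>) * (1 + norm z ^ p)"
      using j(2) by (simp only: distrib_right)
    also have "\<dots> \<le> (\<Sum>j\<in>I. 2 * norm (s j) + \<bar>r j\<bar>) * (1 + norm z ^ p)"
      using member_le_sum[OF j(1), of "\<lambda>j. 2 * norm (s j) + \<bar>r j\<bar>"] I by (intro mult_right_mono) auto
    finally show ?thesis .
  qed
  then have \<phi>C: "\<phi> \<in> C_b p" by (rule convex_in_C_b[OF \<phi> _ p_ge_1])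
  have below: "A \<le> (\<Sum>j\<in>I. m j * t j) - (\<integral>z. \<phi> z \<partial>\<nu>) + \<epsilon>"
    if t: "\<And>j. j \<in> I \<Longrightarrow> Q c (ereal \<circ> \<phi>) (xs j) < ereal (t j)" for t
  proof -
    have "\<exists>y. \<phi> y + h (xs j - y) < t j" if "j \<in> I" for j
      using t[OF that] unfolding Q_def INF_less_iff by auto
    then obtain w where w: "\<And>j. j \<in> I \<Longrightarrow> \<phi> (w j) + h (xs j - w j) < t j" by metis
    have "(\<Sum>j\<in>I. m j * (s j \<bullet> w j + r j + h (xs j - w j))) \<le> (\<Sum>j\<in>I. m j * t j)"
    proof (intro sum_mono mult_left_mono)
      fix j assume j: "j \<in> I"
      show "s j \<bullet> w j + r j + h (xs j - w j) \<le> t j" using w[OF j] \<phi>_ge[OF j, of "w j"] by linarith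
      show "0 \<le> m j" using m_pos[OF j] by simp
    qed
    then show ?thesis using dual[of w] by (simp add: \<phi>_def)
  qed
  show ?thesis
  proof (rule Q_convex_cases[OF \<phi>])
    assume bot: "\<And>x. Q c (ereal \<circ> \<phi>) x = -\<infinity>"
    \<comment> \<open>If the transform were identically \<open>-\<infinity>\<close>, every real
      \<open>t\<close> would be an admissible bound; the one chosen below would give
      \<open>A \<le> -1\<close>.\<close>
    have "A \<le> t - (\<integral>z. \<phi> z \<partial>\<nu>) + \<epsilon>" for t
      using below[of "\<lambda>_. t"] bot by (simp add: m_sum flip: sum_distrib_right)
    from this[of "(\<integral>z. \<phi> z \<partial>\<nu>) - \<epsilon> - 1"] have False using \<open>0 \<le> A\<close> by simp
    then show ?thesis ..
  next
    fix q assume q: "convex_on UNIV q" "q \<in> C_b p" "Q c (ereal \<circ> \<phi>) = ereal \<circ> q"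
    have "A \<le> (\<Sum>j\<in>I. m j * (q (xs j) + \<epsilon>)) - (\<integral>z. \<phi> z \<partial>\<nu>) + \<epsilon>"
      using q(3) \<open>0 < \<epsilon>\<close> by (intro below) simp
    also have "(\<Sum>j\<in>I. m j * (q (xs j) + \<epsilon>)) = (\<Sum>j\<in>I. m j * q (xs j)) + \<epsilon>"
      by (simp add: distrib_left sum.distrib m_sum flip: sum_distrib_right)
    also have "(\<Sum>j\<in>I. m j * q (xs j)) \<le> (\<integral>x. q x \<partial>\<mu>)"
      by (rule jensen[OF q(1) C_b_integrable[OF \<mu> q(2)]])
    finally have "A \<le> ((\<integral>x. q x \<partial>\<mu>) - (\<integral>z. \<phi> z \<partial>\<nu>)) + 2 * \<epsilon>" by simp
    then have "ereal A \<le> J_backward c \<mu> \<nu> (ereal \<circ> \<phi>) + ereal (2 * \<epsilon>)"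
      by (simp add: J_backward_real[OF \<mu> q(2,3) C_b_integrable[OF \<nu> \<phi>C]])
    also have "J_backward c \<mu> \<nu> (ereal \<circ> \<phi>) \<le> D_backward p c \<mu> \<nu>"
      unfolding D_backward_def using \<phi> \<phi>C by (intro SUP_upper) (simp add: convex_funs_def)
    finally show ?thesis by (simp add: add_right_mono)
  qed
qed

end

section \<open>Strong duality and optimisers\<close>

lemma ext_integral_mono:
  assumes "\<And>x. f x \<le> g x"
  shows "ext_integral M f \<le> ext_integral M g"
proof -
  have "(\<integral>\<^sup>+ x. e2ennreal (f x) \<partial>M) \<le> (\<integral>\<^sup>+ x. e2ennreal (g x) \<partial>M)"
    "(\<integral>\<^sup>+ x. e2ennreal (- g x) \<partial>M) \<le> (\<integral>\<^sup>+ x. e2ennreal (- f x) \<partial>M)"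
    using assms by (auto intro!: nn_integral_mono e2ennreal_mono)
  then show ?thesis
    unfolding ext_integral_def less_eq_ennreal.rep_eq by (rule ereal_minus_mono)
qed

context transport_cost
begin

text \<open>A quarter of \<open>\<epsilon>\<close> each goes to the finite duality, to the
  near-minimisers in the transform, to the cell size \<open>\<delta>\<close> and to the tails
  \<open>\<tau>\<close>.\<close>

lemma strong_duality_approx:
  assumes \<mu>: "\<mu> \<in> P p" and \<nu>: "\<nu> \<in> P p" and "0 < \<epsilon>"
  shows "T_backward c \<mu> \<nu> \<le> D_backward p c \<mu> \<nu> + ereal \<epsilon>"
    "T_forward c \<mu> \<nu> \<le> D_backward p c \<mu> \<nu> + ereal \<epsilon>"
proof -
  interpret \<mu>: prob_space \<mu> by (rule PD[OF \<mu>])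
  interpret \<nu>: prob_space \<nu> by (rule PD[OF \<nu>])
  note [measurable_cong] = PD(2)[OF \<mu>] PD(2)[OF \<nu>]
  note int\<mu> = P_integrable_id[OF \<mu> p_ge_1] and int\<nu> = P_integrable_id[OF \<nu> p_ge_1]
  define S where "S = 1 + (\<integral>x. norm x ^ p \<partial>\<mu>) + (\<integral>z. norm z ^ p \<partial>\<nu>)"
  have S: "1 \<le> S" unfolding S_def by (simp add: add_nonneg_nonneg)
  \<comment> \<open>Shifted by 1 since the growth constant may vanish and the next two definitions
    divide by it.\<close>
  define k where "k = growth_const + 1"
  have k: "0 < k" "growth_const \<le> k" using growth_const_nonneg by (auto simp: k_def)
  define \<delta> where "\<delta> = \<epsilon> / (4 * k * S)"
  define \<tau> where "\<tau> = \<epsilon> / (12 * k)"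
  have \<delta>: "0 < \<delta>" and \<tau>: "0 < \<tau>" using k S \<open>0 < \<epsilon>\<close> by (auto simp: \<delta>_def \<tau>_def)
  have "k * (\<delta> * S) = \<epsilon> / 4" "k * (3 * \<tau>) = \<epsilon> / 4"
    using k S by (simp_all add: \<delta>_def \<tau>_def)
  moreover have "growth_const * (\<delta> * S) \<le> k * (\<delta> * S)" "growth_const * (3 * \<tau>) \<le> k * (3 * \<tau>)"
    using \<delta> \<tau> S k by (auto intro!: mult_right_mono)
  ultimately have err: "growth_const * (\<delta> * S + 3 * \<tau>) \<le> \<epsilon> / 2" by (simp add: distrib_left)
  \<comment> \<open>The order of choice matters: \<open>L\<close> cuts the tail of
    \<open>\<nu>\<close> at \<open>\<tau>\<close>, and only then \<open>R\<close> makes the outer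
    cell so light that its mass times \<open>L ^ p\<close> is at most \<open>\<tau>\<close>. This
    yields \<open>2 * \<tau>\<close> for whichever piece \<open>\<rho> N\<close> of
    \<open>\<nu>\<close> the outer cell receives.\<close>
  obtain L where L: "0 < L" "(\<integral>z. indicat_real {z. L < norm z} z * norm z ^ p \<partial>\<nu>) < \<tau>"
    using tail_integral_small[OF PD(2,3)[OF \<nu>] \<tau>] by blast
  define \<tau>' where "\<tau>' = \<tau> / (1 + L ^ p)"
  have L': "0 < 1 + L ^ p" using L(1) by (simp add: add_pos_pos)
  have \<tau>': "0 < \<tau>'" "\<tau>' \<le> \<tau>" "L ^ p * \<tau>' \<le> \<tau>"
    using \<tau> L(1) L' by (auto simp: \<tau>'_def field_simps)
  have int1: "integrable \<mu> (\<lambda>x. 1 + norm x ^ p)" using PD(3)[OF \<mu>] by simp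
  obtain R where R: "(\<integral>x. indicat_real {x. R < norm x} x * (1 + norm x ^ p) \<partial>\<mu>) < \<tau>'"
    using tail_integral_small[OF PD(2)[OF \<mu>] int1 \<tau>'(1)] by blast
  obtain N and cell :: "'a \<Rightarrow> nat" where cell [measurable]: "cell \<in> measurable borel (count_space UNIV)"
    and cell_le: "\<And>x. cell x \<le> N" and outer: "\<And>x. cell x = N \<longleftrightarrow> R < norm x"
    and inner: "\<And>x x'. cell x = cell x' \<Longrightarrow> cell x \<noteq> N \<Longrightarrow> norm (x - x') \<le> \<delta>"
    by (rule cell_partition[OF \<delta>, of R]) (rule that)
  define m where "m j = measure \<mu> {x. cell x = j}" for j
  define I where "I = {j \<in> {..N}. 0 < m j}"
  have I: "finite I" by (simp add: I_def)
  have m_pos: "0 < m j" if "j \<in> I" for j using that by (simp add: I_def)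
  have ind: "integrable \<mu> (indicat_real {x. cell x = j})" for j
    by (rule \<mu>.integrable_const_bound[where B = 1]) auto
  have m_int: "(\<integral>x. indicat_real {x. cell x = j} x \<partial>\<mu>) = m j" for j
  proof -
    have "{x. cell x = j} \<in> sets \<mu>" unfolding PD(2)[OF \<mu>] by measurable
    then show ?thesis by (simp add: m_def)
  qed
  have m_sum: "(\<Sum>j\<in>I. m j) = 1"
  proof -
    have "(\<Sum>j\<in>I. m j) = (\<Sum>j\<le>N. m j)"
      by (rule sum.mono_neutral_left) (auto simp: I_def m_def zero_less_measure_iff)
    also have "\<dots> = (\<integral>x. (\<Sum>j\<le>N. indicat_real {x. cell x = j} x) \<partial>\<mu>)"
      unfolding m_int[symmetric] by (rule Bochner_Integration.integral_sum[symmetric]) (rule ind)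
    also have "\<dots> = (\<integral>x. 1 \<partial>\<mu>)"
    proof (rule Bochner_Integration.integral_cong[OF refl])
      fix x
      have "(\<Sum>j\<le>N. indicat_real {x. cell x = j} x) = (\<Sum>j\<le>N. if j = cell x then 1 else 0)"
        by (intro sum.cong) (auto simp: indicator_def)
      then show "(\<Sum>j\<le>N. indicat_real {x. cell x = j} x) = 1" using cell_le by simp
    qed
    finally show ?thesis by (simp add: \<mu>.prob_space)
  qed
  have cell_AE: "AE x in \<mu>. cell x \<in> I"
  proof -
    have "AE x in \<mu>. cell x \<noteq> j" if "j \<in> {..N} - I" for j
    proof (rule AE_I')
      have "{x. cell x = j} \<in> sets \<mu>" unfolding PD(2)[OF \<mu>] by measurable
      moreover have "measure \<mu> {x. cell x = j} = 0"
        using that by (simp add: I_def m_def zero_less_measure_iff)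
      ultimately show "{x. cell x = j} \<in> null_sets \<mu>" by (simp add: \<mu>.emeasure_eq_measure null_setsI)
    qed auto
    then have "AE x in \<mu>. \<forall>j\<in>{..N} - I. cell x \<noteq> j" by (intro AE_finite_allI) auto
    then show ?thesis by eventually_elim (use cell_le in blast)
  qed
  define xs where "xs j = (\<integral>x. indicat_real {x. cell x = j} x *\<^sub>R x \<partial>\<mu>) /\<^sub>R m j" for j
  have ind_int: "integrable \<mu> (\<lambda>x. indicat_real {x. cell x = j} x *\<^sub>R f x)"
    if "integrable \<mu> f" for j and f :: "'a \<Rightarrow> 'b::{banach, second_countable_topology}"
  proof -
    have "f \<in> borel_measurable \<mu>" using that by simp
    then have "(\<lambda>x. indicat_real {x. cell x = j} x *\<^sub>R f x) \<in> borel_measurable \<mu>" by measurable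
    then show ?thesis
      by (rule Bochner_Integration.integrable_bound[OF that]) (auto simp: indicator_def)
  qed
  have cell_jensen: "m j * f (xs j) \<le> (\<integral>x. indicat_real {x. cell x = j} x * f x \<partial>\<mu>)"
    if "j \<in> I" "convex_on UNIV f" "integrable \<mu> f" for j f
    unfolding xs_def using ind_int[OF that(3)] ind_int[OF int\<mu>] m_pos[OF that(1)]
    by (intro weighted_jensen that(2) ind m_int) auto
  have near: "norm (x - xs j) \<le> \<delta>" if j: "j \<in> I" "j \<noteq> N" and x: "cell x = j" for j x
  proof -
    \<comment> \<open>The distance to \<open>x\<close> is convex and at most \<open>\<delta>\<close>
      on the cell, hence also at the barycentre of the cell. The odd form fits
      \<open>convex_translate_minus\<close>.\<close>
    define f where "f y = norm (y + - x) - 0" for y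
    have f: "convex_on UNIV f"
      unfolding f_def using convex_translate_minus[OF convex_on_norm_power[of 1], of "- x" 0] by simp
    have f_int: "integrable \<mu> f" unfolding f_def using int\<mu> by simp
    have "m j * f (xs j) \<le> (\<integral>y. indicat_real {y. cell y = j} y * f y \<partial>\<mu>)"
      by (rule cell_jensen[OF j(1) f f_int])
    also have "\<dots> \<le> (\<integral>y. indicat_real {y. cell y = j} y * \<delta> \<partial>\<mu>)"
    proof (rule integral_mono)
      show "indicat_real {y. cell y = j} y * f y \<le> indicat_real {y. cell y = j} y * \<delta>" for y
        using inner[of y x] j(2) x by (auto simp: indicator_def f_def)
    qed (use ind_int[OF f_int, of j] ind in auto)
    also have "\<dots> = m j * \<delta>" using m_int by simp
    finally show ?thesis using m_pos[OF j(1)] by (simp add: f_def norm_minus_commute)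
  qed
  have \<epsilon>4: "0 < \<epsilon> / 4" using \<open>0 < \<epsilon>\<close> by simp
  obtain \<rho> s r where \<rho>: "\<rho> \<in> partitions_of_unity I" "\<And>j. j \<in> I \<Longrightarrow> (\<integral>z. \<rho> j z \<partial>\<nu>) = m j"
    and dual: "\<And>w. (\<Sum>j\<in>I. m j * h (xs j - (\<integral>z. \<rho> j z *\<^sub>R z \<partial>\<nu>) /\<^sub>R m j)) \<le>
       (\<Sum>j\<in>I. m j * (s j \<bullet> w j + r j + h (xs j - w j))) -
       (\<integral>z. Max ((\<lambda>j. s j \<bullet> z + r j) ` I) \<partial>\<nu>) + \<epsilon> / 4"
    by (rule finite_weak_transport_duality[OF PD(1,2)[OF \<nu>] int\<nu> I m_pos m_sum h_convex h_nonneg \<epsilon>4, of xs])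
       (assumption, rule that)
  have disc: "discretisation \<mu> \<nu> I cell m \<rho>"
    by unfold_locales
       (use P_mono_1[OF \<mu> p_ge_1] P_mono_1[OF \<nu> p_ge_1] I cell cell_AE m_pos \<rho> in \<open>auto simp: m_def\<close>)
  interpret D: discretisation \<mu> \<nu> I cell m \<rho> by (rule disc)
  define A where "A = (\<Sum>j\<in>I. m j * h (xs j - D.bary j))"
  have A_eq: "A = (\<Sum>j\<in>I. m j * h (xs j - (\<integral>z. \<rho> j z *\<^sub>R z \<partial>\<nu>) /\<^sub>R m j))"
    unfolding A_def by (intro sum.cong refl) (simp add: D.bary_def)
  have A_nonneg: "0 \<le> A"
    unfolding A_def using m_pos h_nonneg by (intro sum_nonneg mult_nonneg_nonneg) (auto simp: less_imp_le)
  have A: "ereal A \<le> D_backward p c \<mu> \<nu> + ereal (2 * (\<epsilon> / 4))"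
  proof (rule discretised_dual[OF I m_pos m_sum \<mu> \<nu> A_nonneg \<epsilon>4 dual[folded A_eq]])
    fix f :: "'a \<Rightarrow> real" assume f: "convex_on UNIV f" "integrable \<mu> f"
    have "(\<Sum>j\<in>I. m j * f (xs j)) \<le> (\<Sum>j\<in>I. \<integral>x. indicat_real {x. cell x = j} x * f x \<partial>\<mu>)"
      by (intro sum_mono cell_jensen f)
    then show "(\<Sum>j\<in>I. m j * f (xs j)) \<le> (\<integral>x. f x \<partial>\<mu>)" by (simp add: D.cell_sum[OF f(2)])
  qed
  have outer_set: "{x. cell x = N} = {x. R < norm x}" using outer by auto
  have tail\<mu>: "(\<integral>x. indicat_real {x. cell x = N} x * (1 + norm x ^ p) \<partial>\<mu>) \<le> \<tau>"
    unfolding outer_set using R \<tau>'(2) by linarith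
  have tail\<nu>: "(\<integral>z. \<rho> N z * norm z ^ p \<partial>\<nu>) \<le> 2 * \<tau>" if N: "N \<in> I"
  proof -
    have [measurable]: "\<rho> N \<in> borel_measurable borel" by (rule partitions_of_unityD(1)[OF \<rho>(1) N])
    have int_ind: "integrable \<nu> (\<lambda>z. indicat_real {z. L < norm z} z * norm z ^ p)"
      by (rule Bochner_Integration.integrable_bound[OF PD(3)[OF \<nu>]]) (auto simp: indicator_def)
    have int_\<rho>: "integrable \<nu> (\<rho> N)" using D.\<rho>_integrable[OF N, of "\<lambda>_. 1 :: real"] by simp
    have "(\<integral>z. \<rho> N z * norm z ^ p \<partial>\<nu>) \<le>
        (\<integral>z. \<rho> N z * L ^ p + indicat_real {z. L < norm z} z * norm z ^ p \<partial>\<nu>)"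
    proof (rule integral_mono)
      fix z
      show "\<rho> N z * norm z ^ p \<le> \<rho> N z * L ^ p + indicat_real {z. L < norm z} z * norm z ^ p"
      proof (cases "L < norm z")
        case True
        have "\<rho> N z * norm z ^ p \<le> 1 * norm z ^ p"
          by (intro mult_right_mono partitions_of_unity_le_1[OF \<rho>(1) I N]) simp
        moreover have "0 \<le> \<rho> N z * L ^ p" using partitions_of_unityD(2)[OF \<rho>(1) N] L(1) by simp
        ultimately show ?thesis using True by simp
      next
        case False
        then have "\<rho> N z * norm z ^ p \<le> \<rho> N z * L ^ p"
          by (intro mult_left_mono power_mono partitions_of_unityD(2)[OF \<rho>(1) N]) auto
        then show ?thesis using False by simp
      qed
    qed (use D.\<rho>_integrable[OF N PD(3)[OF \<nu>]] int_ind int_\<rho> in auto)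
    also have "\<dots> = m N * L ^ p + (\<integral>z. indicat_real {z. L < norm z} z * norm z ^ p \<partial>\<nu>)"
      using int_ind int_\<rho> \<rho>(2)[OF N] by simp
    also have "\<dots> \<le> L ^ p * \<tau>' + \<tau>"
    proof (rule add_mono)
      have "m N \<le> (\<integral>x. indicat_real {x. cell x = N} x * (1 + norm x ^ p) \<partial>\<mu>)"
        unfolding m_int[symmetric] using ind ind_int[OF int1, of N]
        by (intro integral_mono) (auto simp: indicator_def)
      then have "m N \<le> \<tau>'" using R unfolding outer_set by simp
      then show "m N * L ^ p \<le> L ^ p * \<tau>'" using L(1) by (simp add: mult.commute)
    qed (use L(2) in simp)
    finally show ?thesis using \<tau>'(3) by simp
  qed
  have cost: "integrable \<mu> (\<lambda>x. h (x - D.bary (cell x)))"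
    "(\<integral>x. h (x - D.bary (cell x)) \<partial>\<mu>) \<le> A + growth_const * (\<delta> * S + 3 * \<tau>)"
    unfolding S_def A_def
    using discretised_cost[where xs = xs and N = N and cell = cell and I = I,
        OF disc \<mu> \<nu> _ less_imp_le[OF \<delta>] tail\<mu> tail\<nu>] near
    by blast+
  have "(\<integral>x. h (x - D.bary (cell x)) \<partial>\<mu>) \<le> A + \<epsilon> / 2" using cost(2) err by linarith
  then have "ereal (\<integral>x. h (x - D.bary (cell x)) \<partial>\<mu>) \<le> ereal A + ereal (\<epsilon> / 2)" by simp
  also have "\<dots> \<le> (D_backward p c \<mu> \<nu> + ereal (2 * (\<epsilon> / 4))) + ereal (\<epsilon> / 2)"
    by (intro add_right_mono A)
  also have "\<dots> = D_backward p c \<mu> \<nu> + ereal \<epsilon>" by (simp add: add.assoc)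
  finally have le: "ereal (\<integral>x. h (x - D.bary (cell x)) \<partial>\<mu>) \<le> D_backward p c \<mu> \<nu> + ereal \<epsilon>" .
  show "T_backward c \<mu> \<nu> \<le> D_backward p c \<mu> \<nu> + ereal \<epsilon>"
    by (rule order_trans[OF D.T_backward_le[OF h_measurable cost(1)] le])
  show "T_forward c \<mu> \<nu> \<le> D_backward p c \<mu> \<nu> + ereal \<epsilon>"
    by (rule order_trans[OF D.T_forward_le[OF h_measurable cost(1)] le])
qed

section \<open>Comparison of the dual functionals and exchange of optimisers\<close>

lemma J_backward_bot:
  assumes "prob_space \<mu>" "integrable \<nu> \<phi>" "\<And>x. Q c (ereal \<circ> \<phi>) x = -\<infinity>"
  shows "J_backward c \<mu> \<nu> (ereal \<circ> \<phi>) = -\<infinity>"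
proof -
  interpret prob_space \<mu> by fact
  have "ext_integral \<mu> (Q c (ereal \<circ> \<phi>)) = -\<infinity>"
    unfolding ext_integral_def assms(3) by (simp add: e2ennreal_neg emeasure_space_1 zero_ennreal.rep_eq)
  then show ?thesis
    using ext_integral_eq_lebesgue_integral[OF assms(2)] by (simp add: J_backward_def comp_def[of ereal \<phi>])
qed

lemma J_backward_le_J_forward_Q:
  assumes "Q c (ereal \<circ> \<phi>) = ereal \<circ> q"
  shows "J_backward c \<mu> \<nu> (ereal \<circ> \<phi>) \<le> J_forward c \<mu> \<nu> (ereal \<circ> q)"
  unfolding J_backward_def J_forward_def
proof (rule ereal_minus_mono)
  show "ext_integral \<nu> (Q_bar c (ereal \<circ> q)) \<le> ext_integral \<nu> (ereal \<circ> \<phi>)"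
    using Q_bar_Q_le[OF assms] by (intro ext_integral_mono) (simp add: assms)
qed (simp add: assms)

lemma J_forward_le_J_backward_Q_bar:
  "J_forward c \<mu> \<nu> (ereal \<circ> \<psi>) \<le> J_backward c \<mu> \<nu> (Q_bar c (ereal \<circ> \<psi>))"
  unfolding J_backward_def J_forward_def
  using Q_Q_bar_ge by (intro ereal_minus_mono ext_integral_mono) auto

lemma J_forward_infinite:
  assumes "\<mu> \<in> P p" "\<psi> \<in> C_b p" "ext_integral \<nu> (Q_bar c (ereal \<circ> \<psi>)) = \<infinity>"
  shows "J_forward c \<mu> \<nu> (ereal \<circ> \<psi>) = -\<infinity>"
  using ext_integral_eq_lebesgue_integral[OF C_b_integrable[OF assms(1,2)]] assms(3)
  by (simp add: J_forward_def comp_def)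

text \<open>The zero potential suffices because \<open>h\<close> is nonnegative. The bound keeps
  optimisers away from the functional value \<open>-\<infinity>\<close>, and so from a transform
  that is \<open>-\<infinity>\<close> or has infinite integral.\<close>

lemma D_backward_nonneg:
  assumes \<mu>: "\<mu> \<in> P p" and \<nu>: "\<nu> \<in> P p"
  shows "0 \<le> D_backward p c \<mu> \<nu>"
proof -
  let ?z = "\<lambda>_::'a. 0::real"
  have conv: "convex_on UNIV ?z" by (simp add: convex_on_def)
  have Cb: "?z \<in> C_b p" by (rule C_bI[where K = 0]) auto
  have nonneg: "0 \<le> Q c (ereal \<circ> ?z) x" for x
    unfolding Q_def using h_nonneg by (intro INF_greatest) simp
  have "0 \<le> J_backward c \<mu> \<nu> (ereal \<circ> ?z)"
  proof (rule Q_convex_cases[OF conv])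
    assume "\<And>x. Q c (ereal \<circ> ?z) x = -\<infinity>"
    then show ?thesis using nonneg[of 0] by simp
  next
    fix q assume q: "convex_on UNIV q" "q \<in> C_b p" "Q c (ereal \<circ> ?z) = ereal \<circ> q"
    have "0 \<le> q x" for x using nonneg[of x] unfolding q(3) by simp
    then show ?thesis
      by (subst J_backward_real[OF \<mu> q(2,3)]) (simp_all add: Bochner_Integration.integral_nonneg)
  qed
  also have "\<dots> \<le> D_backward p c \<mu> \<nu>"
    unfolding D_backward_def using conv Cb by (intro SUP_upper) (simp add: convex_funs_def)
  finally show ?thesis .
qed

lemma J_backward_Q_bar_le_T_backward:
  assumes "convex_on UNIV \<psi>" "\<psi> \<in> C_b p" "\<mu> \<in> P p" "\<nu> \<in> P p"
    "ext_integral \<nu> (Q_bar c (ereal \<circ> \<psi>)) \<noteq> \<infinity>"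
  shows "J_backward c \<mu> \<nu> (Q_bar c (ereal \<circ> \<psi>)) \<le> T_backward c \<mu> \<nu>"
  unfolding T_backward_def T_def by (intro INF_greatest J_backward_Q_bar_le_cost assms)

lemma duality:
  assumes \<mu>: "\<mu> \<in> P p" and \<nu>: "\<nu> \<in> P p"
  shows "T_forward c \<mu> \<nu> = D_forward p c \<mu> \<nu>" "D_forward p c \<mu> \<nu> = D_backward p c \<mu> \<nu>"
    "D_backward p c \<mu> \<nu> = T_backward c \<mu> \<nu>"
proof -
  have DbDf: "D_backward p c \<mu> \<nu> \<le> D_forward p c \<mu> \<nu>"
    unfolding D_backward_def
  proof (rule SUP_least)
    fix \<phi> :: "'a \<Rightarrow> real" assume "\<phi> \<in> convex_funs \<inter> C_b p"
    then have \<phi>: "convex_on UNIV \<phi>" "\<phi> \<in> C_b p" by (auto simp: convex_funs_def)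
    show "J_backward c \<mu> \<nu> (ereal \<circ> \<phi>) \<le> D_forward p c \<mu> \<nu>"
    proof (rule Q_convex_cases[OF \<phi>(1)])
      assume "\<And>x. Q c (ereal \<circ> \<phi>) x = -\<infinity>"
      then show ?thesis using J_backward_bot[OF PD(1)[OF \<mu>] C_b_integrable[OF \<nu> \<phi>(2)]] by simp
    next
      fix q assume q: "convex_on UNIV q" "q \<in> C_b p" "Q c (ereal \<circ> \<phi>) = ereal \<circ> q"
      have "J_forward c \<mu> \<nu> (ereal \<circ> q) \<le> D_forward p c \<mu> \<nu>"
        unfolding D_forward_def using q by (intro SUP_upper) (simp add: convex_funs_def)
      then show ?thesis using J_backward_le_J_forward_Q[OF q(3)] by (rule order_trans[rotated])
    qed
  qed
  have DfTf: "D_forward p c \<mu> \<nu> \<le> T_forward c \<mu> \<nu>"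
    unfolding D_forward_def T_forward_def T_def
    by (intro SUP_least INF_greatest J_forward_le_cost \<mu> \<nu>) (auto simp: convex_funs_def)
  \<comment> \<open>\<open>\<psi>\<close> is replaced by its transform, to which weak duality
    applies even outside the class of \<open>D_backward\<close>.\<close>
  have DfTb: "D_forward p c \<mu> \<nu> \<le> T_backward c \<mu> \<nu>"
    unfolding D_forward_def
  proof (rule SUP_least)
    fix \<psi> :: "'a \<Rightarrow> real" assume "\<psi> \<in> convex_funs \<inter> C_b p"
    then have \<psi>: "convex_on UNIV \<psi>" "\<psi> \<in> C_b p" by (auto simp: convex_funs_def)
    show "J_forward c \<mu> \<nu> (ereal \<circ> \<psi>) \<le> T_backward c \<mu> \<nu>"
    proof (cases "ext_integral \<nu> (Q_bar c (ereal \<circ> \<psi>)) = \<infinity>")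
      case True
      then show ?thesis using J_forward_infinite[OF \<mu> \<psi>(2)] by simp
    next
      case False
      then show ?thesis
        using J_forward_le_J_backward_Q_bar J_backward_Q_bar_le_T_backward[OF \<psi> \<mu> \<nu>]
        by (rule_tac order_trans)
    qed
  qed
  have TbDb: "T_backward c \<mu> \<nu> \<le> D_backward p c \<mu> \<nu>" and TfDb: "T_forward c \<mu> \<nu> \<le> D_backward p c \<mu> \<nu>"
    by (rule ereal_le_epsilon2, simp add: strong_duality_approx[OF \<mu> \<nu>])+
  show "T_forward c \<mu> \<nu> = D_forward p c \<mu> \<nu>" "D_forward p c \<mu> \<nu> = D_backward p c \<mu> \<nu>"
    "D_backward p c \<mu> \<nu> = T_backward c \<mu> \<nu>"
    using DbDf DfTf DfTb TbDb TfDb by order+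
qed

text \<open>The common dual value is \<open>J_backward\<close> at \<open>\<phi>\<close>, hence at
  most \<open>J_forward\<close> at the transform, which \<open>D_forward\<close> bounds by the same
  value. Integrability of \<open>\<phi>\<close> is enough, since the growth of the transform comes
  from \<open>h\<close>.\<close>

lemma Q_forward_optimal:
  assumes \<mu>: "\<mu> \<in> P p" and \<nu>: "\<nu> \<in> P p" and \<phi>: "convex_on UNIV \<phi>" "integrable \<nu> \<phi>"
    and opt: "backward_optimal p c \<mu> \<nu> (ereal \<circ> \<phi>)"
  shows "Q c (ereal \<circ> \<phi>) \<in> (\<lambda>f. ereal \<circ> f) ` (convex_funs \<inter> C_b p)"
    "forward_optimal p c \<mu> \<nu> (Q c (ereal \<circ> \<phi>))"
proof -
  have opt': "J_backward c \<mu> \<nu> (ereal \<circ> \<phi>) = D_backward p c \<mu> \<nu>"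
    using opt by (simp add: backward_optimal_def)
  have "Q c (ereal \<circ> \<phi>) \<in> (\<lambda>f. ereal \<circ> f) ` (convex_funs \<inter> C_b p) \<and>
      forward_optimal p c \<mu> \<nu> (Q c (ereal \<circ> \<phi>))"
  proof (rule Q_convex_cases[OF \<phi>(1)])
    assume "\<And>x. Q c (ereal \<circ> \<phi>) x = -\<infinity>"
    then show ?thesis
      using J_backward_bot[OF PD(1)[OF \<mu>] \<phi>(2)] opt' D_backward_nonneg[OF \<mu> \<nu>] by simp
  next
    fix q assume q: "convex_on UNIV q" "q \<in> C_b p" "Q c (ereal \<circ> \<phi>) = ereal \<circ> q"
    have "J_forward c \<mu> \<nu> (ereal \<circ> q) \<le> D_forward p c \<mu> \<nu>"
      unfolding D_forward_def using q by (intro SUP_upper) (simp add: convex_funs_def)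
    moreover have "D_forward p c \<mu> \<nu> \<le> J_forward c \<mu> \<nu> (ereal \<circ> q)"
      using J_backward_le_J_forward_Q[OF q(3), of \<mu> \<nu>] opt' duality(2)[OF \<mu> \<nu>] by simp
    ultimately have "J_forward c \<mu> \<nu> (ereal \<circ> q) = D_forward p c \<mu> \<nu>" by (rule antisym)
    then show ?thesis
      unfolding q(3) forward_optimal_def
      by (intro conjI imageI) (use q(1,2) in \<open>auto simp: convex_funs_def\<close>)
  qed
  then show "Q c (ereal \<circ> \<phi>) \<in> (\<lambda>f. ereal \<circ> f) ` (convex_funs \<inter> C_b p)"
    "forward_optimal p c \<mu> \<nu> (Q c (ereal \<circ> \<phi>))" by auto
qed

text \<open>The same sandwich in the other direction, closed from above by
  \<open>T_backward\<close>: the transform may take the value infinity, so it cannot be compared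
  with the supremum \<open>D_backward\<close> directly.\<close>

lemma Q_bar_backward_optimal:
  assumes \<mu>: "\<mu> \<in> P p" and \<nu>: "\<nu> \<in> P p" and \<psi>: "convex_on UNIV \<psi>" "\<psi> \<in> C_b p"
    and opt: "forward_optimal p c \<mu> \<nu> (ereal \<circ> \<psi>)"
  shows "Q_bar c (ereal \<circ> \<psi>) \<in> ext_L1 \<nu>"
    "(\<forall>y. Q_bar c (ereal \<circ> \<psi>) y \<noteq> \<infinity>) \<Longrightarrow>
      Q_bar c (ereal \<circ> \<psi>) \<in> (\<lambda>f. ereal \<circ> f) ` (convex_funs \<inter> L1 \<nu>)"
    "backward_optimal p c \<mu> \<nu> (Q_bar c (ereal \<circ> \<psi>))"
proof -
  define G where "G = Q_bar c (ereal \<circ> \<psi>)"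
  have opt': "J_forward c \<mu> \<nu> (ereal \<circ> \<psi>) = D_backward p c \<mu> \<nu>"
    using opt by (simp add: forward_optimal_def duality(2)[OF \<mu> \<nu>])
  have fin: "ext_integral \<nu> G \<noteq> \<infinity>"
    using J_forward_infinite[OF \<mu> \<psi>(2), of \<nu>] opt' D_backward_nonneg[OF \<mu> \<nu>]
    unfolding G_def by auto
  obtain g where g: "integrable \<nu> g" "AE y in \<nu>. G y = ereal (g y)" "\<And>y. g y = real_of_ereal (G y)"
    using fin unfolding G_def by (rule_tac Q_bar_integral_cases[OF \<psi> \<nu>]) auto
  have "(\<integral>\<^sup>+ y. e2ennreal \<bar>G y\<bar> \<partial>\<nu>) = (\<integral>\<^sup>+ y. ennreal (norm (g y)) \<partial>\<nu>)"
    using g(2) by (intro nn_integral_cong_AE) auto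
  also have "\<dots> < \<infinity>" using g(1) by (simp add: integrable_iff_bounded)
  finally show "Q_bar c (ereal \<circ> \<psi>) \<in> ext_L1 \<nu>"
    using Q_bar_measurable[OF \<psi>(1)] unfolding ext_L1_def G_def by (simp add: P_measurable[OF \<nu>])
  show "Q_bar c (ereal \<circ> \<psi>) \<in> (\<lambda>f. ereal \<circ> f) ` (convex_funs \<inter> L1 \<nu>)"
    if "\<forall>y. Q_bar c (ereal \<circ> \<psi>) y \<noteq> \<infinity>"
  proof -
    have conv: "G \<in> ext_convex_funs" unfolding G_def by (rule Q_bar_ext_convex[OF \<psi>(1)])
    have eq: "G y = ereal (g y)" for y
      using that conv unfolding G_def[symmetric] g(3) ext_convex_funs_def by (cases "G y") auto
    have "convex_on UNIV g"
      unfolding convex_on_def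
    proof (intro conjI ballI allI impI convex_UNIV)
      fix x y and u v :: real
      assume "0 \<le> u" "0 \<le> v" "u + v = 1"
      then have "G (u *\<^sub>R x + v *\<^sub>R y) \<le> ereal u * G x + ereal v * G y"
        using conv unfolding ext_convex_funs_def by blast
      then show "g (u *\<^sub>R x + v *\<^sub>R y) \<le> u * g x + v * g y" by (simp add: eq)
    qed
    then show ?thesis
      using g(1) eq unfolding G_def[symmetric]
      by (intro image_eqI[of _ _ g]) (auto simp: convex_funs_def L1_def)
  qed
  have "J_backward c \<mu> \<nu> G \<le> D_backward p c \<mu> \<nu>"
    using J_backward_Q_bar_le_T_backward[OF \<psi> \<mu> \<nu>] fin unfolding G_def duality(3)[OF \<mu> \<nu>] by blast
  moreover have "D_backward p c \<mu> \<nu> \<le> J_backward c \<mu> \<nu> G"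
    using J_forward_le_J_backward_Q_bar[of \<mu> \<nu> \<psi>] opt' by (simp add: G_def)
  ultimately show "backward_optimal p c \<mu> \<nu> (Q_bar c (ereal \<circ> \<psi>))"
    unfolding backward_optimal_def G_def by (rule antisym)
qed

end

section \<open>From the standing assumption on the cost to the locale, and the theorem\<close>

lemma strictly_convex_imp_convex_on:
  assumes "strictly_convex h"
  shows "convex_on UNIV h"
  unfolding convex_on_def
proof (intro conjI ballI allI impI convex_UNIV)
  fix x y and u v :: real
  assume uv: "0 \<le> u" "0 \<le> v" "u + v = 1"
  show "h (u *\<^sub>R x + v *\<^sub>R y) \<le> u * h x + v * h y"
  proof (cases "x = y \<or> u = 0 \<or> v = 0")
    case True
    then show ?thesis using uv by (auto simp flip: scaleR_add_left distrib_right)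
  next
    case False
    then have "x \<noteq> y" "0 < v" "v < 1" "u = 1 - v" using uv by auto
    then have "h ((1 - v) *\<^sub>R x + v *\<^sub>R y) < (1 - v) * h x + v * h y"
      using assms unfolding strictly_convex_def by blast
    then show ?thesis using \<open>u = 1 - v\<close> by simp
  qed
qed

text \<open>Beyond radius \<open>a\<close> the global growth bound is the supremum condition;
  inside, it comes from continuity on a compact ball.\<close>

lemma admissible_cost_transport_cost:
  fixes h :: "'a::euclidean_space \<Rightarrow> real"
  assumes h: "admissible_cost p h" and p: "1 \<le> p"
  obtains C where "transport_cost h C p"
proof -
  obtain a where nonneg: "\<And>z. 0 \<le> h z" and conv: "convex_on UNIV h" and a: "0 < a"
    and sup: "(SUP z\<in>{z. a \<le> norm z}. ereal (h z / norm z ^ p)) < \<infinity>"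
    using h strictly_convex_imp_convex_on unfolding admissible_cost_def by blast
  obtain B where B: "(SUP z\<in>{z. a \<le> norm z}. ereal (h z / norm z ^ p)) \<le> ereal B"
    using sup by (cases "SUP z\<in>{z. a \<le> norm z}. ereal (h z / norm z ^ p)") auto
  have "bounded (h ` cball 0 a)"
    by (intro compact_imp_bounded compact_continuous_image convex_on_UNIV_continuous conv) simp
  then obtain B' where B': "\<forall>y\<in>h ` cball 0 a. norm y \<le> B'" unfolding bounded_iff by blast
  define C where "C = max \<bar>B\<bar> \<bar>B'\<bar>"
  have "h z \<le> C * (1 + norm z ^ p)" for z
  proof (cases "a \<le> norm z")
    case True
    have "ereal (h z / norm z ^ p) \<le> ereal B"
      using True by (intro order_trans[OF SUP_upper B]) simp
    then have "h z / norm z ^ p \<le> C" by (simp add: C_def)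
    moreover have "0 < norm z ^ p" by (rule zero_less_power[OF less_le_trans[OF a True]])
    ultimately have "h z \<le> C * norm z ^ p" by (simp add: pos_divide_le_eq)
    also have "\<dots> \<le> C * (1 + norm z ^ p)" by (intro mult_left_mono) (auto simp: C_def)
    finally show ?thesis .
  next
    case False
    then have "h z \<in> h ` cball 0 a" by simp
    then have "h z \<le> C" using B' by (force simp: C_def)
    also have "\<dots> \<le> C * (1 + norm z ^ p)" using mult_left_mono[of 1 "1 + norm z ^ p" C] by (simp add: C_def)
    finally show ?thesis .
  qed
  then have "transport_cost h C p" using conv nonneg p by unfold_locales
  then show ?thesis by (rule that)
qed

theorem theorem2:
  fixes p :: nat
    and \<mu> \<nu> :: "'a::euclidean_space measure"
    and h :: "'a \<Rightarrow> real"
    and c :: "'a \<Rightarrow> 'a \<Rightarrow> real"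
  assumes "1 \<le> p"
    and "\<mu> \<in> P p"
    and "\<nu> \<in> P p"
    and "admissible_cost p h"
    and "c = (\<lambda>x y. h (x - y))"
  shows "T_forward c \<mu> \<nu> = D_forward p c \<mu> \<nu>
    \<and> D_forward p c \<mu> \<nu> = D_backward p c \<mu> \<nu>
    \<and> D_backward p c \<mu> \<nu> = T_backward c \<mu> \<nu>
    \<and> (\<forall>\<phi> \<in> convex_funs \<inter> L1 \<nu>. backward_optimal p c \<mu> \<nu> (ereal \<circ> \<phi>) \<longrightarrow>
         Q c (ereal \<circ> \<phi>) \<in> (\<lambda>f. ereal \<circ> f) ` (convex_funs \<inter> C_b p)
         \<and> forward_optimal p c \<mu> \<nu> (Q c (ereal \<circ> \<phi>)))
    \<and> (\<forall>\<psi> \<in> convex_funs \<inter> C_b p. forward_optimal p c \<mu> \<nu> (ereal \<circ> \<psi>) \<longrightarrow>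
         Q_bar c (ereal \<circ> \<psi>) \<in> ext_convex_funs \<inter> ext_L1 \<nu>
         \<and> ((\<forall>y. Q_bar c (ereal \<circ> \<psi>) y \<noteq> \<infinity>) \<longrightarrow>
               Q_bar c (ereal \<circ> \<psi>) \<in> (\<lambda>f. ereal \<circ> f) ` (convex_funs \<inter> L1 \<nu>))
         \<and> backward_optimal p c \<mu> \<nu> (Q_bar c (ereal \<circ> \<psi>)))"
proof -
  obtain C where "transport_cost h C p"
    using admissible_cost_transport_cost[OF assms(4,1)] by blast
  then interpret tc: transport_cost h C p .
  note c = assms(5)
  show ?thesis
    unfolding c
  proof (intro conjI ballI impI tc.duality assms(2,3))
    fix \<phi> :: "'a \<Rightarrow> real"
    assume \<phi>: "\<phi> \<in> convex_funs \<inter> L1 \<nu>"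
      and opt: "backward_optimal p (\<lambda>x y. h (x - y)) \<mu> \<nu> (ereal \<circ> \<phi>)"
    have conv: "convex_on UNIV \<phi>" "integrable \<nu> \<phi>" using \<phi> by (auto simp: convex_funs_def L1_def)
    show "Q (\<lambda>x y. h (x - y)) (ereal \<circ> \<phi>) \<in> (\<lambda>f. ereal \<circ> f) ` (convex_funs \<inter> C_b p)"
      "forward_optimal p (\<lambda>x y. h (x - y)) \<mu> \<nu> (Q (\<lambda>x y. h (x - y)) (ereal \<circ> \<phi>))"
      by (rule tc.Q_forward_optimal[OF assms(2,3) conv opt])+
  next
    fix \<psi> :: "'a \<Rightarrow> real"
    assume \<psi>: "\<psi> \<in> convex_funs \<inter> C_b p"
      and opt: "forward_optimal p (\<lambda>x y. h (x - y)) \<mu> \<nu> (ereal \<circ> \<psi>)"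
    have conv: "convex_on UNIV \<psi>" "\<psi> \<in> C_b p" using \<psi> by (auto simp: convex_funs_def)
    note opt_bar = tc.Q_bar_backward_optimal[OF assms(2,3) conv opt]
    show "Q_bar (\<lambda>x y. h (x - y)) (ereal \<circ> \<psi>) \<in> ext_convex_funs \<inter> ext_L1 \<nu>"
      using tc.Q_bar_ext_convex[OF conv(1)] opt_bar(1) by blast
    show "Q_bar (\<lambda>x y. h (x - y)) (ereal \<circ> \<psi>) \<in> (\<lambda>f. ereal \<circ> f) ` (convex_funs \<inter> L1 \<nu>)"
      if "\<forall>y. Q_bar (\<lambda>x y. h (x - y)) (ereal \<circ> \<psi>) y \<noteq> \<infinity>"
      using opt_bar(2)[OF that] .
    show "backward_optimal p (\<lambda>x y. h (x - y)) \<mu> \<nu> (Q_bar (\<lambda>x y. h (x - y)) (ereal \<circ> \<psi>))"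
      by (rule opt_bar(3))
  qed
qed

end
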